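(* Let $\tau$ be the Archimedean tessellation of type $(3^4.6)$, let $\omega=(1+i\sqrt3)/2$, and identify $T_\tau$ with $\mathbb Z[\omega]$. Let $\alpha,\beta\in\mathbb Z[\omega]\setminus\{0\}$ with $\alpha/\beta\notin\mathbb Q$, and let $\tau_{\alpha,\beta}=\tau/\langle\alpha,\beta\rangle$. Let $\gamma=\mathrm{GCD}(\alpha,\beta)$ be a greatest common divisor in $\mathbb Z[\omega]$. Then the map $\tau_\eta$ with $$\eta=\frac{\mathrm{Im}(\overline\alpha\beta)}{N(\gamma)}\,\gamma$$ is the unique minimal almost regular cover of $\tau_{\alpha,\beta}$. Moreover, the number $K_{\min}$ of fundamental regions of $\tau_{\alpha,\beta}$ glued together in order to obtain a fundamental region of $\tau_\eta$ is $$K_{\min}=\frac{|\mathrm{Im}(\overline\alpha\beta)|}{N(\gamma)}.$$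
   Context: The Archimedean tessellation $\tau$ of type $(3^4.6)$ is the vertex-transitive edge-to-edge tessellation of the Euclidean plane by regular polygons with four triangles and one hexagon around each vertex. $\mathrm{Aut}(\tau)$ is the group of isometries preserving $\tau$ and $T_\tau$ is its subgroup of all translations. A toroidal map of this type is a quotient $\tau/G$, where $G\le T_\tau$ is generated by two linearly independent translations; its fundamental region is the parallelogram spanned by a pair of generators of $G$. A flag of $\tau$ is a triple of an incident vertex, edge and face; a flag of $\tau/G$ is a $G$-orbit of flags of $\tau$. $\mathrm{Aut}(\tau/G)\cong \mathrm{Norm}_{\mathrm{Aut}(\tau)}(G)/G$ is the group induced by the normalizer of $G$ in $\mathrm{Aut}(\tau)$. $\tau/G$ is almost regular if its number of flag orbits under $\mathrm{Aut}(\tau/G)$ equals the number of flag orbits of $\tau$ under $\mathrm{Aut}(\tau)$. $\tau/H$ is a cover of $\tau/G$ if $H\le G$; toroidal maps are ordered by $\mathcal M\le\mathcal N$ iff $\mathcal N$ covers $\mathcal M$. A minimal almost regular cover of $\mathcal M$ is a minimal element of the set of almost regular toroidal maps covering $\mathcal M$. When $\tau/H$ covers $\tau/G$, the number of fundamental regions of $\tau/G$ glued together to obtain a fundamental region of $\tau/H$ equals the index $[G:H]$. Coordinates: the plane is given Cartesian coordinates (with suitable scaling, origin at a vertex of $\tau$) such that shortest translational symmetries generating $T_\tau$ are $\mathbf e_1=(1,0)$, $\mathbf e_2=(1/2,\sqrt3/2)$. The translation $u_1\mathbf e_1+u_2\mathbf e_2\in T_\tau$ is identified with $u_1+u_2\omega\in\mathbb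 Z[\omega]=\{a+b\omega: a,b\in\mathbb Z\}$. For $\alpha=a+b\omega\in\mathbb Z[\omega]$: $\overline\alpha=a+b\overline\omega$ is the complex conjugate, $N(\alpha)=\alpha\overline\alpha$, and (non-standard) $\mathrm{Im}\,\alpha:=b$. The GCD in $\mathbb Z[\omega]$ is defined up to multiplication by units; $\tau_\eta$ denotes $\tau_{\eta,\omega\eta}=\tau/\langle\eta,\omega\eta\rangle$ and depends on $\eta$ only up to units. *)

theory Defs
  imports "HOL-Analysis.Analysis" "HOL-Algebra.Group_Action" "HOL-Algebra.Generated_Groups"
begin

section \<open>Tessellations of the plane by regular polygons\<close>

text \<open>The Euclidean plane is \<^typ>\<open>complex\<close>, and a tessellation is given by the set of its faces
  (closed convex regions). The vertices and edges of a face are its extreme points and its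
  one-dimensional faces in the sense of convex geometry.\<close>

definition regular_polygon :: "nat \<Rightarrow> complex set \<Rightarrow> bool" where
  "regular_polygon n P \<longleftrightarrow> n \<ge> 3 \<and>
     (\<exists>c r. r \<noteq> 0 \<and> P = convex hull {c + r * cis (2 * pi * real k / real n) | k. k < n})"

definition vertices :: "complex set set \<Rightarrow> complex set" where
  "vertices \<tau> = {v. \<exists>P\<in>\<tau>. v extreme_point_of P}"

definition tessellation_by_regular_polygons :: "complex set set \<Rightarrow> bool" where
  "tessellation_by_regular_polygons \<tau> \<longleftrightarrow>
     (\<forall>P\<in>\<tau>. \<exists>n. regular_polygon n P) \<and>
     \<Union>\<tau> = UNIV \<and>
     (\<forall>P\<in>\<tau>. \<forall>Q\<in>\<tau>. P \<noteq> Q \<longrightarrow> interior P \<inter> interior Q = {}) \<and>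
     (\<forall>x. \<exists>\<epsilon>>0. finite {P\<in>\<tau>. P \<inter> ball x \<epsilon> \<noteq> {}})"

text \<open>Two distinct faces meet in the empty set, in a common vertex, or in a common edge. The empty
  set counts as a face in \<^const>\<open>face_of\<close>, and \<open>P\<close> itself is excluded by disjointness of interiors.\<close>

definition edge_to_edge :: "complex set set \<Rightarrow> bool" where
  "edge_to_edge \<tau> \<longleftrightarrow>
     (\<forall>P\<in>\<tau>. \<forall>Q\<in>\<tau>. P \<noteq> Q \<longrightarrow> (P \<inter> Q) face_of P \<and> (P \<inter> Q) face_of Q)"

definition isometries :: "(complex \<Rightarrow> complex) set" where
  "isometries = {g. bij g \<and> (\<forall>x y. dist (g x) (g y) = dist x y)}"

definition Aut :: "complex set set \<Rightarrow> (complex \<Rightarrow> complex) monoid" where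
  "Aut \<tau> = \<lparr>carrier = {g \<in> isometries. (\<lambda>P. g ` P) ` \<tau> = \<tau>}, mult = (\<circ>), one = id\<rparr>"

definition vertex_transitive :: "complex set set \<Rightarrow> bool" where
  "vertex_transitive \<tau> \<longleftrightarrow>
     (\<forall>u\<in>vertices \<tau>. \<forall>v\<in>vertices \<tau>. \<exists>g\<in>carrier (Aut \<tau>). g u = v)"

text \<open>The type \<open>(3\<^sup>4.6)\<close>. Counting the faces at a vertex suffices, since four triangles and one
  hexagon admit only one cyclic arrangement. Both mirror images of the tessellation qualify.\<close>

definition archimedean_3_3_3_3_6 :: "complex set set \<Rightarrow> bool" where
  "archimedean_3_3_3_3_6 \<tau> \<longleftrightarrow>
     tessellation_by_regular_polygons \<tau> \<and> edge_to_edge \<tau> \<and> vertex_transitive \<tau> \<and>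
     (\<forall>v\<in>vertices \<tau>.
        (\<forall>P\<in>\<tau>. v extreme_point_of P \<longrightarrow> regular_polygon 3 P \<or> regular_polygon 6 P) \<and>
        card {P\<in>\<tau>. v extreme_point_of P \<and> regular_polygon 3 P} = 4 \<and>
        card {P\<in>\<tau>. v extreme_point_of P \<and> regular_polygon 6 P} = 1)"


section \<open>Toroidal maps\<close>

text \<open>The translation by \<open>t\<close> is the function \<open>(+) t\<close>.\<close>

definition translation_group :: "complex set set \<Rightarrow> (complex \<Rightarrow> complex) set" where
  "translation_group \<tau> = {g \<in> carrier (Aut \<tau>). \<exists>t. g = (+) t}"

text \<open>The subgroup \<open>\<langle>s, t\<rangle>\<close> generated by the translations by \<open>s\<close> and \<open>t\<close>.\<close>

definition trans_gen :: "complex set set \<Rightarrow> complex \<Rightarrow> complex \<Rightarrow> (complex \<Rightarrow> complex) set" where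
  "trans_gen \<tau> s t = generate (Aut \<tau>) {(+) s, (+) t}"

text \<open>A toroidal map \<open>\<tau>/G\<close> is represented by the group \<open>G\<close>, which is determined by the quotient
  (as any \<open>G\<close>-orbit of flags determines \<open>G\<close>).\<close>

definition toroidal :: "complex set set \<Rightarrow> (complex \<Rightarrow> complex) set \<Rightarrow> bool" where
  "toroidal \<tau> G \<longleftrightarrow>
     (\<exists>s t. (+) s \<in> translation_group \<tau> \<and> (+) t \<in> translation_group \<tau> \<and>
            s \<noteq> t \<and> independent {s, t} \<and> G = trans_gen \<tau> s t)"

type_synonym flag = "complex \<times> complex set \<times> complex set"

definition flags :: "complex set set \<Rightarrow> flag set" where
  "flags \<tau> = {(v, e, P). P \<in> \<tau> \<and> e edge_of P \<and> v extreme_point_of e}"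

definition flag_act :: "(complex \<Rightarrow> complex) \<Rightarrow> flag \<Rightarrow> flag" where
  "flag_act g = (\<lambda>(v, e, P). (g v, g ` e, g ` P))"

text \<open>The flags of \<open>\<tau>/G\<close> are the \<open>G\<close>-orbits of flags of \<open>\<tau>\<close>, and \<open>Aut(\<tau>/G)\<close> is \<open>Norm(G)/G\<close>, where
  the coset \<open>G \<circ> n\<close> maps the orbit of \<open>\<Phi>\<close> to the orbit of \<open>n \<Phi>\<close>.\<close>

definition quotient_flags :: "complex set set \<Rightarrow> (complex \<Rightarrow> complex) set \<Rightarrow> flag set set" where
  "quotient_flags \<tau> G = orbits ((Aut \<tau>)\<lparr>carrier := G\<rparr>) (flags \<tau>) flag_act"

definition quotient_Aut ::
    "complex set set \<Rightarrow> (complex \<Rightarrow> complex) set \<Rightarrow> (complex \<Rightarrow> complex) set monoid" where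
  "quotient_Aut \<tau> G = (Aut \<tau>)\<lparr>carrier := normalizer (Aut \<tau>) G\<rparr> Mod G"

definition quotient_flag_act :: "(complex \<Rightarrow> complex) set \<Rightarrow> flag set \<Rightarrow> flag set" where
  "quotient_flag_act C \<Phi> = (\<Union>g\<in>C. flag_act g ` \<Phi>)"

definition almost_regular :: "complex set set \<Rightarrow> (complex \<Rightarrow> complex) set \<Rightarrow> bool" where
  "almost_regular \<tau> G \<longleftrightarrow> toroidal \<tau> G \<and>
     card (orbits (quotient_Aut \<tau> G) (quotient_flags \<tau> G) quotient_flag_act)
       = card (orbits (Aut \<tau>) (flags \<tau>) flag_act)"

text \<open>\<open>covers \<tau> H G\<close> says that \<open>\<tau>/H\<close> is a cover of \<open>\<tau>/G\<close>, that is, \<open>\<tau>/G \<le> \<tau>/H\<close> in the order on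
  toroidal maps.\<close>

definition covers ::
    "complex set set \<Rightarrow> (complex \<Rightarrow> complex) set \<Rightarrow> (complex \<Rightarrow> complex) set \<Rightarrow> bool" where
  "covers \<tau> H G \<longleftrightarrow> toroidal \<tau> H \<and> toroidal \<tau> G \<and> H \<subseteq> G"

definition minimal_almost_regular_cover ::
    "complex set set \<Rightarrow> (complex \<Rightarrow> complex) set \<Rightarrow> (complex \<Rightarrow> complex) set \<Rightarrow> bool" where
  "minimal_almost_regular_cover \<tau> H G \<longleftrightarrow>
     almost_regular \<tau> H \<and> covers \<tau> H G \<and>
     (\<forall>K. almost_regular \<tau> K \<and> covers \<tau> K G \<and> covers \<tau> H K \<longrightarrow> K = H)"

text \<open>When \<open>\<tau>/H\<close> covers \<open>\<tau>/G\<close>, the number of fundamental regions of \<open>\<tau>/G\<close> that are glued together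
  to obtain a fundamental region of \<open>\<tau>/H\<close> is the index \<open>[G : H]\<close>.\<close>

definition glued_regions ::
    "complex set set \<Rightarrow> (complex \<Rightarrow> complex) set \<Rightarrow> (complex \<Rightarrow> complex) set \<Rightarrow> nat" where
  "glued_regions \<tau> H G = card (rcosets\<^bsub>(Aut \<tau>)\<lparr>carrier := G\<rparr>\<^esub> H)"


section \<open>The ring \<open>\<int>[\<omega>]\<close>\<close>

definition omega :: complex (\<open>\<omega>\<close>) where
  "\<omega> = (1 + \<i> * complex_of_real (sqrt 3)) / 2"

definition Z_omega :: "complex set" where
  "Z_omega = {of_int a + of_int b * \<omega> | a b :: int. True}"

text \<open>The coefficient of \<open>\<omega>\<close>, not the usual imaginary part.\<close>

definition Im_omega :: "complex \<Rightarrow> int" where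
  "Im_omega z = (THE b. \<exists>a::int. z = of_int a + of_int b * \<omega>)"

definition N_omega :: "complex \<Rightarrow> complex" where
  "N_omega z = z * cnj z"

definition dvd_omega :: "complex \<Rightarrow> complex \<Rightarrow> bool" where
  "dvd_omega x y \<longleftrightarrow> (\<exists>z\<in>Z_omega. y = x * z)"

definition is_gcd_omega :: "complex \<Rightarrow> complex \<Rightarrow> complex \<Rightarrow> bool" where
  "is_gcd_omega g x y \<longleftrightarrow> g \<in> Z_omega \<and> dvd_omega g x \<and> dvd_omega g y \<and>
     (\<forall>d\<in>Z_omega. dvd_omega d x \<and> dvd_omega d y \<longrightarrow> dvd_omega d g)"

end

theory Submission
  imports Defs "HOL-Algebra.Zassenhaus"
begin

text \<open>The theorem splits into a geometric and an arithmetic half.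

  \<^bold>\<open>Geometry.\<close> What matters about the tessellation is its point group: the linear parts of the
  automorphisms are exactly the multiplications by the six units of \<open>\<int>[\<omega>]\<close>. Walking around a
  corner of a hexagon, each edge leads to the next face, and this determines the four triangles
  there; hence all vertices and hexagon centres near a hexagon lie on one triangular lattice. Every
  vertex belongs to exactly one hexagon, so that the hexagon centres form a \<^emph>\<open>perfect code\<close> of the
  lattice: each lattice point is at distance at most one from exactly one centre. Up to a
  translation, a perfect code is one of two mirror-image sublattices of index 7, the ideals
  generated by \<open>2 + \<omega>\<close> and by its conjugate. An orientation-reversing automorphism would exchange the two, so there is none
  (\<open>no_opposite_automorphism\<close>). Given this, an automorphism that moves one corner of a hexagon to the
  next one can only be a rotation by 60 degrees (\<open>sixfold_rotation\<close>).

  An automorphism that fixes a flag is now the identity, and there are finitely many flag orbits.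
  Therefore \<open>\<tau>/G\<close> has as few flag orbits as \<open>\<tau>\<close> iff every automorphism normalizes \<open>G\<close>
  (\<open>almost_regular_iff_normal\<close>), that is, iff the lattice of translation vectors of \<open>G\<close> is closed
  under multiplication by \<open>\<omega>\<close> and so is an ideal (\<open>almost_regular_iff\<close>).

  \<^bold>\<open>Arithmetic.\<close> What remains is to find the largest ideal in the lattice \<open>\<int>\<alpha> + \<int>\<beta>\<close>. Dividing by \<open>\<gamma>\<close>
  reduces to coprime \<open>\<alpha>'\<close>, \<open>\<beta>'\<close>, with \<open>D = Im (cnj \<alpha>' * \<beta>')\<close> the determinant of their coordinates;
  then \<open>\<eta> = D \<gamma>\<close>. By Cramer's rule \<open>\<eta>\<close> and \<open>\<omega>\<eta>\<close> are in the lattice. Conversely, if \<open>x\<close> and \<open>\<omega>x\<close>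
  are in the lattice spanned by \<open>\<alpha>'\<close> and \<open>\<beta>'\<close>, then both \<open>cnj \<alpha>' * x\<close> and \<open>cnj \<beta>' * x\<close> are divisible
  by \<open>D\<close>, and by Bezout so is \<open>x\<close> (\<open>span_closed_multiple_of_eta\<close>). So every almost regular cover covers
  \<open>\<tau>\<^sub>\<eta>\<close>, which makes \<open>\<tau>\<^sub>\<eta>\<close> the unique minimal one, and the index is the determinant \<open>\<bar>D\<bar>\<close> of the
  coordinates of \<open>\<eta>\<close>, \<open>\<omega>\<eta>\<close> with respect to \<open>\<alpha>\<close>, \<open>\<beta>\<close> (\<open>glued_regions_det\<close>).\<close>

section \<open>The ring \<open>\<int>[\<omega>]\<close> and its units\<close>

definition units6 :: "complex set" where
  "units6 = {1, \<omega>, \<omega> - 1, -1, -\<omega>, 1 - \<omega>}"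

lemma omega_sq: "\<omega> * \<omega> = \<omega> - 1"
  by (simp add: omega_def complex_eq_iff field_simps)

lemma omega_sq_left: "\<omega> * (\<omega> * x) = \<omega> * x - x"
  by (simp add: mult.assoc[symmetric] omega_sq algebra_simps)

lemma omega_power2: "\<omega>\<^sup>2 = \<omega> - 1"
  by (simp add: power2_eq_square omega_sq)

lemma omega_power3: "\<omega> ^ 3 = -1"
  by (simp add: power3_eq_cube omega_sq algebra_simps)

lemma cnj_omega: "cnj \<omega> = 1 - \<omega>"
  by (simp add: omega_def complex_eq_iff field_simps)

lemma omega_mult_cnj: "\<omega> * cnj \<omega> = 1" "\<omega> * (1 - \<omega>) = 1"
  by (simp_all add: cnj_omega omega_sq algebra_simps)

lemma norm_omega [simp]: "norm \<omega> = 1"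
  by (simp add: omega_def cmod_def power2_eq_square divide_simps)

lemma Im_omega_pos: "Im \<omega> > 0"
  by (simp add: omega_def)

lemma omega_coords_eq_iff:
  fixes a b c d :: real
  shows "of_real a + of_real b * \<omega> = of_real c + of_real d * \<omega> \<longleftrightarrow> a = c \<and> b = d"
  using Im_omega_pos by (auto simp: complex_eq_iff)

lemma omega_int_coords_eq_iff [simp]:
  "of_int a + of_int b * \<omega> = of_int c + of_int d * \<omega> \<longleftrightarrow> a = c \<and> b = d"
  using omega_coords_eq_iff[of "of_int a" "of_int b" "of_int c" "of_int d"] by simp

lemma Z_omegaI: "of_int a + of_int b * \<omega> \<in> Z_omega"
  by (auto simp: Z_omega_def)

lemma Z_omega_of_int [simp]: "of_int a \<in> Z_omega" "0 \<in> Z_omega" "1 \<in> Z_omega" "\<omega> \<in> Z_omega"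
  using Z_omegaI[of a 0] Z_omegaI[of 0 0] Z_omegaI[of 1 0] Z_omegaI[of 0 1] by simp_all

lemma Z_omega_add: "x \<in> Z_omega \<Longrightarrow> y \<in> Z_omega \<Longrightarrow> x + y \<in> Z_omega"
proof -
  assume "x \<in> Z_omega" "y \<in> Z_omega"
  then obtain a b c d :: int where "x = of_int a + of_int b * \<omega>" "y = of_int c + of_int d * \<omega>"
    by (auto simp: Z_omega_def)
  then have "x + y = of_int (a + c) + of_int (b + d) * \<omega>"
    by (simp add: algebra_simps)
  then show ?thesis by (simp only: Z_omegaI)
qed

lemma Z_omega_mult: "x \<in> Z_omega \<Longrightarrow> y \<in> Z_omega \<Longrightarrow> x * y \<in> Z_omega"
proof -
  assume "x \<in> Z_omega" "y \<in> Z_omega"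
  then obtain a b c d :: int where "x = of_int a + of_int b * \<omega>" "y = of_int c + of_int d * \<omega>"
    by (auto simp: Z_omega_def)
  then have "x * y = of_int (a * c) + of_int (a * d + b * c) * \<omega> + of_int (b * d) * (\<omega> * \<omega>)"
    by (simp add: algebra_simps)
  also have "\<dots> = of_int (a * c - b * d) + of_int (a * d + b * c + b * d) * \<omega>"
    by (simp add: omega_sq algebra_simps)
  finally show ?thesis by (simp only: Z_omegaI)
qed

lemma Z_omega_uminus: "x \<in> Z_omega \<Longrightarrow> - x \<in> Z_omega"
  using Z_omega_mult[of "of_int (-1)" x] Z_omega_of_int(1)[of "-1"] by simp

lemma Z_omega_diff: "x \<in> Z_omega \<Longrightarrow> y \<in> Z_omega \<Longrightarrow> x - y \<in> Z_omega"
  using Z_omega_add[of x "- y"] Z_omega_uminus[of y] by simp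

lemma Z_omega_cnj: "x \<in> Z_omega \<Longrightarrow> cnj x \<in> Z_omega"
proof -
  assume "x \<in> Z_omega"
  then obtain a b :: int where x: "x = of_int a + of_int b * \<omega>"
    by (auto simp: Z_omega_def)
  show ?thesis
    by (simp add: x cnj_omega Z_omega_add Z_omega_mult Z_omega_diff)
qed

lemmas Z_omega_closed = Z_omega_add Z_omega_mult Z_omega_uminus Z_omega_diff Z_omega_cnj

lemma omega_neq [simp]: "\<omega> \<noteq> 0" "\<omega> \<noteq> 1" "1 \<noteq> \<omega>" "\<omega> \<noteq> -1"
  using Im_omega_pos by (auto simp: complex_eq_iff)

lemma norm_squared_omega_coords:
  "(norm (of_int a + of_int b * \<omega>))\<^sup>2 = of_int (a\<^sup>2 + a * b + b\<^sup>2)"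
  by (simp only: cmod_power2) (simp add: omega_def power2_eq_square field_simps)

text \<open>For a unit with coordinates \<open>a\<close>, \<open>b\<close> the norm form gives \<open>(2a + b)\<^sup>2 + 3b\<^sup>2 = 4\<close>, and the same
  with \<open>a\<close> and \<open>b\<close> exchanged, so both coordinates are at most 1 in absolute value.\<close>

lemma units6_iff: "u \<in> units6 \<longleftrightarrow> u \<in> Z_omega \<and> norm u = 1"
proof
  have "norm (\<omega> - 1) = 1"
    by (simp add: omega_power2[symmetric] norm_power)
  then show "u \<in> units6 \<Longrightarrow> u \<in> Z_omega \<and> norm u = 1"
    by (auto simp: units6_def norm_minus_commute Z_omega_closed)
next
  assume u: "u \<in> Z_omega \<and> norm u = 1"
  then obtain a b :: int where ab: "u = of_int a + of_int b * \<omega>"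
    by (auto simp: Z_omega_def)
  have eq: "a\<^sup>2 + a * b + b\<^sup>2 = 1"
  proof -
    have "real_of_int (a\<^sup>2 + a * b + b\<^sup>2) = 1"
      using u norm_squared_omega_coords[of a b, unfolded ab[symmetric]] by simp
    then show ?thesis by (simp only: of_int_eq_1_iff)
  qed
  have "(2 * a + b)\<^sup>2 + 3 * b\<^sup>2 = 4" "(2 * b + a)\<^sup>2 + 3 * a\<^sup>2 = 4"
    using eq by (simp_all add: power2_eq_square algebra_simps)
  then have "b\<^sup>2 \<le> 1" "a\<^sup>2 \<le> 1"
    using zero_le_power2[of "2 * a + b"] zero_le_power2[of "2 * b + a"] by linarith+
  then have "a \<in> {-1, 0, 1}" "b \<in> {-1, 0, 1}"
    by (auto simp: abs_le_square_iff[of _ 1, simplified, symmetric])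
  with eq show "u \<in> units6"
    by (auto simp: ab units6_def)
qed

lemma units6_nonzero: "u \<in> units6 \<Longrightarrow> u \<noteq> 0"
  by (auto simp: units6_iff)

lemma units6_mult: "u \<in> units6 \<Longrightarrow> v \<in> units6 \<Longrightarrow> u * v \<in> units6"
  by (auto simp: units6_iff norm_mult Z_omega_closed)

lemma units6_uminus: "u \<in> units6 \<Longrightarrow> - u \<in> units6"
  by (auto simp: units6_iff Z_omega_closed)

lemma units6_cnj: "u \<in> units6 \<Longrightarrow> cnj u \<in> units6"
  by (auto simp: units6_iff Z_omega_closed)

lemma units6_mult_cnj: "u \<in> units6 \<Longrightarrow> u * cnj u = 1"
  by (auto simp: units6_iff complex_norm_square[symmetric])

lemma one_units6 [simp]: "1 \<in> units6"
  by (simp add: units6_def)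

lemma units6_iff_omega_power: "u \<in> units6 \<longleftrightarrow> (\<exists>k<6. u = \<omega> ^ k)"
proof -
  have "{k::nat. k < 6} = {0,1,2,3,4,5}" by auto
  moreover have "\<omega> ^ 4 = - \<omega>" "\<omega> ^ 5 = 1 - \<omega>"
    using omega_power3 by (simp_all add: eval_nat_numeral omega_sq algebra_simps)
  ultimately have "(\<lambda>k. \<omega> ^ k) ` {k. k < 6} = units6"
    by (auto simp: units6_def omega_power2 omega_power3)
  then show ?thesis by (auto simp: image_iff set_eq_iff)
qed

lemma finite_units6 [simp]: "finite units6"
  by (simp add: units6_def)

lemma units6_Z_omega: "u \<in> units6 \<Longrightarrow> u \<in> Z_omega"
  by (simp add: units6_iff)

text \<open>The lattice is connected by unit steps: properties spread from a point to all six neighbours.\<close>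

lemma Z_omega_unit_induct [consumes 1, case_names zero step]:
  assumes z: "z \<in> Z_omega" and "P 0" and step: "\<And>z u. \<lbrakk>z \<in> Z_omega; P z; u \<in> units6\<rbrakk> \<Longrightarrow> P (z + u)"
  shows "P z"
proof -
  have u: "1 \<in> units6" "-1 \<in> units6" "\<omega> \<in> units6" "-\<omega> \<in> units6" by (simp_all add: units6_def)
  have x: "P (of_int a)" for a
  proof (induction a rule: int_induct[of _ 0])
    case (step1 i)
    show ?case using step[OF _ step1(2) u(1)] by simp
  next
    case (step2 i)
    show ?case using step[OF _ step2(2) u(2)] by simp
  qed (use \<open>P 0\<close> in simp)
  have "P (of_int a + of_int b * \<omega>)" for a b
  proof (induction b rule: int_induct[of _ 0])
    case (step1 i)
    show ?case using step[OF _ step1(2) u(3)] Z_omegaI by (simp add: algebra_simps)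
  next
    case (step2 i)
    show ?case using step[OF _ step2(2) u(4)] Z_omegaI by (simp add: algebra_simps)
  qed (use x in simp)
  then show ?thesis using z by (auto simp: Z_omega_def)
qed

text \<open>Taking \<open>\<zeta>\<close> to be \<open>\<omega>\<close> or its conjugate treats the two mirror images of the tessellation at once.\<close>

lemma Z_omega_basis:
  assumes "\<zeta> \<in> {\<omega>, cnj \<omega>}"
  shows "z \<in> Z_omega \<longleftrightarrow> (\<exists>a b :: int. z = of_int a + of_int b * \<zeta>)"
proof -
  have "\<exists>c d :: int. of_int a + of_int b * \<omega> = of_int c + of_int d * (1 - \<omega>)"
    "\<exists>c d :: int. of_int a + of_int b * (1 - \<omega>) = of_int c + of_int d * \<omega>" for a b :: int
    by (rule exI[of _ "a + b"], rule exI[of _ "- b"], simp add: algebra_simps)+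
  then show ?thesis
    using assms by (fastforce simp: Z_omega_def cnj_omega)
qed

lemma Z_omega_basis_unique:
  assumes "\<zeta> \<in> {\<omega>, cnj \<omega>}" and eq: "of_int a + of_int b * \<zeta> = of_int c + of_int d * \<zeta>"
  shows "a = c \<and> b = d"
proof (cases "\<zeta> = \<omega>")
  case False
  then have \<zeta>: "\<zeta> = 1 - \<omega>" using assms(1) by (simp add: cnj_omega)
  have "of_int (a + b) + of_int (- b) * \<omega> = of_int (c + d) + of_int (- d) * \<omega>"
    using eq by (simp add: \<zeta> algebra_simps)
  then show ?thesis unfolding omega_int_coords_eq_iff by simp
qed (use eq in simp)

lemma zeta_sq:
  assumes "\<zeta> \<in> {\<omega>, cnj \<omega>}"
  shows "\<zeta> * \<zeta> = \<zeta> - 1" "\<zeta> \<in> units6"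
proof -
  show "\<zeta> * \<zeta> = \<zeta> - 1"
    using assms by (auto simp: cnj_omega left_diff_distrib right_diff_distrib omega_sq)
  show "\<zeta> \<in> units6"
    using assms by (auto simp: units6_def cnj_omega)
qed

text \<open>Walking around a corner of a hexagon, these facts show that the edges between two triangles do not end in
  another corner of that hexagon.\<close>

lemma not_units6: "1 + \<omega> \<notin> units6" "1 + 1 \<notin> units6" "1 + (1 - \<omega>) \<notin> units6"
proof -
  have *: "of_int a + of_int b * \<omega> \<in> units6 \<longleftrightarrow> a\<^sup>2 + a * b + b\<^sup>2 = 1" for a b
  proof -
    have "of_int a + of_int b * \<omega> \<in> units6 \<longleftrightarrow> (norm (of_int a + of_int b * \<omega>))\<^sup>2 = 1"
      by (simp add: units6_iff Z_omegaI abs_square_eq_1)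
    then show ?thesis unfolding norm_squared_omega_coords by (simp only: of_int_eq_1_iff)
  qed
  show "1 + \<omega> \<notin> units6" "1 + 1 \<notin> units6" "1 + (1 - \<omega>) \<notin> units6"
    using *[of 1 1] *[of 2 0] *[of 2 "-1"] by simp_all
qed

section \<open>Perfect codes in the triangular lattice\<close>

text \<open>In coordinates with respect to \<open>1\<close> and \<open>\<zeta>\<close>, these are the origin and its six neighbours in the
  triangular lattice.\<close>

definition close6 :: "int \<Rightarrow> int \<Rightarrow> bool" where
  "close6 i j \<longleftrightarrow> (i, j) \<in> {(0,0), (1,0), (-1,0), (0,1), (0,-1), (1,-1), (-1,1)}"

text \<open>A perfect code of the graph whose vertices are the points of \<open>\<int>[\<omega>]\<close> and whose edges join points
  at distance 1: the closed unit balls around the code points partition the lattice.\<close>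

definition perfect_code :: "complex set \<Rightarrow> bool" where
  "perfect_code L \<longleftrightarrow> L \<subseteq> Z_omega \<and> (\<forall>z\<in>Z_omega. \<exists>!c. c \<in> L \<and> c - z \<in> insert 0 units6)"

lemma close6_iff:
  assumes "\<zeta> \<in> {\<omega>, cnj \<omega>}"
  shows "close6 i j \<longleftrightarrow> of_int i + of_int j * \<zeta> \<in> insert 0 units6"
proof -
  have *: "of_int i + of_int j * \<omega> \<in> insert 0 units6 \<longleftrightarrow>
     (i, j) \<in> {(0,0), (1,0), (-1,0), (0,1), (0,-1), (1,-1), (-1,1)}" for i j
    using omega_int_coords_eq_iff[of i j 0 0] omega_int_coords_eq_iff[of i j 1 0]
      omega_int_coords_eq_iff[of i j "-1" 0] omega_int_coords_eq_iff[of i j 0 1]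
      omega_int_coords_eq_iff[of i j 0 "-1"] omega_int_coords_eq_iff[of i j 1 "-1"]
      omega_int_coords_eq_iff[of i j "-1" 1]
    by (auto simp: units6_def)
  have **: "of_int i + of_int j * (1 - \<omega>) = of_int (i + j) + of_int (- j) * \<omega>"
    by (simp add: algebra_simps)
  have "of_int i + of_int j * (1 - \<omega>) \<in> insert 0 units6 \<longleftrightarrow>
     (i, j) \<in> {(0,0), (1,0), (-1,0), (0,1), (0,-1), (1,-1), (-1,1)}"
    unfolding ** * unfolding insert_iff empty_iff prod.inject by presburger
  then show ?thesis
    using assms * unfolding close6_def by (elim insertE emptyE) (simp_all only: cnj_omega)
qed

lemma perfect_codeD:
  assumes "perfect_code L"
  shows "L \<subseteq> Z_omega"
    and "\<And>z. z \<in> Z_omega \<Longrightarrow> \<exists>c\<in>L. c - z \<in> insert 0 units6"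
    and "\<And>z c c'. \<lbrakk>z \<in> Z_omega; c \<in> L; c' \<in> L; c - z \<in> insert 0 units6; c' - z \<in> insert 0 units6\<rbrakk> \<Longrightarrow> c = c'"
  using assms unfolding perfect_code_def by blast+

text \<open>The code is viewed from the point \<open>p\<close> after a rotation by \<open>u\<close> and, for \<open>\<zeta> = cnj \<omega>\<close>, a reflection.
  The same combinatorial argument then applies in all twelve positions.\<close>

lemma perfect_code_local_coords:
  assumes L: "perfect_code L" and \<zeta>: "\<zeta> \<in> {\<omega>, cnj \<omega>}" and p: "p \<in> Z_omega" and u: "u \<in> units6"
  defines "M \<equiv> \<lambda>a b :: int. p + u * (of_int a + of_int b * \<zeta>) \<in> L"
  shows "\<And>a b. \<exists>i j. close6 i j \<and> M (a + i) (b + j)"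
    and "\<And>a b a' b' i j. \<lbrakk>M a b; M a' b'; close6 (a - i) (b - j); close6 (a' - i) (b' - j)\<rbrakk> \<Longrightarrow> a = a' \<and> b = b'"
proof -
  note uinv = units6_mult_cnj[OF u]
  fix a b :: int
  have Z: "p + u * (of_int a + of_int b * \<zeta>) \<in> Z_omega" for a b :: int
    using p u \<zeta> by (auto simp: Z_omega_closed units6_iff)
  obtain c where c: "c \<in> L" "c - (p + u * (of_int a + of_int b * \<zeta>)) \<in> insert 0 units6"
    using perfect_codeD(2)[OF L Z] by blast
  have "cnj u * (c - p) \<in> Z_omega"
    using perfect_codeD(1)[OF L] c(1) p u by (auto simp: Z_omega_closed units6_iff)
  then obtain i j :: int where ij: "cnj u * (c - p) = of_int i + of_int j * \<zeta>"
    using Z_omega_basis[OF \<zeta>] by blast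
  have "c - p = u * (of_int i + of_int j * \<zeta>)"
    by (metis ij uinv mult.assoc mult_1)
  then have ceq: "c = p + u * (of_int i + of_int j * \<zeta>)"
    by (simp add: algebra_simps)
  have "cnj u * (c - (p + u * (of_int a + of_int b * \<zeta>))) \<in> insert 0 units6"
    using c(2) units6_mult[OF units6_cnj[OF u]] by auto
  also have "cnj u * (c - (p + u * (of_int a + of_int b * \<zeta>)))
      = (u * cnj u) * (of_int (i - a) + of_int (j - b) * \<zeta>)"
    unfolding ceq by (simp add: algebra_simps)
  finally have "close6 (i - a) (j - b)"
    using close6_iff[OF \<zeta>] uinv by simp
  then show "\<exists>i j. close6 i j \<and> M (a + i) (b + j)"
    using c(1) ceq by (intro exI[of _ "i - a"] exI[of _ "j - b"]) (simp add: M_def)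
next
  note uinv = units6_mult_cnj[OF u]
  fix a b a' b' i j :: int
  assume *: "M a b" "M a' b'" "close6 (a - i) (b - j)" "close6 (a' - i) (b' - j)"
  have diff: "p + u * (of_int a + of_int b * \<zeta>) - (p + u * (of_int i + of_int j * \<zeta>)) \<in> insert 0 units6"
    if "close6 (a - i) (b - j)" for a b
  proof -
    have "u * (of_int (a - i) + of_int (b - j) * \<zeta>) \<in> insert 0 units6"
      using that close6_iff[OF \<zeta>] units6_mult[OF u] by auto
    then show ?thesis by (simp add: algebra_simps)
  qed
  have "p + u * (of_int i + of_int j * \<zeta>) \<in> Z_omega"
    using p u \<zeta> by (auto simp: Z_omega_closed units6_iff)
  then have "p + u * (of_int a + of_int b * \<zeta>) = p + u * (of_int a' + of_int b' * \<zeta>)"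
    using perfect_codeD(3)[OF L] * diff unfolding M_def by blast
  then have "of_int a + of_int b * \<zeta> = of_int a' + of_int b' * \<zeta>"
    using units6_nonzero[OF u] by simp
  then show "a = a' \<and> b = b'"
    using Z_omega_basis_unique[OF \<zeta>] by blast
qed

text \<open>The point \<open>(0, 2)\<close> must be covered. All of its neighbours other than \<open>(-1, 3)\<close> and \<open>(0, 3)\<close>, and the
  point itself, are too close to one of the code points \<open>(0, 0)\<close> and \<open>(2, 1)\<close>. But if \<open>(0, 3)\<close> were in
  the code, then nothing could cover \<open>(-1, 2)\<close>.\<close>

lemma perfect_code_turn:
  fixes M :: "int \<Rightarrow> int \<Rightarrow> bool"
  assumes ex: "\<And>a b. \<exists>i j. close6 i j \<and> M (a + i) (b + j)"
    and un: "\<And>a b a' b' i j. \<lbrakk>M a b; M a' b'; close6 (a - i) (b - j); close6 (a' - i) (b' - j)\<rbrakk> \<Longrightarrow> a = a' \<and> b = b'"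
    and M: "M 0 0" "M 2 1"
  shows "M (-1) 3"
proof (rule ccontr)
  assume n: "\<not> M (-1) 3"
  \<comment> \<open>A point \<open>(i, j)\<close> that is covered by a known code point is not covered by any other one.\<close>
  have no0: "\<not> M a b" if "close6 (a - i) (b - j)" "close6 (0 - i) (0 - j)" "(a, b) \<noteq> (0,0)" for a b i j
    using un[OF _ M(1), of a b i j] that by auto
  have no2: "\<not> M a b" if "close6 (a - i) (b - j)" "close6 (2 - i) (1 - j)" "(a, b) \<noteq> (2,1)" for a b i j
    using un[OF _ M(2), of a b i j] that by auto
  have "\<not> M 1 2" by (rule no2[of _ 1 _ 1]) (auto simp: close6_def)
  moreover have "\<not> M 1 1" by (rule no0[of _ 1 _ 0]) (auto simp: close6_def)
  moreover have "\<not> M (-1) 2" by (rule no0[of _ 0 _ 1]) (auto simp: close6_def)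
  moreover have "\<not> M 0 1" by (rule no0[of _ 0 _ 1]) (auto simp: close6_def)
  moreover have "\<not> M 0 2" by (rule no0[of _ 0 _ 1]) (auto simp: close6_def)
  ultimately have M03: "M 0 3"
    using ex[of 0 2] n by (auto simp: close6_def)
  have no3: "\<not> M a b" if "close6 (a - i) (b - j)" "close6 (0 - i) (3 - j)" "(a, b) \<noteq> (0,3)" for a b i j
    using un[OF _ M03, of a b i j] that by auto
  have "\<not> M (-2) 2" by (rule no0[of _ "-1" _ 1]) (auto simp: close6_def)
  moreover have "\<not> M (-1) 1" by (rule no0[of _ 0 _ 1]) (auto simp: close6_def)
  moreover have "\<not> M (-2) 3" by (rule no3[of _ "-1" _ 3]) (auto simp: close6_def)
  ultimately show False
    using ex[of "-1" 2] n \<open>\<not> M (-1) 2\<close> \<open>\<not> M 0 2\<close> \<open>\<not> M 0 1\<close> by (auto simp: close6_def)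
qed

text \<open>In complex coordinates the lemma turns a step of the code by 60 degrees, as
  \<open>\<zeta> * (2 + \<zeta>) = -1 + 3\<zeta>\<close>.\<close>

lemma perfect_code_turn_complex:
  assumes L: "perfect_code L" and \<zeta>: "\<zeta> \<in> {\<omega>, cnj \<omega>}"
    and that: "p \<in> L" "u \<in> units6" "p + u * (2 + \<zeta>) \<in> L"
  shows "p + u * \<zeta> * (2 + \<zeta>) \<in> L"
proof -
  have pZ: "p \<in> Z_omega" using that(1) perfect_codeD(1)[OF L] by auto
  define M where "M a b \<longleftrightarrow> p + u * (of_int a + of_int b * \<zeta>) \<in> L" for a b :: int
  have "M (-1) 3"
  proof (rule perfect_code_turn)
    show "\<exists>i j. close6 i j \<and> M (a + i) (b + j)" for a b
      unfolding M_def by (rule perfect_code_local_coords(1)[OF L \<zeta> pZ that(2)])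
    show "a = a' \<and> b = b'" if "M a b" "M a' b'" "close6 (a - i) (b - j)" "close6 (a' - i) (b' - j)" for a b a' b' i j
      using that(1,2) unfolding M_def by (rule perfect_code_local_coords(2)[OF L \<zeta> pZ \<open>u \<in> units6\<close> _ _ that(3,4)])
    show "M 0 0" "M 2 1" using that by (simp_all add: M_def)
  qed
  then have "p + u * (of_int (-1) + of_int 3 * \<zeta>) \<in> L" by (simp add: M_def)
  moreover have "\<zeta> * (2 + \<zeta>) = of_int (-1) + of_int 3 * \<zeta>"
    using zeta_sq(1)[OF \<zeta>] by (simp add: algebra_simps)
  ultimately show ?thesis by (simp add: mult.assoc)
qed

text \<open>Only \<open>2 + \<omega>\<close> or its mirror image \<open>1 + 2\<omega>\<close> can cover \<open>1 + \<omega>\<close>; this choice is the chirality. Turning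
  gives all six steps of the same kind around the origin, and the chirality passes to a neighbouring code point
  because the step back is one of its own steps. So the code contains the ideal generated by \<open>2 + \<zeta>\<close>.
  Since this ideal already covers the lattice, it is the whole code. A step of the other kind is
  impossible, as its end point and that of a step of the first kind have a common neighbour.\<close>

lemma perfect_code_chirality:
  assumes L: "perfect_code L" and "0 \<in> L"
  shows "\<exists>\<zeta>\<in>{\<omega>, cnj \<omega>}. \<forall>z\<in>L. \<forall>u\<in>units6. z + u * (2 + \<zeta>) \<in> L \<and> z + u * (2 + cnj \<zeta>) \<notin> L"
proof -
  have "\<exists>\<zeta>\<in>{\<omega>, cnj \<omega>}. 2 + \<zeta> \<in> L"
  proof -
    have w: "\<omega> \<in> {\<omega>, cnj \<omega>}" by simp
    note M = perfect_code_local_coords[OF L w Z_omega_of_int(2) one_units6, unfolded add_0 mult_1]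
    obtain i j where ij: "close6 i j" "of_int (1 + i) + of_int (1 + j) * \<omega> \<in> L"
      using M(1)[of 1 1] by blast
    have no: False if "of_int a + of_int b * \<omega> \<in> L" "close6 (a - i) (b - j)" "close6 (0 - i) (0 - j)"
      "(a, b) \<noteq> (0,0)" for a b i j
      using M(2)[OF that(1) _ that(2,3)] that(4) \<open>0 \<in> L\<close> by simp
    have "(i, j) = (1, 0) \<or> (i, j) = (0, 1)"
    proof (rule ccontr)
      assume "\<not> ?thesis"
      then have "(i, j) \<in> {(0, 0), (-1,0), (1,-1)} \<or> (i, j) \<in> {(0,-1), (-1,1)}"
        using ij(1) by (auto simp: close6_def)
      then show False
        using no[OF ij(2), of 1 0] no[OF ij(2), of 0 1]
        by (auto simp: close6_def)
    qed
    then have "2 + \<omega> \<in> L \<or> 1 + 2 * \<omega> \<in> L"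
      using ij(2) by auto
    moreover have ?thesis if "1 + 2 * \<omega> \<in> L"
    proof -
      have c: "cnj \<omega> \<in> {\<omega>, cnj \<omega>}" "\<omega> \<in> units6" by (auto simp: units6_def)
      have "0 + \<omega> * (2 + cnj \<omega>) \<in> L"
        using that omega_mult_cnj(1) by (simp add: distrib_left mult.commute add.commute)
      from perfect_code_turn_complex[OF L c(1) \<open>0 \<in> L\<close> c(2) this] have "2 + cnj \<omega> \<in> L"
        by (simp add: omega_mult_cnj(1))
      then show ?thesis by blast
    qed
    ultimately show ?thesis by blast
  qed
  then obtain \<zeta> where \<zeta>: "\<zeta> \<in> {\<omega>, cnj \<omega>}" and start: "2 + \<zeta> \<in> L" by blast
  note z = zeta_sq[OF \<zeta>]
  note turn = perfect_code_turn_complex[OF L \<zeta>]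
  have all: "\<forall>v\<in>units6. p + v * (2 + \<zeta>) \<in> L" if p: "p \<in> L" and u: "u \<in> units6" and pu: "p + u * (2 + \<zeta>) \<in> L" for p u
  proof
    fix v assume v: "v \<in> units6"
    have pow: "\<zeta> ^ k \<in> units6" for k
      by (induction k) (auto intro: units6_mult z(2))
    have k: "p + u * \<zeta> ^ k * (2 + \<zeta>) \<in> L" for k
    proof (induction k)
      case (Suc k)
      from turn[OF p units6_mult[OF u pow] Suc] show ?case by (simp add: mult_ac)
    qed (use pu in simp)
    have "\<exists>k. w = \<zeta> ^ k" if w: "w \<in> units6" for w
    proof -
      obtain k where k: "cnj w = \<omega> ^ k"
        using units6_iff_omega_power units6_cnj[OF w] by blast
      have "w = cnj \<omega> ^ k" using k by (metis complex_cnj_cnj complex_cnj_power)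
      moreover obtain k' where "w = \<omega> ^ k'" using units6_iff_omega_power w by blast
      ultimately show ?thesis using \<zeta> by blast
    qed
    from this[OF units6_mult[OF units6_cnj[OF u] v]] obtain k' where k': "cnj u * v = \<zeta> ^ k'" by blast
    have "v = u * \<zeta> ^ k'"
      using units6_mult_cnj[OF u] by (metis k' mult.assoc mult_1)
    then show "p + v * (2 + \<zeta>) \<in> L" using k by blast
  qed
  \<comment> \<open>The code points that have all six steps of the chosen chirality.\<close>
  define good where "good p \<longleftrightarrow> p \<in> L \<and> (\<forall>u\<in>units6. p + u * (2 + \<zeta>) \<in> L)" for p
  have good0: "good 0"
    using all[OF \<open>0 \<in> L\<close>, of 1] start \<open>0 \<in> L\<close> by (simp add: good_def)
  have good_step: "good (p + u * (2 + \<zeta>))" if "good p" "u \<in> units6" for p u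
    using that all[of "p + u * (2 + \<zeta>)" "- u"] by (auto simp: good_def units6_uminus)
  have good_multiple: "good (w * (2 + \<zeta>))" if "w \<in> Z_omega" for w
    using that
  proof (induction w rule: Z_omega_unit_induct)
    case (step w u)
    show ?case using good_step[OF step.IH step.hyps(2)] by (simp add: algebra_simps)
  qed (use good0 in simp)
  have good_ideal: "good ((of_int a + of_int b * \<zeta>) * (2 + \<zeta>))" for a b :: int
    using good_multiple Z_omega_basis[OF \<zeta>] by blast
  have near: "\<exists>i j a b. close6 i j \<and> of_int (x + i) + of_int (y + j) * \<zeta> = (of_int a + of_int b * \<zeta>) * (2 + \<zeta>)" for x y :: int
  proof -
    define r where "r = (x - 2 * y) mod 7"
    have "r \<in> {0,1,2,3,4,5,6}" unfolding r_def by (simp, presburger)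
    \<comment> \<open>The point \<open>x + y\<zeta>\<close> is in the ideal iff 7 divides \<open>x - 2y\<close>, and the six unit steps change
      \<open>x - 2y\<close> by all the nonzero residues modulo 7.\<close>
    then have "\<exists>i j. close6 i j \<and> 7 dvd (r + i - 2 * j)"
      unfolding close6_def
      apply (elim insertE emptyE)
      apply (rule exI[of _ 0], rule exI[of _ 0], simp)
      apply (rule exI[of _ "-1"], rule exI[of _ 0], simp)
      apply (rule exI[of _ 0], rule exI[of _ 1], simp)
      apply (rule exI[of _ "-1"], rule exI[of _ 1], simp)
      apply (rule exI[of _ 1], rule exI[of _ "-1"], simp)
      apply (rule exI[of _ 0], rule exI[of _ "-1"], simp)
      apply (rule exI[of _ 1], rule exI[of _ 0], simp)
      done
    then obtain i j where ij: "close6 i j" "7 dvd (r + i - 2 * j)" by blast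
    have "7 dvd (x + i) - 2 * (y + j)"
      using ij(2) unfolding r_def by presburger
    then obtain b' where b': "(x + i) - 2 * (y + j) = 7 * b'" by (elim dvdE)
    define b where "b = - b'"
    define a where "a = y + j - 3 * b"
    have "x + i = 2 * a - b" "y + j = a + 3 * b"
      using b' by (auto simp: a_def b_def)
    moreover have "(of_int a + of_int b * \<zeta>) * (2 + \<zeta>) = of_int (2 * a - b) + of_int (a + 3 * b) * \<zeta>"
    proof -
      have "(of_int a + of_int b * \<zeta>) * (2 + \<zeta>) = 2 * of_int a + of_int (a + 2 * b) * \<zeta> + of_int b * (\<zeta> * \<zeta>)"
        by (simp add: algebra_simps)
      then show ?thesis by (simp add: z(1) algebra_simps)
    qed
    ultimately show ?thesis using ij(1) by metis
  qed
  have "good p" if p: "p \<in> L" for p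
  proof -
    have pZ: "p \<in> Z_omega" using p perfect_codeD(1)[OF L] by auto
    then obtain x y :: int where xy: "p = of_int x + of_int y * \<zeta>"
      using Z_omega_basis[OF \<zeta>] by blast
    obtain i j a b where n: "close6 i j" "of_int (x + i) + of_int (y + j) * \<zeta> = (of_int a + of_int b * \<zeta>) * (2 + \<zeta>)"
      using near by blast
    have g: "good (of_int (x + i) + of_int (y + j) * \<zeta>)"
      using good_ideal[of a b] n(2) by simp
    have "of_int (x + i) + of_int (y + j) * \<zeta> - p \<in> insert 0 units6"
      using n(1) close6_iff[OF \<zeta>] by (simp add: xy algebra_simps)
    then have "p = of_int (x + i) + of_int (y + j) * \<zeta>"
      using perfect_codeD(3)[OF L pZ p] g by (auto simp: good_def)
    then show ?thesis using g by simp
  qed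
  moreover have "p + u * (2 + cnj \<zeta>) \<notin> L" if "good p" and u: "u \<in> units6" for p u
  proof
    assume A: "p + u * (2 + cnj \<zeta>) \<in> L"
    define v where "v = u * cnj \<zeta>"
    have v: "v \<in> units6" using u z(2) by (simp add: v_def units6_mult units6_cnj)
    have B: "p + v * (2 + \<zeta>) \<in> L" using that(1) v by (simp add: good_def)
    have uv: "u = v * \<zeta>"
      using units6_mult_cnj[OF z(2)] by (simp add: v_def mult.assoc mult.commute)
    have "\<zeta> * (2 + cnj \<zeta>) = 1 + 2 * \<zeta>"
      using units6_mult_cnj[OF z(2)] by (simp add: algebra_simps)
    then have A': "p + v * (1 + 2 * \<zeta>) \<in> L"
      using A by (simp add: uv mult.assoc)
    have "p \<in> Z_omega" using that(1) perfect_codeD(1)[OF L] by (auto simp: good_def)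
    moreover have "\<zeta> \<in> Z_omega" "v \<in> Z_omega" using z(2) v by (auto simp: units6_iff)
    ultimately have q: "p + v * (1 + \<zeta>) \<in> Z_omega"
      by (simp add: Z_omega_closed)
    have "p + v * (2 + \<zeta>) - (p + v * (1 + \<zeta>)) = v" "p + v * (1 + 2 * \<zeta>) - (p + v * (1 + \<zeta>)) = v * \<zeta>"
      by (simp_all add: algebra_simps)
    then have "p + v * (2 + \<zeta>) = p + v * (1 + 2 * \<zeta>)"
      using perfect_codeD(3)[OF L q B A'] v units6_mult[OF v z(2)] by auto
    then have "1 = \<zeta>" using units6_nonzero[OF v] by (simp add: algebra_simps)
    then show False using \<zeta> by (auto simp: cnj_omega)
  qed
  ultimately show ?thesis using \<zeta> by (auto simp: good_def)
qed

section \<open>Equilateral triangles and regular hexagons\<close>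

text \<open>The equilateral triangle with corner \<open>v\<close>, its sides at \<open>v\<close> being \<open>d\<close> and, counterclockwise, \<open>d\<omega>\<close>.\<close>

definition tri :: "complex \<Rightarrow> complex \<Rightarrow> complex set" where
  "tri v d = convex hull {v, v + d, v + d * \<omega>}"

text \<open>The regular hexagon with centre \<open>c\<close> and a corner at \<open>c + d\<close>.\<close>

definition hexa :: "complex \<Rightarrow> complex \<Rightarrow> complex set" where
  "hexa c d = convex hull ((\<lambda>u. c + d * u) ` units6)"

text \<open>Points of a sphere are extreme in the ball by strict convexity, hence extreme in any subset of
  the ball.\<close>

lemma finite_sphere_extreme_point:
  fixes x c :: complex
  assumes fin: "finite S" and sph: "S \<subseteq> sphere c r"
  shows "x extreme_point_of convex hull S \<longleftrightarrow> x \<in> S"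
proof
  show "x extreme_point_of convex hull S \<Longrightarrow> x \<in> S"
    by (rule extreme_point_of_convex_hull)
next
  assume x: "x \<in> S"
  have sub: "convex hull S \<subseteq> cball c r"
    using sph by (intro hull_minimal) auto
  have "x \<notin> open_segment a b" if "a \<in> convex hull S" "b \<in> convex hull S" for a b
  proof
    assume "x \<in> open_segment a b"
    then have "dist c x < dist c a \<or> dist c x < dist c b"
      by (rule dist_decreases_open_segment)
    moreover have "dist c a \<le> r" "dist c b \<le> r" "dist c x = r"
      using that sub x sph by auto
    ultimately show False by linarith
  qed
  then show "x extreme_point_of convex hull S"
    using x by (auto simp: extreme_point_of_def hull_inc)
qed

lemma hexa_extreme_point: "x extreme_point_of hexa c d \<longleftrightarrow> (\<exists>u\<in>units6. x = c + d * u)"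
proof -
  have "(\<lambda>u. c + d * u) ` units6 \<subseteq> sphere c (norm d)"
    by (auto simp: dist_norm norm_mult units6_iff)
  then show ?thesis
    unfolding hexa_def by (subst finite_sphere_extreme_point) auto
qed

lemma tri_extreme_point: "x extreme_point_of tri v d \<longleftrightarrow> x \<in> {v, v + d, v + d * \<omega>}"
proof -
  \<comment> \<open>the centre of the circumscribed circle\<close>
  define c where "c = v + d * ((1 + \<omega>) / 3)"
  have n: "norm (1 + \<omega>) = sqrt 3" "norm (\<omega> - 2) = sqrt 3" "norm (2 * \<omega> - 1) = sqrt 3"
    by (simp_all add: omega_def cmod_def power2_eq_square field_simps)
  have "c - v = d * ((1 + \<omega>) / 3)" "c - (v + d) = d * ((\<omega> - 2) / 3)" "c - (v + d * \<omega>) = - (d * ((2 * \<omega> - 1) / 3))"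
    by (simp_all add: c_def field_simps)
  then have "norm (c - v) = norm d * (sqrt 3 / 3)" "norm (c - (v + d)) = norm d * (sqrt 3 / 3)"
    "norm (c - (v + d * \<omega>)) = norm d * (sqrt 3 / 3)"
    by (simp_all only: norm_mult norm_divide n norm_minus_cancel norm_numeral)
  then have "{v, v + d, v + d * \<omega>} \<subseteq> sphere c (norm d * (sqrt 3 / 3))"
    by (simp add: dist_norm)
  then show ?thesis
    using finite_sphere_extreme_point[of "{v, v + d, v + d * \<omega>}" c _ x]
    unfolding tri_def by blast
qed

lemma cis_sixth: "cis (2 * pi * real k / 6) = \<omega> ^ k"
proof -
  have "cis (pi / 3) = \<omega>"
    by (simp add: omega_def complex_eq_iff cos_60 sin_60)
  then have "cis (real k * (pi / 3)) = \<omega> ^ k"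
    by (metis Complex.DeMoivre)
  then show ?thesis by (simp add: mult.commute)
qed

lemma regular_hexagon_iff: "regular_polygon 6 P \<longleftrightarrow> (\<exists>c d. d \<noteq> 0 \<and> P = hexa c d)"
proof -
  have "{c + r * cis (2 * pi * real k / real 6) |k. k < 6} = (\<lambda>u. c + r * u) ` units6" for c r
    using cis_sixth units6_iff_omega_power by (auto simp: image_iff)
  then show ?thesis
    by (auto simp: regular_polygon_def hexa_def)
qed

lemma tri_turn: "tri (v + d) (d * (\<omega> - 1)) = tri v d"
proof -
  have e: "v + d + d * (\<omega> - 1) = v + d * \<omega>" "v + d + d * (\<omega> - 1) * \<omega> = v"
    by (simp_all add: algebra_simps omega_sq omega_sq_left)
  show ?thesis
    unfolding tri_def e by (simp only: insert_commute)
qed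

lemma omega_power_even: "\<omega> ^ (2 * k) = (\<omega> - 1) ^ k"
  by (simp add: power_mult omega_power2)

lemma regular_triangle_iff: "regular_polygon 3 P \<longleftrightarrow> (\<exists>v d. d \<noteq> 0 \<and> P = tri v d)"
proof -
  have cis3: "cis (2 * pi * real k / real 3) = (\<omega> - 1) ^ k" for k
  proof -
    have "2 * pi * real k / real 3 = 2 * pi * real (2 * k) / 6" by simp
    then show ?thesis by (simp only: cis_sixth omega_power_even)
  qed
  have "{k::nat. k < 3} = {0, 1, 2}" by auto
  then have "{c + r * cis (2 * pi * real k / real 3) |k. k < 3} = (\<lambda>k. c + r * (\<omega> - 1) ^ k) ` {0, 1, 2}" for c r
    unfolding cis3 setcompr_eq_image by simp
  also have "(\<lambda>k. c + r * (\<omega> - 1) ^ k) ` {0, 1, 2} = {c + r, c + r + r * (\<omega> - 2), c + r + r * (\<omega> - 2) * \<omega>}" for c r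
  proof -
    have "c + r * (\<omega> - 1) = c + r + r * (\<omega> - 2)" "c + r * (\<omega> - 1)\<^sup>2 = c + r + r * (\<omega> - 2) * \<omega>"
      by (simp_all add: algebra_simps power2_eq_square omega_sq omega_sq_left)
    then show ?thesis by (simp add: add.assoc)
  qed
  finally have hull: "convex hull {c + r * cis (2 * pi * real k / real 3) |k. k < 3} = tri (c + r) (r * (\<omega> - 2))" for c r
    by (simp add: tri_def)
  have w2: "\<omega> - 2 \<noteq> 0"
    by (auto simp: complex_eq_iff omega_def)
  show ?thesis
  proof
    assume "regular_polygon 3 P"
    then obtain c r where "r \<noteq> 0" "P = tri (c + r) (r * (\<omega> - 2))"
      unfolding regular_polygon_def hull by blast
    then show "\<exists>v d. d \<noteq> 0 \<and> P = tri v d"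
      using w2 by (intro exI[of _ "c + r"] exI[of _ "r * (\<omega> - 2)"]) simp
  next
    assume "\<exists>v d. d \<noteq> 0 \<and> P = tri v d"
    then obtain v d where "d \<noteq> 0" "P = tri v d" by blast
    then show "regular_polygon 3 P"
      unfolding regular_polygon_def hull
      using w2 by (intro conjI exI[of _ "v - d / (\<omega> - 2)"] exI[of _ "d / (\<omega> - 2)"]) simp_all
  qed
qed

lemma regular_triangle_at:
  assumes "regular_polygon 3 P" "v extreme_point_of P"
  obtains d where "d \<noteq> 0" "P = tri v d"
proof -
  obtain w d where d: "d \<noteq> 0" "P = tri w d"
    using assms(1) regular_triangle_iff by blast
  have w1: "\<omega> - 1 \<noteq> 0" by simp
  consider "v = w" | "v = w + d" | "v = w + d * \<omega>"
    using assms(2) d(2) tri_extreme_point by auto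
  then show ?thesis
  proof cases
    case 2
    then show ?thesis using that[of "d * (\<omega> - 1)"] d tri_turn[of w d] w1 by simp
  next
    case 3
    have "v = w + d + d * (\<omega> - 1)" by (simp add: 3 algebra_simps)
    then show ?thesis
      using that[of "d * (\<omega> - 1) * (\<omega> - 1)"] d tri_turn[of w d] tri_turn[of "w + d" "d * (\<omega> - 1)"] w1 by simp
  qed (use that d in blast)
qed

lemma hexa_turn: "u \<in> units6 \<Longrightarrow> hexa c (d * u) = hexa c d"
proof -
  assume u: "u \<in> units6"
  have "(*) u ` units6 = units6"
  proof
    show "(*) u ` units6 \<subseteq> units6" using u units6_mult by blast
    show "units6 \<subseteq> (*) u ` units6"
    proof
      fix x assume "x \<in> units6"
      moreover have "x = u * (cnj u * x)" using units6_mult_cnj[OF u] by (simp add: mult.assoc[symmetric])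
      ultimately show "x \<in> (*) u ` units6" using units6_mult units6_cnj u by blast
    qed
  qed
  then have "(\<lambda>x. c + d * u * x) ` units6 = (\<lambda>x. c + d * x) ` units6"
    by (metis (no_types, lifting) image_cong image_image mult.assoc)
  then show ?thesis by (simp add: hexa_def)
qed

lemma regular_hexagon_at:
  assumes "regular_polygon 6 P" "v extreme_point_of P"
  obtains c d where "d \<noteq> 0" "P = hexa c d" "v = c + d"
proof -
  obtain c d where d: "d \<noteq> 0" "P = hexa c d"
    using assms(1) regular_hexagon_iff by blast
  obtain u where u: "u \<in> units6" "v = c + d * u"
    using assms(2) d(2) hexa_extreme_point by auto
  show ?thesis
    using that[of "d * u" c] d u hexa_turn units6_nonzero by simp
qed

lemma centre_in_hexa: "c \<in> hexa c d"
proof -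
  have "c + d * 1 \<in> hexa c d" "c + d * (-1) \<in> hexa c d"
    unfolding hexa_def by (auto intro!: hull_inc simp: units6_def)
  then have "closed_segment (c + d * 1) (c + d * (-1)) \<subseteq> hexa c d"
    unfolding hexa_def by (intro closed_segment_subset) auto
  then have "midpoint (c + d * 1) (c + d * (-1)) \<in> hexa c d"
    using midpoint_in_closed_segment by blast
  then show ?thesis by (simp add: midpoint_def scaleR_conv_of_real)
qed

lemma corner_in_hexa: "u \<in> units6 \<Longrightarrow> c + d * u \<in> hexa c d"
  unfolding hexa_def by (auto intro!: hull_inc)

lemma sector_subset_hexa: "u \<in> units6 \<Longrightarrow> tri c (d * u) \<subseteq> hexa c d"
proof -
  assume u: "u \<in> units6"
  have "c + d * u * \<omega> \<in> hexa c d"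
    using corner_in_hexa[of "u * \<omega>" c d] units6_mult[OF u, of \<omega>] by (simp add: units6_def mult.assoc)
  then show ?thesis
    unfolding tri_def using u centre_in_hexa[of c d] corner_in_hexa[OF u, of c d]
    by (intro hull_minimal) (auto simp: hexa_def)
qed

text \<open>At the corner \<open>c + d\<close> the hexagon spans an angle of 120 degrees, which two of the six lattice
  triangles fill.\<close>

lemma inner_triangle_subset_hexa:
  assumes "k \<in> {-1, \<omega> - 1}"
  shows "tri (c + d) (d * k) \<subseteq> hexa c d"
proof -
  have "c + d + d * k \<in> hexa c d \<and> c + d + d * k * \<omega> \<in> hexa c d"
  proof (cases "k = -1")
    case True
    have e: "c + d + d * k = c" "c + d + d * k * \<omega> = c + d * (1 - \<omega>)"
      by (simp_all add: True algebra_simps)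
    show ?thesis unfolding e using centre_in_hexa[of c d] corner_in_hexa[of "1 - \<omega>" c d] by (simp add: units6_def)
  next
    case False
    then have k: "k = \<omega> - 1" using assms by simp
    have e: "c + d + d * k = c + d * \<omega>" "c + d + d * k * \<omega> = c"
      by (simp_all add: k algebra_simps omega_sq omega_sq_left)
    show ?thesis unfolding e using centre_in_hexa[of c d] corner_in_hexa[of \<omega> c d] by (simp add: units6_def)
  qed
  then have "{c + d, c + d + d * k, c + d + d * k * \<omega>} \<subseteq> hexa c d"
    using corner_in_hexa[OF one_units6, of c d] by simp
  then show ?thesis
    unfolding tri_def hexa_def by (rule hull_minimal[where S = convex, OF _ convex_convex_hull])
qed

lemma tri_interior_nonempty:
  assumes "d \<noteq> 0"
  shows "interior (tri v d) \<noteq> {}"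
proof -
  have nd: "v \<noteq> v + d" "v \<noteq> v + d * \<omega>" "v + d \<noteq> v + d * \<omega>"
    using assms by auto
  have "\<not> affine_dependent {v, v + d, v + d * \<omega>}"
  proof
    assume "affine_dependent {v, v + d, v + d * \<omega>}"
    then have "collinear {v, v + d, v + d * \<omega>}"
      by (rule affine_dependent_imp_collinear_3)
    then have "collinear {0, d, d * \<omega>}"
      using collinear_3[of "v + d" v "v + d * \<omega>"] nd by (simp add: insert_commute)
    then obtain r where r: "d * \<omega> = r *\<^sub>R d"
      using assms by (auto simp: collinear_lemma)
    then have "d * \<omega> = d * complex_of_real r" by (simp add: scaleR_conv_of_real)
    then have "\<omega> = complex_of_real r" using assms by simp
    then have "Im \<omega> = 0" by (metis Im_complex_of_real)
    then show False using Im_omega_pos by simp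
  qed
  moreover have "card {v, v + d, v + d * \<omega>} = Suc (DIM(complex))"
    using nd by simp
  ultimately show ?thesis
    unfolding tri_def by (simp only: interior_convex_hull_eq_empty not_False_eq_True)
qed

text \<open>The hypothesis says that all other points lie strictly to the left of the line from \<open>a\<close> to \<open>b\<close>,
  so that this line supports the convex hull.\<close>

lemma hull_segment_edge:
  fixes a b :: complex
  assumes "finite S" "a \<in> S" "b \<in> S" "a \<noteq> b"
    and left: "\<And>x. x \<in> S - {a, b} \<Longrightarrow> Im ((x - a) / (b - a)) > 0"
  shows "closed_segment a b edge_of convex hull S"
proof -
  define f where "f x = Im ((x - a) / (b - a))" for x
  have aff: "f (u *\<^sub>R x + v *\<^sub>R y) = u * f x + v * f y" if "u + v = 1" for u v x y
  proof -
    have "u *\<^sub>R x + v *\<^sub>R y - a = of_real u * (x - a) + of_real v * (y - a)"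
    proof -
      have "a = of_real (u + v) * a" using that by simp
      then show ?thesis by (simp add: scaleR_conv_of_real algebra_simps)
    qed
    then have "(u *\<^sub>R x + v *\<^sub>R y - a) / (b - a) = of_real u * ((x - a) / (b - a)) + of_real v * ((y - a) / (b - a))"
      by (simp add: add_divide_distrib)
    then show ?thesis by (simp only: f_def plus_complex.sel Im_complex_of_real times_complex.sel) simp
  qed
  have "affine {x. f x = 0}"
    unfolding affine_def using aff by auto
  moreover have "f a = 0" "f b = 0" using assms(4) by (simp_all add: f_def)
  ultimately have 1: "affine hull {a, b} \<subseteq> {x. f x = 0}"
    by (intro hull_minimal) auto
  have "convex {x. f x > 0}"
    unfolding convex_def using aff
    by (auto intro: pos_add_strict simp: add_nonneg_pos add_pos_nonneg)
       (metis add_0 add_nonneg_pos add_pos_nonneg less_eq_real_def mult_nonneg_nonneg mult_pos_pos zero_less_one)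
  then have "convex hull (S - {a, b}) \<subseteq> {x. f x > 0}"
    using left by (intro hull_minimal) (auto simp: f_def)
  then have "affine hull {a, b} \<inter> convex hull (S - {a, b}) = {}"
    using 1 by force
  then have "convex hull {a, b} face_of convex hull S"
    using assms by (intro face_of_convex_hulls) auto
  then show ?thesis
    using assms(4) by (simp add: edge_of_def segment_convex_hull aff_dim_convex_hull aff_dim_2)
qed

lemma tri_edge:
  assumes "d \<noteq> 0"
  shows "closed_segment v (v + d) edge_of tri v d"
  unfolding tri_def
proof (rule hull_segment_edge)
  fix x assume "x \<in> {v, v + d, v + d * \<omega>} - {v, v + d}"
  then have "(x - v) / (v + d - v) = \<omega>"
    using assms by auto
  then show "Im ((x - v) / (v + d - v)) > 0" using Im_omega_pos by simp
qed (use assms in auto)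

lemma hexa_edge:
  assumes "d \<noteq> 0"
  shows "closed_segment (c + d) (c + d * \<omega>) edge_of hexa c d"
  unfolding hexa_def
proof (rule hull_segment_edge)
  have one: "c + d = c + d * 1" by simp
  show "c + d \<in> (\<lambda>u. c + d * u) ` units6" "c + d * \<omega> \<in> (\<lambda>u. c + d * u) ` units6"
    using one by (auto simp: units6_def)
  fix x assume x: "x \<in> (\<lambda>u. c + d * u) ` units6 - {c + d, c + d * \<omega>}"
  then obtain u where u: "u \<in> units6" "x = c + d * u" "u \<noteq> 1" "u \<noteq> \<omega>" by auto
  have "(x - (c + d)) / (c + d * \<omega> - (c + d)) = (d * (u - 1)) / (d * (\<omega> - 1))"
    by (simp add: u(2) algebra_simps)
  also have "\<dots> = (u - 1) / (\<omega> - 1)" using assms by simp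
  also have "\<dots> = - (u - 1) * \<omega>"
    by (subst divide_eq_eq) (simp add: algebra_simps omega_sq omega_sq_left)
  finally have e: "(x - (c + d)) / (c + d * \<omega> - (c + d)) = - (u - 1) * \<omega>" .
  have "u \<in> {\<omega> - 1, -1, -\<omega>, 1 - \<omega>}" using u by (auto simp: units6_def)
  then have "- (u - 1) * \<omega> \<in> (\<lambda>u. - (u - 1) * \<omega>) ` {\<omega> - 1, -1, -\<omega>, 1 - \<omega>}"
    by (rule imageI)
  also have "\<dots> = {1 + \<omega>, 2 * \<omega>, 2 * \<omega> - 1, \<omega> - 1}"
    by (simp add: algebra_simps omega_sq)
  finally show "Im ((x - (c + d)) / (c + d * \<omega> - (c + d))) > 0"
    unfolding e using Im_omega_pos by (elim insertE emptyE) (simp_all only:, simp_all)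
qed (use assms in auto)

text \<open>Opposite corners of the larger hexagon lie in the circumscribed disc of the other one; by the
  parallelogram law this forces the centres to agree.\<close>

lemma hexa_same_centre:
  assumes "hexa c d = hexa c' d'"
  shows "c = c'"
proof -
  have sub: "hexa c d \<subseteq> cball c (norm d)" for c d
    unfolding hexa_def by (intro hull_minimal) (auto simp: dist_norm norm_mult units6_iff)
  have le: "c = c'" if eq: "hexa c d = hexa c' d'" and "norm d' \<le> norm d" for c d c' d'
  proof -
    have "c + d * 1 \<in> cball c' (norm d')" "c + d * (-1) \<in> cball c' (norm d')"
      using corner_in_hexa[of 1 c d] corner_in_hexa[of "-1" c d] sub[of c' d'] eq
      by (auto simp del: mem_cball simp: units6_uminus)
    then have "norm (c + d - c') \<le> norm d" "norm (c - d - c') \<le> norm d"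
      using that(2) by (simp_all add: dist_norm norm_minus_commute)
    then have "(norm ((c - c') + d))\<^sup>2 \<le> (norm d)\<^sup>2" "(norm ((c - c') - d))\<^sup>2 \<le> (norm d)\<^sup>2"
      by (simp_all add: power_mono algebra_simps)
    moreover have "(norm ((c - c') + d))\<^sup>2 + (norm ((c - c') - d))\<^sup>2 = 2 * (norm (c - c'))\<^sup>2 + 2 * (norm d)\<^sup>2"
      by (simp only: cmod_power2) (simp add: power2_eq_square algebra_simps)
    ultimately have "(norm (c - c'))\<^sup>2 \<le> 0" by linarith
    then show ?thesis by simp
  qed
  show ?thesis
    using le[OF assms] le[OF assms[symmetric]] linear[of "norm d'" "norm d"] by blast
qed

lemma tri_neq_hexa: "d' \<noteq> 0 \<Longrightarrow> tri v d \<noteq> hexa c d'"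
proof
  assume d': "d' \<noteq> 0" and eq: "tri v d = hexa c d'"
  have "(\<lambda>u. c + d' * u) ` units6 \<subseteq> {v, v + d, v + d * \<omega>}"
    using tri_extreme_point[of _ v d] hexa_extreme_point[of _ c d'] eq by auto
  then have "card ((\<lambda>u. c + d' * u) ` units6) \<le> card {v, v + d, v + d * \<omega>}"
    by (intro card_mono) auto
  also have "\<dots> \<le> 3" by (simp add: card_insert_if)
  finally have "card units6 \<le> 3"
    using d' by (subst (asm) card_image) (auto intro: inj_onI)
  moreover have "card units6 = 6"
  proof -
    have "\<omega> \<noteq> 1 - \<omega>" "\<omega> - 1 \<noteq> -\<omega>" "\<omega> - 1 \<noteq> 1 - \<omega>" "\<omega> \<noteq> - \<omega>" "1 \<noteq> \<omega> - 1" "-1 \<noteq> 1 - \<omega>" "\<omega> \<noteq> 1 - \<omega>"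
       "1 \<noteq> - \<omega>"
      using Im_omega_pos by (auto simp: complex_eq_iff)
    then show ?thesis by (simp add: units6_def)
  qed
  ultimately show False by simp
qed

section \<open>Faces around a vertex\<close>

text \<open>The tessellation of type \<open>(3\<^sup>4.6)\<close> is also known as the snub hexagonal tiling.\<close>

locale snub_hexagonal =
  fixes \<tau> :: "complex set set"
  assumes archimedean: "archimedean_3_3_3_3_6 \<tau>"
begin

lemma edge_to_edge: "\<lbrakk>P \<in> \<tau>; Q \<in> \<tau>; P \<noteq> Q\<rbrakk> \<Longrightarrow> (P \<inter> Q) face_of P \<and> (P \<inter> Q) face_of Q"
  using archimedean by (auto simp: archimedean_3_3_3_3_6_def edge_to_edge_def)

lemma interiors_disjoint: "\<lbrakk>P \<in> \<tau>; Q \<in> \<tau>; P \<noteq> Q\<rbrakk> \<Longrightarrow> interior P \<inter> interior Q = {}"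
  using archimedean by (auto simp: archimedean_3_3_3_3_6_def tessellation_by_regular_polygons_def)

lemma covers_plane: "\<exists>P\<in>\<tau>. x \<in> P"
  using archimedean by (auto simp: archimedean_3_3_3_3_6_def tessellation_by_regular_polygons_def)

lemma locally_finite: "\<exists>\<epsilon>>0. finite {P\<in>\<tau>. P \<inter> ball x \<epsilon> \<noteq> {}}"
  using archimedean by (auto simp: archimedean_3_3_3_3_6_def tessellation_by_regular_polygons_def)

lemma face_at_vertex: "\<lbrakk>v \<in> vertices \<tau>; P \<in> \<tau>; v extreme_point_of P\<rbrakk> \<Longrightarrow> regular_polygon 3 P \<or> regular_polygon 6 P"
  using archimedean by (auto simp: archimedean_3_3_3_3_6_def)

lemma card_triangles_at: "v \<in> vertices \<tau> \<Longrightarrow> card {P\<in>\<tau>. v extreme_point_of P \<and> regular_polygon 3 P} = 4"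
  using archimedean by (auto simp: archimedean_3_3_3_3_6_def)

lemma card_hexagons_at: "v \<in> vertices \<tau> \<Longrightarrow> card {P\<in>\<tau>. v extreme_point_of P \<and> regular_polygon 6 P} = 1"
  using archimedean by (auto simp: archimedean_3_3_3_3_6_def)

lemma face_polytope:
  assumes "P \<in> \<tau>"
  shows "polytope P" "P \<noteq> {}"
proof -
  obtain n c r where P: "n \<ge> 3" "P = convex hull {c + r * cis (2 * pi * real k / real n) | k. k < n}"
    using archimedean assms
    unfolding archimedean_3_3_3_3_6_def tessellation_by_regular_polygons_def regular_polygon_def by meson
  have "finite {c + r * cis (2 * pi * real k / real n) | k. k < n}" by simp
  then show "polytope P"
    unfolding P(2) by (rule polytope_convex_hull)
  have "c + r * cis (2 * pi * real 0 / real n) \<in> {c + r * cis (2 * pi * real k / real n) | k. k < n}"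
    using P(1) by (intro CollectI exI[of _ 0]) auto
  from hull_inc[OF this, of convex] show "P \<noteq> {}"
    unfolding P(2) by blast
qed

lemma face_cases:
  assumes "P \<in> \<tau>"
  obtains (triangle) v d where "d \<noteq> 0" "P = tri v d" | (hexagon) c d where "d \<noteq> 0" "P = hexa c d"
proof -
  have "{x. x extreme_point_of P} \<noteq> {}"
    using Krein_Milman_Minkowski[OF polytope_imp_compact polytope_imp_convex, OF face_polytope(1) face_polytope(1), OF assms assms]
      face_polytope(2)[OF assms] by auto
  then obtain v where v: "v extreme_point_of P" by blast
  then have "v \<in> vertices \<tau>" using assms by (auto simp: vertices_def)
  from face_at_vertex[OF this assms v] show ?thesis
  proof
    assume "regular_polygon 3 P"
    then show ?thesis using triangle unfolding regular_triangle_iff by blast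
  next
    assume "regular_polygon 6 P"
    then show ?thesis using hexagon unfolding regular_hexagon_iff by blast
  qed
qed

lemma face_interior_nonempty:
  assumes "P \<in> \<tau>"
  shows "interior P \<noteq> {}"
  using assms
proof (cases rule: face_cases)
  case (hexagon c d)
  then have "tri c d \<subseteq> P" using sector_subset_hexa[of 1 c d] by simp
  from interior_mono[OF this] show ?thesis
    using tri_interior_nonempty[OF hexagon(1), of c] by blast
qed (use tri_interior_nonempty in simp)

lemma face_subset_imp_eq:
  assumes "P \<in> \<tau>" "Q \<in> \<tau>" "P \<subseteq> Q"
  shows "P = Q"
proof (rule ccontr)
  assume "P \<noteq> Q"
  with interiors_disjoint[OF assms(1,2)] have "interior P \<inter> interior Q = {}" .
  then show False
    using interior_mono[OF assms(3)] face_interior_nonempty[OF assms(1)] by blast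
qed

lemma common_triangle_imp_eq:
  assumes "P \<in> \<tau>" "Q \<in> \<tau>" "tri v d \<subseteq> P" "tri v d \<subseteq> Q" "d \<noteq> 0"
  shows "P = Q"
proof (rule ccontr)
  assume "P \<noteq> Q"
  with interiors_disjoint[OF assms(1,2)] have "interior P \<inter> interior Q = {}" .
  then show False
    using interior_mono[OF assms(3)] interior_mono[OF assms(4)]
      tri_interior_nonempty[OF assms(5), of v] by blast
qed

text \<open>Two distinct faces meet in a common face. If that contained the centre, which is the midpoint of any
  two opposite corners, it would contain all corners.\<close>

lemma face_through_centre:
  assumes "hexa c d \<in> \<tau>" "Q \<in> \<tau>" "c \<in> Q"
  shows "Q = hexa c d"
proof (cases "hexa c d = Q")
  case False
  have f: "(hexa c d \<inter> Q) face_of hexa c d"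
    by (rule conjunct1[OF edge_to_edge[OF assms(1,2) False]])
  have "c + d * u \<in> hexa c d \<inter> Q" if u: "u \<in> units6" for u
  proof (cases "d = 0")
    case False
    have "midpoint (c + d * u) (c + d * (- u)) = c"
      by (simp add: midpoint_def scaleR_conv_of_real)
    moreover have "c + d * u \<noteq> c + d * (- u)"
    proof
      assume "c + d * u = c + d * (- u)"
      then have "d * u = - (d * u)" by simp
      then have "d * u + d * u = 0" by (metis add.right_inverse)
      then have "2 * (d * u) = 0" by (simp only: mult_2)
      then show False using False units6_nonzero[OF u] by simp
    qed
    ultimately have "c \<in> open_segment (c + d * u) (c + d * (- u))"
      by (metis midpoint_in_open_segment)
    then show ?thesis
      using face_ofD[OF f, of c "c + d * u" "c + d * (- u)"] corner_in_hexa[OF u, of c d]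
        corner_in_hexa[OF units6_uminus[OF u], of c d] centre_in_hexa[of c d] assms(3) by blast
  next
    case True
    then have "c + d * u = c" by simp
    then show ?thesis using assms(3) centre_in_hexa[of c d] by (simp only: IntI)
  qed
  then have "(\<lambda>u. c + d * u) ` units6 \<subseteq> Q" by blast
  from hull_minimal[where S = convex, OF this polytope_imp_convex[OF face_polytope(1)[OF assms(2)]]]
  have "hexa c d \<subseteq> Q" by (simp only: hexa_def)
  then show ?thesis
    using face_subset_imp_eq[OF assms(1,2)] by blast
qed simp

text \<open>The midpoint of the edge is not interior to \<open>P\<close>, and near it there are only finitely many other
  faces, which are closed; as the faces cover the plane, one of them contains this point. It meets \<open>P\<close> in a
  proper face of \<open>P\<close> that includes the edge, so in the edge itself.\<close>

lemma across_edge: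
  assumes P: "P \<in> \<tau>" and e: "e edge_of P"
  obtains Q where "Q \<in> \<tau>" "Q \<noteq> P" "e edge_of Q"
proof -
  have ef: "e face_of P" and dim: "aff_dim e = 1" using e by (auto simp: edge_of_def)
  have cP: "convex P" using face_polytope(1)[OF P] polytope_imp_convex by auto
  have aP: "aff_dim P = 2"
    using aff_dim_nonempty_interior[OF face_interior_nonempty[OF P]] by simp
  then have "e \<noteq> P" using dim by auto
  have "convex e" using ef by (rule face_of_imp_convex)
  moreover have "e \<noteq> {}" using dim by auto
  ultimately obtain m where m: "m \<in> rel_interior e"
    using rel_interior_eq_empty by blast
  then have me: "m \<in> e" using rel_interior_subset by blast
  then have mP: "m \<in> P" "m \<notin> interior P"
    using face_of_imp_subset[OF ef] face_of_disjoint_interior[OF ef \<open>e \<noteq> P\<close>] by auto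
  obtain \<epsilon> where \<epsilon>: "\<epsilon> > 0" "finite {Q\<in>\<tau>. Q \<inter> ball m \<epsilon> \<noteq> {}}"
    using locally_finite by blast
  define U where "U = \<Union>({Q\<in>\<tau>. Q \<inter> ball m \<epsilon> \<noteq> {}} - {P})"
  have "closed U"
    unfolding U_def using \<epsilon>(2) face_polytope(1) polytope_imp_compact compact_imp_closed
    by (intro closed_Union) auto
  have "m \<in> U"
  proof (rule ccontr)
    assume "m \<notin> U"
    then have "m \<in> ball m \<epsilon> - U" using \<epsilon>(1) by simp
    moreover have "open (ball m \<epsilon> - U)" using \<open>closed U\<close> by (intro open_Diff) auto
    moreover have "ball m \<epsilon> - U \<subseteq> P"
    proof
      fix x assume x: "x \<in> ball m \<epsilon> - U"
      obtain Q where "Q \<in> \<tau>" "x \<in> Q" using covers_plane by blast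
      then show "x \<in> P" using x unfolding U_def by blast
    qed
    ultimately show False using mP(2) by (meson interiorI)
  qed
  then obtain Q where Q: "Q \<in> \<tau>" "Q \<noteq> P" "m \<in> Q" unfolding U_def by blast
  have f: "(P \<inter> Q) face_of P" "(P \<inter> Q) face_of Q"
    using edge_to_edge[OF P Q(1)] Q(2) by blast+
  have sub: "e \<subseteq> P \<inter> Q"
    using subset_of_face_of[OF f(1) face_of_imp_subset[OF ef]] m mP Q(3) by blast
  have "P \<inter> Q \<noteq> P"
    using face_subset_imp_eq[OF P Q(1)] Q(2) by blast
  then have "aff_dim (P \<inter> Q) \<le> 1"
    using face_of_aff_dim_lt[OF cP f(1)] aP by simp
  moreover have "e face_of (P \<inter> Q)"
    using ef sub by (rule face_of_subset) auto
  moreover have "convex (P \<inter> Q)" using f(1) by (rule face_of_imp_convex)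
  ultimately have "e = P \<inter> Q"
    using face_of_aff_dim_lt[of "P \<inter> Q" e] dim by fastforce
  then show ?thesis
    using that[OF Q(1,2)] f(2) dim by (simp add: edge_of_def)
qed

lemma vertex_of_hexagon: "\<lbrakk>hexa c d \<in> \<tau>; u \<in> units6\<rbrakk> \<Longrightarrow> c + d * u \<in> vertices \<tau>"
  unfolding vertices_def using hexa_extreme_point by blast

lemma hexagon_at_unique:
  assumes "P \<in> \<tau>" "Q \<in> \<tau>" "v extreme_point_of P" "v extreme_point_of Q" "regular_polygon 6 P" "regular_polygon 6 Q"
  shows "P = Q"
proof -
  have "v \<in> vertices \<tau>" using assms by (auto simp: vertices_def)
  from card_hexagons_at[OF this] show ?thesis
    using assms by (auto simp: card_1_singleton_iff set_eq_iff)
qed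

lemma hexagon_at:
  assumes "v \<in> vertices \<tau>"
  obtains c d where "d \<noteq> 0" "hexa c d \<in> \<tau>" "v = c + d"
proof -
  obtain P where "P \<in> \<tau>" "v extreme_point_of P" "regular_polygon 6 P"
    using card_hexagons_at[OF assms] by (auto simp: card_1_singleton_iff set_eq_iff)
  then show ?thesis using that regular_hexagon_at by metis
qed

text \<open>The face across the edge is a triangle, because hexagons are excluded. It cannot lie to the left of
  the edge, where it would overlap \<open>P\<close>.\<close>

lemma next_triangle:
  assumes P: "P \<in> \<tau>" "closed_segment v (v + e) edge_of P" "tri v e \<subseteq> P" and e: "e \<noteq> 0"
    and H: "\<And>Q. \<lbrakk>Q \<in> \<tau>; Q \<noteq> P; v extreme_point_of Q; v + e extreme_point_of Q\<rbrakk> \<Longrightarrow> \<not> regular_polygon 6 Q"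
  shows "tri v (e * (1 - \<omega>)) \<in> \<tau>"
proof -
  obtain Q where Q: "Q \<in> \<tau>" "Q \<noteq> P" "closed_segment v (v + e) edge_of Q"
    using across_edge[OF P(1,2)] by blast
  have fQ: "closed_segment v (v + e) face_of Q" using Q(3) by (simp add: edge_of_def)
  have ext: "v extreme_point_of Q" "v + e extreme_point_of Q"
    using extreme_point_of_face[OF fQ] extreme_point_of_segment by blast+
  then have "regular_polygon 3 Q"
    using face_at_vertex[of v Q] H[OF Q(1,2)] Q(1) by (auto simp: vertices_def)
  from regular_triangle_at[OF this ext(1)] obtain d where d: "d \<noteq> 0" "Q = tri v d" by blast
  have "v + e \<in> {v, v + d, v + d * \<omega>}"
    using ext(2) unfolding d(2) tri_extreme_point .
  then have "e = d \<or> e = d * \<omega>" using e by auto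
  moreover have "e \<noteq> d"
    using common_triangle_imp_eq[OF P(1) Q(1) P(3)] Q(2) e d(2) by auto
  ultimately have "d = e * (1 - \<omega>)"
    using omega_mult_cnj(2) by (simp add: mult.assoc)
  then show ?thesis using Q(1) d(2) by simp
qed

text \<open>The first sides, as multiples of \<open>d\<close>, of the four triangles at the corner \<open>c + d\<close> of a hexagon with
  centre \<open>c\<close>. The two remaining units \<open>-1\<close> and \<open>\<omega> - 1\<close> belong to the triangles inside the hexagon.\<close>

definition fan :: "complex set" where
  "fan = {1, \<omega>, -\<omega>, 1 - \<omega>}"

text \<open>Clockwise from the hexagon, each edge at the corner leads to the next triangle, since the only
  hexagon at the corner is the one that the walk starts from.\<close>

lemma triangles_around_corner:
  assumes H: "hexa c d \<in> \<tau>" and d: "d \<noteq> 0" and u: "u \<in> fan"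
  shows "tri (c + d) (d * u) \<in> \<tau>"
proof -
  define v where "v = c + d"
  have u6: "\<omega> \<in> units6" "1 - \<omega> \<in> units6" by (simp_all add: units6_def)
  have corner: "v + d * x extreme_point_of hexa c d \<longleftrightarrow> 1 + x \<in> units6" for x
  proof -
    have "v + d * x = c + d * y \<longleftrightarrow> 1 + x = y" for y
    proof -
      have "v + d * x = c + d * (1 + x)" by (simp add: v_def algebra_simps)
      then show ?thesis using d by simp
    qed
    then show ?thesis by (auto simp: hexa_extreme_point)
  qed
  have rp: "regular_polygon 6 (hexa c d)" using regular_hexagon_iff d by blast
  have vH: "v extreme_point_of hexa c d" using corner[of 0] by simp
  have noth: "\<not> regular_polygon 6 Q" if "Q \<in> \<tau>" "v extreme_point_of Q" "Q \<noteq> hexa c d" for Q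
    using hexagon_at_unique[OF that(1) H that(2) vH _ rp] that(3) by blast
  have step: "tri v (d * x * (1 - \<omega>)) \<in> \<tau>" if "tri v (d * x) \<in> \<tau>" "x \<in> units6" "1 + x \<notin> units6" for x
  proof (rule next_triangle)
    show "closed_segment v (v + d * x) edge_of tri v (d * x)"
      using d units6_nonzero[OF that(2)] by (intro tri_edge) simp
    show "\<not> regular_polygon 6 Q" if "Q \<in> \<tau>" "Q \<noteq> tri v (d * x)" "v extreme_point_of Q" "v + d * x extreme_point_of Q" for Q
      using noth that corner[of x] \<open>1 + x \<notin> units6\<close> by blast
  qed (use that d units6_nonzero in auto)
  have "tri v (d * (\<omega> - 1) * (1 - \<omega>)) \<in> \<tau>"
  proof (rule next_triangle[OF H])
    have corner2: "v + d * (\<omega> - 1) = c + d * \<omega>" by (simp add: v_def algebra_simps)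
    show "closed_segment v (v + d * (\<omega> - 1)) edge_of hexa c d"
      unfolding corner2 unfolding v_def by (rule hexa_edge[OF d])
    show "tri v (d * (\<omega> - 1)) \<subseteq> hexa c d"
      unfolding v_def by (rule inner_triangle_subset_hexa) simp
    show "\<not> regular_polygon 6 Q" if "Q \<in> \<tau>" "Q \<noteq> hexa c d" "v extreme_point_of Q" for Q
      using noth that by blast
  qed (use d in auto)
  moreover have "d * (\<omega> - 1) * (1 - \<omega>) = d * \<omega>"
    by (simp add: algebra_simps omega_sq omega_sq_left)
  ultimately have 1: "tri v (d * \<omega>) \<in> \<tau>" by simp
  have "tri v (d * \<omega> * (1 - \<omega>)) \<in> \<tau>"
    using not_units6 u6 by (intro step[OF 1]) simp_all
  moreover have "d * \<omega> * (1 - \<omega>) = d * 1"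
    by (simp only: mult.assoc omega_mult_cnj)
  ultimately have 2: "tri v (d * 1) \<in> \<tau>" by simp
  have "tri v (d * 1 * (1 - \<omega>)) \<in> \<tau>"
    using not_units6 u6 by (intro step[OF 2]) simp_all
  then have 3: "tri v (d * (1 - \<omega>)) \<in> \<tau>" by simp
  have "tri v (d * (1 - \<omega>) * (1 - \<omega>)) \<in> \<tau>"
    using not_units6 u6 by (intro step[OF 3]) simp_all
  moreover have "d * (1 - \<omega>) * (1 - \<omega>) = d * (- \<omega>)"
    by (simp add: algebra_simps omega_sq omega_sq_left)
  ultimately have 4: "tri v (d * (- \<omega>)) \<in> \<tau>" by simp
  show ?thesis
    using u 1 2 3 4 unfolding fan_def v_def by blast
qed

text \<open>The four triangles of the fan are distinct, and there are only four triangles at a vertex.\<close>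

lemma triangle_at_corner:
  assumes H: "hexa c d \<in> \<tau>" and d: "d \<noteq> 0" and P: "P \<in> \<tau>" "c + d extreme_point_of P" "regular_polygon 3 P"
  shows "\<exists>u\<in>fan. P = tri (c + d) (d * u)"
proof -
  define v where "v = c + d"
  have tri_inj: "u = u'" if "tri v (d * u) = tri v (d * u')" "u \<in> fan" "u' \<in> fan" for u u'
  proof (rule ccontr)
    assume ne: "u \<noteq> u'"
    have "v + d * u \<in> {v, v + d * u', v + d * u' * \<omega>}" "v + d * u' \<in> {v, v + d * u, v + d * u * \<omega>}"
      using tri_extreme_point[of "v + d * u"] tri_extreme_point[of "v + d * u'"] that(1) by (metis insertCI)+
    moreover have "u \<noteq> 0" "u' \<noteq> 0" using that(2,3) by (auto simp: fan_def)
    ultimately have "u = u' * \<omega>" "u' = u * \<omega>"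
      using ne d by simp_all
    then have "u = u * (\<omega> * \<omega>)" by (metis mult.assoc)
    then have "\<omega> * \<omega> = 1" using \<open>u \<noteq> 0\<close> by simp
    then show False using Im_omega_pos by (auto simp: omega_sq complex_eq_iff)
  qed
  have "card fan = 4"
  proof -
    have "\<omega> \<noteq> 1 - \<omega>" "\<omega> \<noteq> - \<omega>" "1 \<noteq> - \<omega>"
      using Im_omega_pos by (auto simp: complex_eq_iff)
    then show ?thesis by (simp add: fan_def)
  qed
  then have card: "card ((\<lambda>u. tri v (d * u)) ` fan) = 4"
    using tri_inj by (subst card_image) (auto intro: inj_onI)
  have vV: "v \<in> vertices \<tau>"
    using P by (auto simp: vertices_def v_def)
  have "(\<lambda>u. tri v (d * u)) ` fan \<subseteq> {P\<in>\<tau>. v extreme_point_of P \<and> regular_polygon 3 P}"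
  proof clarify
    fix u assume u: "u \<in> fan"
    then have "d * u \<noteq> 0" using d by (auto simp: fan_def)
    then have "regular_polygon 3 (tri v (d * u))" unfolding regular_triangle_iff by blast
    then show "tri v (d * u) \<in> \<tau> \<and> v extreme_point_of tri v (d * u) \<and> regular_polygon 3 (tri v (d * u))"
      using triangles_around_corner[OF H d u] tri_extreme_point[of v v "d * u"]
      by (simp add: v_def)
  qed
  note sub = this
  have fin: "finite {P\<in>\<tau>. v extreme_point_of P \<and> regular_polygon 3 P}"
    by (rule card_ge_0_finite) (simp only: card_triangles_at[OF vV] zero_less_numeral)
  have eq: "(\<lambda>u. tri v (d * u)) ` fan = {P\<in>\<tau>. v extreme_point_of P \<and> regular_polygon 3 P}"
    by (rule card_subset_eq[OF fin sub]) (simp only: card card_triangles_at[OF vV])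
  have "P \<in> (\<lambda>u. tri v (d * u)) ` fan"
    unfolding eq using P unfolding v_def by blast
  then obtain u where "P = tri v (d * u)" "u \<in> fan" by (rule imageE)
  then show ?thesis unfolding v_def by blast
qed

end

section \<open>The lattice of hexagon centres\<close>

lemma tri_coords:
  assumes "0 \<le> s" "0 \<le> t" "s + t \<le> 1"
  shows "v + d * (of_real s + of_real t * \<omega>) \<in> tri v d"
proof -
  have "v + d * (of_real s + of_real t * \<omega>) = (1 - s - t) *\<^sub>R v + s *\<^sub>R (v + d) + t *\<^sub>R (v + d * \<omega>)"
    by (simp add: scaleR_conv_of_real algebra_simps)
  then show ?thesis
    unfolding tri_def convex_hull_3 using assms
    by (intro CollectI exI[of _ "1 - s - t"] exI[of _ s] exI[of _ t]) simp
qed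

text \<open>Integer parts of the coordinates locate a point in a rhombus of the lattice; a diagonal cuts the
  rhombus into two triangles.\<close>

lemma triangular_grid_cover:
  assumes "d \<noteq> 0"
  obtains z e where "z \<in> Z_omega" "e \<in> units6" "p \<in> tri (c + d * z) (d * e)"
proof -
  define w where "w = (p - c) / d"
  define y where "y = Im w / Im \<omega>"
  define x where "x = Re w - y * Re \<omega>"
  have w: "w = of_real x + of_real y * \<omega>"
    using Im_omega_pos by (simp add: complex_eq_iff x_def y_def)
  have p: "p = c + d * w" using assms by (simp add: w_def)
  define z :: complex where "z = of_int \<lfloor>x\<rfloor> + of_int \<lfloor>y\<rfloor> * \<omega>"
  have z: "z \<in> Z_omega" unfolding z_def by (rule Z_omegaI)
  have w': "w = z + of_real (frac x) + of_real (frac y) * \<omega>"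
    unfolding w z_def frac_def by (simp add: algebra_simps)
  show thesis
  proof (cases "frac x + frac y \<le> 1")
    case True
    have "p = (c + d * z) + d * (of_real (frac x) + of_real (frac y) * \<omega>)"
      unfolding p w' by (simp add: algebra_simps)
    then have "p \<in> tri (c + d * z) (d * 1)"
      using tri_coords[of "frac x" "frac y" "c + d * z" d] True by simp
    then show thesis using that[OF z one_units6] by blast
  next
    case False
    have "p = (c + d * (z + 1 + \<omega>)) + d * (-1) * (of_real (1 - frac x) + of_real (1 - frac y) * \<omega>)"
      unfolding p w' by (simp add: algebra_simps)
    then have "p \<in> tri (c + d * (z + 1 + \<omega>)) (d * (-1))"
      using tri_coords[of "1 - frac x" "1 - frac y" "c + d * (z + 1 + \<omega>)" "d * (-1)"] False
        frac_lt_1[of x] frac_lt_1[of y] by simp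
    moreover have "z + 1 + \<omega> \<in> Z_omega" using z by (simp add: Z_omega_closed)
    ultimately show thesis using that units6_uminus[OF one_units6] by blast
  qed
qed

context snub_hexagonal
begin

text \<open>The vertex \<open>c + d + dk\<close> shares a triangle with the corner \<open>c + d\<close>. Seen from the hexagon at that vertex,
  this triangle belongs to its own fan, so the side from one vertex to the other is a unit multiple both of
  \<open>d\<close> and of the corner vector of that hexagon. Hence the hexagon has the same size and orientation.\<close>

lemma neighbour_hexagon_aligned:
  assumes H: "hexa c d \<in> \<tau>" and d: "d \<noteq> 0" and k: "k \<in> units6" "k \<noteq> -1"
  shows "\<exists>y\<in>units6. hexa (c + d + d * k + d * y) d \<in> \<tau>"
proof -
  define v where "v = c + d"
  define w where "w = v + d * k"
  have "\<exists>u\<in>fan. w \<in> {v, v + d * u, v + d * u * \<omega>}"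
  proof (cases "k \<in> fan")
    case True
    then show ?thesis by (intro bexI[of _ k]) (auto simp: w_def)
  next
    case False
    then have "k = \<omega> * \<omega>" using k by (auto simp: units6_def fan_def omega_sq)
    then have "w = v + d * \<omega> * \<omega>" by (simp add: w_def mult.assoc)
    then show ?thesis by (intro bexI[of _ \<omega>]) (auto simp: fan_def)
  qed
  then obtain u where u: "u \<in> fan" "w \<in> {v, v + d * u, v + d * u * \<omega>}" by blast
  define T where "T = tri v (d * u)"
  have T: "T \<in> \<tau>" unfolding T_def v_def by (rule triangles_around_corner[OF H d u(1)])
  have "d * u \<noteq> 0" using u(1) d by (auto simp: fan_def)
  then have rT: "regular_polygon 3 T" unfolding T_def regular_triangle_iff by blast
  have wT: "w extreme_point_of T" and vT: "v extreme_point_of T"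
    unfolding T_def tri_extreme_point using u(2) by simp_all
  have "w \<in> vertices \<tau>" unfolding vertices_def using wT T by blast
  then obtain c' d' where H': "d' \<noteq> 0" "hexa c' d' \<in> \<tau>" "w = c' + d'"
    using hexagon_at by blast
  obtain u' where u': "u' \<in> fan" "T = tri w (d' * u')"
    using triangle_at_corner[OF H'(2,1) T] wT rT unfolding H'(3) by blast
  have "v \<in> {w, w + d' * u', w + d' * u' * \<omega>}"
    using vT unfolding u'(2) tri_extreme_point .
  moreover have "v \<noteq> w" using d units6_nonzero[OF k(1)] by (simp add: w_def)
  ultimately obtain x where x: "x \<in> {u', u' * \<omega>}" "v = w + d' * x"
    by (auto simp: mult.assoc)
  have fan6: "fan \<subseteq> units6" by (auto simp: fan_def units6_def)
  have "\<omega> \<in> units6" by (simp add: units6_def)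
  then have xu: "x \<in> units6" using x(1) u'(1) fan6 units6_mult by blast
  have "d' * x = - (d * k)" using x(2) by (simp add: w_def add_eq_0_iff)
  then have "d' * (x * cnj x) = d * (- k * cnj x)" by (simp add: mult.assoc[symmetric])
  then have d': "d' = d * (- k * cnj x)" using units6_mult_cnj[OF xu] by simp
  have y: "- k * cnj x \<in> units6" using k(1) xu by (intro units6_mult units6_uminus units6_cnj)
  have "c' = c + d + d * k + d * (- (- k * cnj x))"
    using H'(3) unfolding d' w_def v_def by (simp add: algebra_simps)
  moreover have "hexa c' d' = hexa c' d" unfolding d' by (rule hexa_turn[OF y])
  ultimately show ?thesis using H'(2) units6_uminus[OF y] by metis
qed

text \<open>The centres of the hexagons of the same size and orientation, in the coordinates in which the given
  hexagon has its centre at the origin and its corners at the units.\<close>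

definition centres :: "complex \<Rightarrow> complex \<Rightarrow> complex set" where
  "centres c d = {z \<in> Z_omega. hexa (c + d * z) d \<in> \<tau>}"

text \<open>Uniqueness: a corner belongs to one hexagon only, and a centre even to one face only. Existence spreads from the origin by unit steps, because the neighbours of a corner
  other than the centre are again corners of aligned hexagons.\<close>

lemma perfect_code_centres:
  assumes H: "hexa c d \<in> \<tau>" and d: "d \<noteq> 0"
  shows "perfect_code (centres c d)"
proof -
  have rp: "regular_polygon 6 (hexa e d)" for e using regular_hexagon_iff d by blast
  have eq_iff: "z = z'" if "hexa (c + d * z) d = hexa (c + d * z') d" for z z'
    using hexa_same_centre[OF that] d by simp
  have corner: "c + d * z extreme_point_of hexa (c + d * z') d" if "z' - z \<in> units6" for z z'
  proof -
    have "c + d * z = (c + d * z') + d * (- (z' - z))" by (simp add: algebra_simps)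
    then show ?thesis unfolding hexa_extreme_point using units6_uminus[OF that] by blast
  qed
  have centre: "z' = z" if "z \<in> centres c d" "z' \<in> centres c d" "z' - z \<in> units6" for z z'
  proof -
    have "c + d * z \<in> hexa (c + d * z') d"
      using corner[OF that(3)] by (simp only: extreme_point_of_def)
    moreover have "hexa (c + d * z) d \<in> \<tau>" "hexa (c + d * z') d \<in> \<tau>"
      using that(1,2) by (simp_all add: centres_def)
    ultimately have "hexa (c + d * z') d = hexa (c + d * z) d"
      using face_through_centre by blast
    then show ?thesis by (rule eq_iff)
  qed
  have unique: "z1 = z2" if z12: "z1 \<in> centres c d" "z2 \<in> centres c d"
    and near: "z1 - z \<in> insert 0 units6" "z2 - z \<in> insert 0 units6" for z z1 z2
  proof -
    consider "z1 = z" "z2 = z" | "z1 = z" "z2 - z \<in> units6" | "z1 - z \<in> units6" "z2 = z"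
      | "z1 - z \<in> units6" "z2 - z \<in> units6"
      using near unfolding insert_iff right_minus_eq by blast
    then show ?thesis
    proof cases
      case 4
      have "hexa (c + d * z1) d = hexa (c + d * z2) d"
        using hexagon_at_unique[OF _ _ corner[OF 4(1)] corner[OF 4(2)] rp rp] z12
        by (simp add: centres_def)
      then show ?thesis by (rule eq_iff)
    next
      case 2 then show ?thesis using centre[of z1 z2] z12 by simp
    next
      case 3 then show ?thesis using centre[of z2 z1] z12 by simp
    qed simp
  qed
  have exist: "\<exists>x\<in>centres c d. x - z \<in> insert 0 units6" if "z \<in> Z_omega" for z
    using that
  proof (induction z rule: Z_omega_unit_induct)
    case zero
    have "0 \<in> centres c d" using H by (simp add: centres_def)
    then show ?case by (intro bexI[of _ 0]) simp_all
  next
    case (step z u)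
    from step.IH obtain x where x: "x \<in> centres c d" "x - z \<in> insert 0 units6" by blast
    show ?case
    proof (cases "x = z \<or> x = z + u")
      case True
      then have "x - (z + u) \<in> insert 0 units6" using units6_uminus[OF step.hyps(2)] by auto
      then show ?thesis using x(1) by blast
    next
      case False
      define y where "y = - (x - z)"
      have y: "y \<in> units6" using x(2) False units6_uminus[of "x - z"] by (auto simp: y_def)
      define k where "k = u * cnj y"
      have k: "k \<in> units6" unfolding k_def by (intro units6_mult units6_cnj step.hyps(2) y)
      have yk: "y * k = u"
        unfolding k_def using units6_mult_cnj[OF y] by (simp add: mult.left_commute)
      \<comment> \<open>From the corner \<open>z\<close> of the hexagon with centre \<open>x\<close>, the step \<open>u\<close> does not lead to the centre.\<close>
      have "k \<noteq> -1" using False yk by (auto simp: y_def)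
      have "hexa (c + d * x) (d * y) \<in> \<tau>"
        unfolding hexa_turn[OF y] using x(1) by (simp add: centres_def)
      from neighbour_hexagon_aligned[OF this _ k \<open>k \<noteq> -1\<close>] d units6_nonzero[OF y]
      obtain t where t: "t \<in> units6" "hexa (c + d * x + d * y + d * y * k + d * y * t) (d * y) \<in> \<tau>" by auto
      have "c + d * x + d * y + d * y * k + d * y * t = c + d * (x + y + y * k + y * t)"
        by (simp add: algebra_simps)
      also have "x + y + y * k + y * t = z + u + y * t"
        unfolding yk by (simp add: y_def)
      finally have eq: "c + d * x + d * y + d * y * k + d * y * t = c + d * (z + u + y * t)" .
      have "hexa (c + d * (z + u + y * t)) d \<in> \<tau>"
        using t(2) unfolding hexa_turn[OF y] eq .
      moreover have "z + u + y * t \<in> Z_omega"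
        using step.hyps(1) units6_Z_omega[OF step.hyps(2)] units6_Z_omega[OF y] units6_Z_omega[OF t(1)] by (intro Z_omega_add Z_omega_mult)
      moreover have "z + u + y * t - (z + u) \<in> insert 0 units6"
        using units6_mult[OF y t(1)] by simp
      ultimately show ?thesis by (intro bexI[of _ "z + u + y * t"]) (simp_all add: centres_def)
    qed
  qed
  show ?thesis
    unfolding perfect_code_def
  proof (intro conjI ballI)
    show "centres c d \<subseteq> Z_omega" by (auto simp: centres_def)
    fix z assume "z \<in> Z_omega"
    from exist[OF this] obtain x where x: "x \<in> centres c d" "x - z \<in> insert 0 units6" by blast
    show "\<exists>!x. x \<in> centres c d \<and> x - z \<in> insert 0 units6"
    proof (rule ex1I)
      show "y = x" if "y \<in> centres c d \<and> y - z \<in> insert 0 units6" for y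
        using unique[of y x z] that x by blast
    qed (use x in blast)
  qed
qed

text \<open>A centre \<open>c'\<close> lies in some lattice triangle. Each lattice triangle is a face or is part of an aligned hexagon,
  and the only face through \<open>c'\<close> is the hexagon around it.\<close>

lemma hexagon_centres_grid:
  assumes H: "hexa c d \<in> \<tau>" and d: "d \<noteq> 0" and H': "hexa c' d' \<in> \<tau>" "d' \<noteq> 0"
  shows "\<exists>z\<in>centres c d. \<exists>u\<in>units6. c' = c + d * z \<and> d' = d * u"
proof -
  obtain z e where ze: "z \<in> Z_omega" "e \<in> units6" "c' \<in> tri (c + d * z) (d * e)"
    using triangular_grid_cover[OF d] by blast
  have notri: False if "tri (c + d * z) (d * e) \<in> \<tau>"
    using face_through_centre[OF H'(1) that ze(3)] tri_neq_hexa[OF H'(2)] by (rule notE[rotated])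
  have hex: "c' = c + d * x" if x: "x \<in> centres c d" "c' \<in> hexa (c + d * x) d" for x
  proof -
    have "hexa (c + d * x) d \<in> \<tau>" using x(1) by (simp add: centres_def)
    from hexa_same_centre[OF face_through_centre[OF H'(1) this x(2)]] show ?thesis by (rule sym)
  qed
  obtain x where x: "x \<in> centres c d" "x - z \<in> insert 0 units6"
    using perfect_codeD(2)[OF perfect_code_centres[OF H d] ze(1)] by blast
  have "c' \<in> hexa (c + d * x) d"
  proof (cases "x = z")
    case True
    then show ?thesis using sector_subset_hexa[OF ze(2)] ze(3) by blast
  next
    case False
    define y where "y = - (x - z)"
    have y: "y \<in> units6" using x(2) False units6_uminus[of "x - z"] by (auto simp: y_def)
    define k where "k = e * cnj y"
    have k: "k \<in> units6" unfolding k_def by (intro units6_mult units6_cnj ze(2) y)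
    have yk: "y * k = e"
      unfolding k_def using units6_mult_cnj[OF y] by (simp add: mult.left_commute)
    \<comment> \<open>Seen from the hexagon with centre \<open>x\<close>, the point \<open>z\<close> is the corner in direction \<open>y\<close>, and \<open>k\<close> tells
      which of the six lattice triangles at this corner is meant.\<close>
    have T: "tri (c + d * z) (d * e) = tri (c + d * x + d * y) (d * y * k)"
      by (simp add: mult.assoc yk) (simp add: y_def algebra_simps)
    have Hx: "hexa (c + d * x) (d * y) \<in> \<tau>"
      unfolding hexa_turn[OF y] using x(1) by (simp add: centres_def)
    have "k \<notin> fan"
    proof
      assume "k \<in> fan"
      from triangles_around_corner[OF Hx _ this] have "tri (c + d * x + d * y) (d * y * k) \<in> \<tau>"
        using d units6_nonzero[OF y] by simp
      then show False using notri unfolding T by blast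
    qed
    then have "k \<in> {-1, \<omega> - 1}" using k by (auto simp: units6_def fan_def)
    from inner_triangle_subset_hexa[OF this] show ?thesis
      using ze(3) unfolding T hexa_turn[OF y, symmetric, of _ d] by blast
  qed
  from hex[OF x(1) this] have c': "c' = c + d * x" .
  have "hexa c' d' = hexa c' d"
    using face_through_centre[of c' d "hexa c' d'"] x(1) H'(1) centre_in_hexa c' by (simp add: centres_def)
  moreover have "c' + d' * 1 extreme_point_of hexa c' d'"
    unfolding hexa_extreme_point using one_units6 by blast
  ultimately obtain u where "u \<in> units6" "d' = d * u"
    by (auto simp: hexa_extreme_point)
  then show ?thesis using x(1) c' by blast
qed

end

section \<open>Automorphisms preserve orientation\<close>

lemma hexa_affine_image:
  "(\<lambda>z. a * z + b) ` hexa c d = hexa (a * c + b) (a * d)"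
  "(\<lambda>z. a * cnj z + b) ` hexa c d = hexa (a * cnj c + b) (a * cnj d)"
proof -
  have hull: "(\<lambda>z. f z + b) ` (convex hull S) = convex hull ((\<lambda>z. f z + b) ` S)" if "linear f" for f :: "complex \<Rightarrow> complex" and S
  proof -
    have "(\<lambda>z. f z + b) ` T = (\<lambda>z. b + z) ` f ` T" for T
      by (simp only: image_image add.commute)
    then show ?thesis
      by (simp only: convex_hull_translation convex_hull_linear_image[OF that])
  qed
  have "linear ((*) a)" "linear (\<lambda>z. a * cnj z)"
    by (auto intro!: linearI simp: algebra_simps scaleR_conv_of_real)
  from this[THEN hull]
  have 1: "(\<lambda>z. a * z + b) ` hexa c d = convex hull ((\<lambda>z. a * z + b) ` (\<lambda>u. c + d * u) ` units6)"
   and 2: "(\<lambda>z. a * cnj z + b) ` hexa c d = convex hull ((\<lambda>z. a * cnj z + b) ` (\<lambda>u. c + d * u) ` units6)"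
    unfolding hexa_def by blast+
  have cnj6: "cnj ` units6 = units6"
    using units6_cnj by (metis complex_cnj_cnj image_iff subsetI subset_antisym image_subset_iff)
  have "(\<lambda>z. a * z + b) ` (\<lambda>u. c + d * u) ` units6 = (\<lambda>u. a * c + b + a * d * u) ` units6"
    by (simp add: image_image algebra_simps)
  then show "(\<lambda>z. a * z + b) ` hexa c d = hexa (a * c + b) (a * d)"
    unfolding 1 by (simp add: hexa_def)
  have "(\<lambda>z. a * cnj z + b) ` (\<lambda>u. c + d * u) ` units6 = (\<lambda>u. a * cnj c + b + a * cnj d * u) ` cnj ` units6"
    by (simp add: image_image algebra_simps)
  then show "(\<lambda>z. a * cnj z + b) ` hexa c d = hexa (a * cnj c + b) (a * cnj d)"
    unfolding 2 cnj6 by (simp add: hexa_def)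
qed

text \<open>After normalizing to \<open>f 0 = 0\<close> and \<open>f 1 = 1\<close>, an isometry preserves inner products, so it preserves real
  parts, and \<open>f \<i> = \<plusminus>\<i>\<close> determines the imaginary parts.\<close>

lemma isometries_cases:
  assumes "g \<in> isometries"
  obtains (direct) a b where "norm a = 1" "g = (\<lambda>z. a * z + b)"
    | (opposite) a b where "norm a = 1" "g = (\<lambda>z. a * cnj z + b)"
proof -
  have iso: "dist (g x) (g y) = dist x y" for x y
    using assms by (simp add: isometries_def)
  define a where "a = g 1 - g 0"
  define f where "f z = (g z - g 0) / a" for z
  have na: "norm a = 1" using iso[of 1 0] by (simp add: a_def dist_norm)
  then have a0: "a \<noteq> 0" by auto
  have g: "g z = a * f z + g 0" for z using a0 by (simp add: f_def)
  have df: "norm (f x - f y) = norm (x - y)" for x y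
  proof -
    have "f x - f y = (g x - g y) / a" by (simp add: f_def diff_divide_distrib)
    then show ?thesis using iso[of x y] na by (simp add: dist_norm norm_divide)
  qed
  have f0: "f 0 = 0" "f 1 = 1" using a0 by (simp_all add: f_def a_def)
  have nf: "norm (f x) = norm x" for x using df[of x 0] f0 by simp
  have sq: "(norm x)\<^sup>2 = (Re x)\<^sup>2 + (Im x)\<^sup>2" for x by (rule cmod_power2)
  have dot: "Re (f x) * Re (f y) + Im (f x) * Im (f y) = Re x * Re y + Im x * Im y" for x y
    using arg_cong[OF df[of x y], of "\<lambda>r. r\<^sup>2"] arg_cong[OF nf[of x], of "\<lambda>r. r\<^sup>2"] arg_cong[OF nf[of y], of "\<lambda>r. r\<^sup>2"]
    unfolding sq by (simp add: power2_eq_square algebra_simps)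
  have Re: "Re (f x) = Re x" for x using dot[of x 1] f0 by simp
  have "(Im (f \<i>))\<^sup>2 = 1" using arg_cong[OF nf[of \<i>], of "\<lambda>r. r\<^sup>2"] Re[of \<i>] unfolding sq by simp
  then consider "Im (f \<i>) = 1" | "Im (f \<i>) = -1" by (auto simp: power2_eq_1_iff)
  then show thesis
  proof cases
    case 1
    then have f: "f x = x" for x using dot[of x \<i>] Re by (simp add: complex_eq_iff)
    have "g = (\<lambda>z. a * z + g 0)" using g unfolding f by (rule ext)
    with na show thesis by (rule direct)
  next
    case 2
    have f: "f x = cnj x" for x using dot[of x \<i>] Re[of x] Re[of \<i>] 2 by (simp add: complex_eq_iff)
    have "g = (\<lambda>z. a * cnj z + g 0)" using g unfolding f by (rule ext)
    with na show thesis by (rule opposite)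
  qed
qed

context snub_hexagonal
begin

lemma Aut_preserves_faces: "g \<in> carrier (Aut \<tau>) \<Longrightarrow> P \<in> \<tau> \<Longrightarrow> g ` P \<in> \<tau>"
  by (auto simp: Aut_def)

lemma hexagon_exists: obtains c d where "hexa c d \<in> \<tau>" "d \<noteq> 0"
proof -
  obtain P where P: "P \<in> \<tau>" using covers_plane by blast
  then obtain v where "v extreme_point_of P"
  proof (cases rule: face_cases)
    case (triangle v d)
    then show ?thesis using that[of v] tri_extreme_point by simp
  next
    case (hexagon c d)
    then show ?thesis using that[of "c + d * 1"] hexa_extreme_point one_units6 by blast
  qed
  then have "v \<in> vertices \<tau>" unfolding vertices_def using P by blast
  then show ?thesis using hexagon_at that by blast
qed

text \<open>The image of the given hexagon is again aligned with the lattice. So the automorphism maps the steps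
  between neighbouring hexagon centres to steps of the opposite chirality, which do not occur.\<close>

theorem no_opposite_automorphism:
  assumes "(\<lambda>z. a * cnj z + b) \<in> carrier (Aut \<tau>)" "norm a = 1"
  shows False
proof -
  define g where "g = (\<lambda>z. a * cnj z + b)"
  have image: "hexa (g c) (a * cnj d) \<in> \<tau>" if "hexa c d \<in> \<tau>" for c d
    using Aut_preserves_faces[OF assms(1) that] unfolding hexa_affine_image g_def .
  obtain c d where H: "hexa c d \<in> \<tau>" and d: "d \<noteq> 0" using hexagon_exists by blast
  have "0 \<in> centres c d" using H by (simp add: centres_def)
  from perfect_code_chirality[OF perfect_code_centres[OF H d] this]
  obtain \<zeta> where \<zeta>: "\<zeta> \<in> {\<omega>, cnj \<omega>}"
    and chir: "\<And>z u. \<lbrakk>z \<in> centres c d; u \<in> units6\<rbrakk> \<Longrightarrow> z + u * (2 + \<zeta>) \<in> centres c d \<and> z + u * (2 + cnj \<zeta>) \<notin> centres c d"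
    by blast
  have "a * cnj d \<noteq> 0" using d assms(2) by auto
  from hexagon_centres_grid[OF H d image[OF H] this] obtain z u
    where zu: "z \<in> centres c d" "u \<in> units6" "g c = c + d * z" "a * cnj d = d * u" by blast
  have "hexa (c + d * (2 + \<zeta>)) d \<in> \<tau>"
    using chir[OF \<open>0 \<in> centres c d\<close> one_units6] by (simp add: centres_def)
  from image[OF this] have "hexa (g (c + d * (2 + \<zeta>))) d \<in> \<tau>"
    unfolding zu(4) hexa_turn[OF zu(2)] .
  also have "g (c + d * (2 + \<zeta>)) = g c + (a * cnj d) * (2 + cnj \<zeta>)"
    by (simp add: g_def algebra_simps)
  also have "\<dots> = c + d * (z + u * (2 + cnj \<zeta>))"
    unfolding zu(3,4) by (simp add: algebra_simps)
  finally have "hexa (c + d * (z + u * (2 + cnj \<zeta>))) d \<in> \<tau>" .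
  moreover have "z + u * (2 + cnj \<zeta>) \<in> Z_omega"
    using zu(1,2) zeta_sq(2)[OF \<zeta>] Z_omega_of_int(1)[of 2] by (auto simp: centres_def units6_iff Z_omega_closed)
  ultimately show False
    using chir[OF zu(1,2)] by (simp add: centres_def)
qed

lemma Aut_cases:
  assumes "g \<in> carrier (Aut \<tau>)"
  obtains a b where "norm a = 1" "g = (\<lambda>z. a * z + b)"
proof -
  have "g \<in> isometries" using assms by (simp add: Aut_def)
  then show thesis
  proof (cases rule: isometries_cases)
    case (opposite a b)
    then show thesis using no_opposite_automorphism assms by blast
  qed (use that in blast)
qed

text \<open>An automorphism that moves a corner of a hexagon to the next one fixes the hexagon, as there is no other one at that
  corner. It fixes the centre, and it is not a reflection.\<close>

lemma sixfold_rotation: "\<exists>b. (\<lambda>z. \<omega> * z + b) \<in> carrier (Aut \<tau>)"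
proof -
  obtain c d where H: "hexa c d \<in> \<tau>" and d: "d \<noteq> 0" using hexagon_exists by blast
  have w6: "\<omega> \<in> units6" by (simp add: units6_def)
  have V: "c + d * 1 \<in> vertices \<tau>" "c + d * \<omega> \<in> vertices \<tau>"
    using vertex_of_hexagon[OF H] one_units6 w6 by blast+
  have "vertex_transitive \<tau>" using archimedean by (simp add: archimedean_3_3_3_3_6_def)
  then obtain g where g: "g \<in> carrier (Aut \<tau>)" "g (c + d * 1) = c + d * \<omega>"
    unfolding vertex_transitive_def using V by blast
  obtain a b where ab: "norm a = 1" "g = (\<lambda>z. a * z + b)"
    using Aut_cases[OF g(1)] by blast
  have im: "hexa (a * c + b) (a * d) \<in> \<tau>"
    using Aut_preserves_faces[OF g(1) H] unfolding ab(2) hexa_affine_image .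
  have ad: "a * d \<noteq> 0" using ab(1) d by auto
  have eq: "c + d * \<omega> = (a * c + b) + a * d * 1"
    using g(2) unfolding ab(2) by (simp add: algebra_simps)
  have "hexa (a * c + b) (a * d) = hexa c d"
  proof (rule hexagon_at_unique[OF im H])
    show "c + d * \<omega> extreme_point_of hexa (a * c + b) (a * d)"
      unfolding hexa_extreme_point eq using one_units6 by blast
    show "c + d * \<omega> extreme_point_of hexa c d"
      unfolding hexa_extreme_point using w6 by blast
    show "regular_polygon 6 (hexa (a * c + b) (a * d))" "regular_polygon 6 (hexa c d)"
      using regular_hexagon_iff ad d by blast+
  qed
  then have "a * c + b = c" by (rule hexa_same_centre)
  then have "a = \<omega>" using eq d by simp
  then show ?thesis using g(1) ab(2) by blast
qed

end

section \<open>Flag orbits and almost regularity\<close>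

lemma flag_act_simps:
  "flag_act (g \<circ> h) \<Phi> = flag_act g (flag_act h \<Phi>)"
  "flag_act id \<Phi> = \<Phi>"
  by (cases \<Phi>; simp add: flag_act_def image_comp)+

lemma card_image_eq_if_same_fibres:
  assumes "\<And>x y. \<lbrakk>x \<in> A; y \<in> A\<rbrakk> \<Longrightarrow> f x = f y \<longleftrightarrow> g x = g y"
  shows "card (f ` A) = card (g ` A)"
proof -
  define h where "h y = g (inv_into A f y)" for y
  have hf: "h (f x) = g x" if "x \<in> A" for x
  proof -
    have "f (inv_into A f (f x)) = f x" "inv_into A f (f x) \<in> A"
      using that by (simp_all add: f_inv_into_f inv_into_into)
    then show ?thesis using assms that by (simp add: h_def)
  qed
  have "inj_on h (f ` A)"
    by (rule inj_onI) (use hf assms in force)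
  moreover have "h ` f ` A = g ` A"
    using hf by (force simp: image_image)
  ultimately show ?thesis by (metis card_image)
qed

text \<open>The map from the finer to the coarser classes is surjective between finite sets of the same size. The
  finiteness of the finer partition comes from the equality, because the other cardinal is positive.\<close>

lemma same_fibres_if_card_image_eq:
  assumes coarser: "\<And>x y. \<lbrakk>x \<in> A; y \<in> A; f x = f y\<rbrakk> \<Longrightarrow> g x = g y"
    and card: "card (f ` A) = card (g ` A)" and fin: "finite (g ` A)" and xy: "x \<in> A" "y \<in> A" "g x = g y"
  shows "f x = f y"
proof -
  define h where "h y = g (inv_into A f y)" for y
  have hf: "h (f x) = g x" if "x \<in> A" for x
    using that coarser[of "inv_into A f (f x)" x] by (simp add: h_def f_inv_into_f inv_into_into)
  have "card (g ` A) > 0" using fin xy(1) by (auto simp: card_gt_0_iff)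
  then have "finite (f ` A)" using card by (metis card_ge_0_finite)
  moreover have "h ` f ` A = g ` A"
    using hf by (force simp: image_image)
  ultimately have "inj_on h (f ` A)" using card by (metis eq_card_imp_inj_on)
  then show ?thesis by (rule inj_onD) (simp_all add: hf xy)
qed

lemma Aut_simps [simp]: "mult (Aut \<tau>) = (\<circ>)" "one (Aut \<tau>) = id"
  by (simp_all add: Aut_def)

lemma group_Aut: "group (Aut \<tau>)"
proof (rule groupI)
  show "\<one>\<^bsub>Aut \<tau>\<^esub> \<in> carrier (Aut \<tau>)" by (simp add: Aut_def isometries_def)
  show "f \<otimes>\<^bsub>Aut \<tau>\<^esub> g \<in> carrier (Aut \<tau>)" if "f \<in> carrier (Aut \<tau>)" "g \<in> carrier (Aut \<tau>)" for f g
  proof -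
    have "(\<lambda>P. (f \<circ> g) ` P) ` \<tau> = (\<lambda>P. f ` P) ` (\<lambda>P. g ` P) ` \<tau>"
      by (simp only: image_comp[symmetric] image_image)
    then show ?thesis using that by (simp add: Aut_def isometries_def bij_comp)
  qed
  show "\<exists>g\<in>carrier (Aut \<tau>). g \<otimes>\<^bsub>Aut \<tau>\<^esub> f = \<one>\<^bsub>Aut \<tau>\<^esub>" if f: "f \<in> carrier (Aut \<tau>)" for f
  proof (intro bexI[of _ "inv_into UNIV f"])
    have b: "bij f" "(\<lambda>P. f ` P) ` \<tau> = \<tau>" and d: "\<And>x y. dist (f x) (f y) = dist x y"
      using f by (auto simp: Aut_def isometries_def)
    show "inv_into UNIV f \<otimes>\<^bsub>Aut \<tau>\<^esub> f = \<one>\<^bsub>Aut \<tau>\<^esub>"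
      using bij_is_inj[OF b(1)] by (simp add: inv_o_cancel)
    have "dist (inv_into UNIV f x) (inv_into UNIV f y) = dist x y" for x y
      using d[of "inv_into UNIV f x" "inv_into UNIV f y"] by (simp add: surj_f_inv_f[OF bij_is_surj[OF b(1)]])
    moreover have "(\<lambda>P. inv_into UNIV f ` P) ` \<tau> = \<tau>"
    proof -
      have "(\<lambda>P. inv_into UNIV f ` P) ` (\<lambda>P. f ` P) ` \<tau> = \<tau>"
        using bij_is_inj[OF b(1)] by (simp add: image_image)
      then show ?thesis by (simp only: b(2))
    qed
    ultimately show "inv_into UNIV f \<in> carrier (Aut \<tau>)"
      using bij_imp_bij_inv[OF b(1)] by (simp add: Aut_def isometries_def)
  qed
qed (auto simp: comp_assoc)

definition flag_orbit :: "(complex \<Rightarrow> complex) set \<Rightarrow> flag \<Rightarrow> flag set" where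
  "flag_orbit K \<Phi> = {flag_act k \<Phi> | k. k \<in> K}"

lemma flag_orbit_eq_iff:
  assumes K: "subgroup K (Aut \<tau>)"
  shows "flag_orbit K \<Phi> = flag_orbit K \<Psi> \<longleftrightarrow> (\<exists>k\<in>K. \<Phi> = flag_act k \<Psi>)"
proof
  have id: "id \<in> K" using subgroup.one_closed[OF K] by simp
  have comp: "g \<circ> h \<in> K" if "g \<in> K" "h \<in> K" for g h using subgroup.m_closed[OF K that] by simp
  show "flag_orbit K \<Phi> = flag_orbit K \<Psi> \<Longrightarrow> \<exists>k\<in>K. \<Phi> = flag_act k \<Psi>"
  proof -
    assume eq: "flag_orbit K \<Phi> = flag_orbit K \<Psi>"
    have "\<Phi> \<in> flag_orbit K \<Phi>" unfolding flag_orbit_def using id flag_act_simps(2) by (metis (mono_tags, lifting) mem_Collect_eq)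
    then show ?thesis unfolding eq by (auto simp: flag_orbit_def)
  qed
  assume "\<exists>k\<in>K. \<Phi> = flag_act k \<Psi>"
  then obtain k where k: "k \<in> K" "\<Phi> = flag_act k \<Psi>" by blast
  define k' where "k' = inv\<^bsub>Aut \<tau>\<^esub> k"
  have k': "k' \<in> K" unfolding k'_def by (rule subgroup.m_inv_closed[OF K k(1)])
  have "k' \<circ> k = id"
    using group.l_inv[OF group_Aut subgroup.mem_carrier[OF K k(1)]] by (simp add: k'_def)
  then have "\<Psi> = flag_act k' \<Phi>"
    unfolding k(2) by (simp only: flag_act_simps(1)[symmetric] flag_act_simps(2))
  then have "flag_act g \<Psi> \<in> flag_orbit K \<Phi>" if "g \<in> K" for g
    unfolding flag_orbit_def \<open>\<Psi> = _\<close> flag_act_simps(1)[symmetric] using comp[OF that k'] by blast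
  moreover have "flag_act g \<Phi> \<in> flag_orbit K \<Psi>" if "g \<in> K" for g
    unfolding flag_orbit_def k(2) flag_act_simps(1)[symmetric] using comp[OF that k(1)] by blast
  ultimately show "flag_orbit K \<Phi> = flag_orbit K \<Psi>"
    by (auto simp: flag_orbit_def[of K \<Phi>] flag_orbit_def[of K \<Psi>])
qed

lemma orbits_Aut: "orbits (Aut \<tau>) (flags \<tau>) flag_act = flag_orbit (carrier (Aut \<tau>)) ` flags \<tau>"
  by (auto simp: orbits_def orbit_def flag_orbit_def)

text \<open>An orbit of \<open>Aut(\<tau>/G)\<close> consists of the \<open>G\<close>-orbits that make up one orbit of the normalizer.\<close>

lemma card_quotient_flag_orbits:
  assumes G: "subgroup G (Aut \<tau>)"
  shows "card (orbits (quotient_Aut \<tau> G) (quotient_flags \<tau> G) quotient_flag_act)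
    = card (flag_orbit (normalizer (Aut \<tau>) G) ` flags \<tau>)"
proof -
  define N where "N = normalizer (Aut \<tau>) G"
  interpret A: group "Aut \<tau>" by (rule group_Aut)
  have GA: "G \<subseteq> carrier (Aut \<tau>)" by (rule subgroup.subset[OF G])
  have N: "subgroup N (Aut \<tau>)" unfolding N_def by (rule A.normalizer_imp_subgroup[OF GA])
  have normal: "G \<lhd> (Aut \<tau>)\<lparr>carrier := N\<rparr>"
    unfolding N_def by (rule A.subgroup_in_normalizer[OF G])
  have GN: "G \<subseteq> N" using subgroup.subset[OF normal_imp_subgroup[OF normal]] by simp
  have comp: "g \<circ> h \<in> N" if "g \<in> N" "h \<in> N" for g h using subgroup.m_closed[OF N that] by simp
  have compG: "g \<circ> h \<in> G" if "g \<in> G" "h \<in> G" for g h using subgroup.m_closed[OF G that] by simp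
  have idG: "id \<in> G" using subgroup.one_closed[OF G] by simp
  have nG: "(\<lambda>h. n \<circ> h) ` G = (\<lambda>h. h \<circ> n) ` G" if "n \<in> N" for n
  proof -
    have "G #>\<^bsub>(Aut \<tau>)\<lparr>carrier := N\<rparr>\<^esub> n = n <#\<^bsub>(Aut \<tau>)\<lparr>carrier := N\<rparr>\<^esub> G"
      using normal.coset_eq[OF normal] that by simp
    moreover have "n <#\<^bsub>(Aut \<tau>)\<lparr>carrier := N\<rparr>\<^esub> G = (\<lambda>h. n \<circ> h) ` G"
      unfolding l_coset_def by auto
    moreover have "G #>\<^bsub>(Aut \<tau>)\<lparr>carrier := N\<rparr>\<^esub> n = (\<lambda>h. h \<circ> n) ` G"
      unfolding r_coset_def by auto
    ultimately show ?thesis by (simp only:)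
  qed
  have act: "quotient_flag_act (G #>\<^bsub>(Aut \<tau>)\<lparr>carrier := N\<rparr>\<^esub> n) (flag_orbit G \<Phi>) = flag_orbit G (flag_act n \<Phi>)"
    if n: "n \<in> N" for n \<Phi>
  proof -
    have "quotient_flag_act (G #>\<^bsub>(Aut \<tau>)\<lparr>carrier := N\<rparr>\<^esub> n) (flag_orbit G \<Phi>) = {flag_act (h \<circ> n \<circ> h') \<Phi> | h h'. h \<in> G \<and> h' \<in> G}"
      by (auto simp: quotient_flag_act_def r_coset_def flag_orbit_def flag_act_simps) blast
    also have "\<dots> = {flag_act (h \<circ> n) \<Phi> | h. h \<in> G}"
    proof (intro equalityI subsetI)
      fix x assume "x \<in> {flag_act (h \<circ> n \<circ> h') \<Phi> | h h'. h \<in> G \<and> h' \<in> G}"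
      then obtain h h' where h: "h \<in> G" "h' \<in> G" "x = flag_act (h \<circ> n \<circ> h') \<Phi>" by blast
      have "n \<circ> h' \<in> (\<lambda>h. h \<circ> n) ` G" using nG[OF n] h(2) by blast
      then obtain h'' where "h'' \<in> G" "n \<circ> h' = h'' \<circ> n" by blast
      then have "x = flag_act ((h \<circ> h'') \<circ> n) \<Phi>" "h \<circ> h'' \<in> G"
        using h compG by (simp_all add: comp_assoc)
      then show "x \<in> {flag_act (h \<circ> n) \<Phi> | h. h \<in> G}" by blast
    next
      fix x assume "x \<in> {flag_act (h \<circ> n) \<Phi> | h. h \<in> G}"
      then obtain h where "h \<in> G" "x = flag_act (h \<circ> n \<circ> id) \<Phi>" by auto
      then show "x \<in> {flag_act (h \<circ> n \<circ> h') \<Phi> | h h'. h \<in> G \<and> h' \<in> G}" using idG by blast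
    qed
    also have "\<dots> = flag_orbit G (flag_act n \<Phi>)" by (simp add: flag_orbit_def flag_act_simps)
    finally show ?thesis .
  qed
  define Orb where "Orb \<Phi> = {flag_orbit G (flag_act n \<Phi>) | n. n \<in> N}" for \<Phi>
  have flags: "quotient_flags \<tau> G = flag_orbit G ` flags \<tau>"
    by (auto simp: quotient_flags_def orbits_def orbit_def flag_orbit_def)
  have carrier: "carrier (quotient_Aut \<tau> G) = {G #>\<^bsub>(Aut \<tau>)\<lparr>carrier := N\<rparr>\<^esub> n | n. n \<in> N}"
    by (auto simp: quotient_Aut_def N_def FactGroup_def RCOSETS_def)
  have orbit: "orbit (quotient_Aut \<tau> G) quotient_flag_act (flag_orbit G \<Phi>) = Orb \<Phi>" for \<Phi>
  proof -
    have "orbit (quotient_Aut \<tau> G) quotient_flag_act (flag_orbit G \<Phi>)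
      = {quotient_flag_act (G #>\<^bsub>(Aut \<tau>)\<lparr>carrier := N\<rparr>\<^esub> n) (flag_orbit G \<Phi>) | n. n \<in> N}"
      unfolding orbit_def carrier by blast
    also have "\<dots> = Orb \<Phi>" unfolding Orb_def using act by metis
    finally show ?thesis .
  qed
  have "orbits (quotient_Aut \<tau> G) (quotient_flags \<tau> G) quotient_flag_act
     = (\<lambda>X. orbit (quotient_Aut \<tau> G) quotient_flag_act X) ` flag_orbit G ` flags \<tau>"
    unfolding orbits_def flags by blast
  also have "\<dots> = Orb ` flags \<tau>" by (simp only: image_image orbit)
  finally have orbits: "orbits (quotient_Aut \<tau> G) (quotient_flags \<tau> G) quotient_flag_act = Orb ` flags \<tau>" .
  have "Orb \<Phi> = Orb \<Psi> \<longleftrightarrow> flag_orbit N \<Phi> = flag_orbit N \<Psi>" for \<Phi> \<Psi>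
  proof
    assume eq: "Orb \<Phi> = Orb \<Psi>"
    have "flag_orbit G (flag_act id \<Phi>) \<in> Orb \<Phi>" unfolding Orb_def using idG GN by blast
    then obtain n where n: "n \<in> N" "flag_orbit G \<Phi> = flag_orbit G (flag_act n \<Psi>)"
      unfolding eq by (auto simp: Orb_def flag_act_simps)
    then obtain h where h: "h \<in> G" "\<Phi> = flag_act h (flag_act n \<Psi>)" using flag_orbit_eq_iff[OF G] by blast
    have "h \<circ> n \<in> N" using comp h(1) n(1) GN by blast
    then show "flag_orbit N \<Phi> = flag_orbit N \<Psi>"
      unfolding flag_orbit_eq_iff[OF N] h(2) flag_act_simps(1)[symmetric] by blast
  next
    have sub: "Orb \<Phi> \<subseteq> Orb \<Psi>" if "flag_orbit N \<Phi> = flag_orbit N \<Psi>" for \<Phi> \<Psi>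
    proof -
      obtain n where n: "n \<in> N" "\<Phi> = flag_act n \<Psi>" using \<open>flag_orbit N \<Phi> = flag_orbit N \<Psi>\<close> flag_orbit_eq_iff[OF N] by blast
      show ?thesis
        unfolding Orb_def n(2) flag_act_simps(1)[symmetric] using comp[OF _ n(1)] by blast
    qed
    show "flag_orbit N \<Phi> = flag_orbit N \<Psi> \<Longrightarrow> Orb \<Phi> = Orb \<Psi>"
      using sub[of \<Phi> \<Psi>] sub[of \<Psi> \<Phi>] by auto
  qed
  then have "card (Orb ` flags \<tau>) = card (flag_orbit N ` flags \<tau>)"
    by (intro card_image_eq_if_same_fibres)
  then show ?thesis unfolding orbits N_def .
qed

lemma affine_image_flag:
  fixes a b :: complex
  assumes a: "a \<noteq> 0"
  defines "g \<equiv> \<lambda>z. a * z + b"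
  shows "S face_of T \<Longrightarrow> g ` S face_of g ` T"
    and "S edge_of T \<Longrightarrow> g ` S edge_of g ` T"
    and "v extreme_point_of T \<Longrightarrow> g v extreme_point_of g ` T"
proof -
  have lin: "linear ((*) a)" "inj ((*) a)"
    using a by (auto intro!: linearI injI simp: algebra_simps scaleR_conv_of_real)
  have g: "g ` S = (+) b ` (*) a ` S" for S by (simp add: g_def image_image add.commute)
  show face: "S face_of T \<Longrightarrow> g ` S face_of g ` T" for S T
    by (simp only: g face_of_translation_eq face_of_linear_image[OF lin])
  show "S edge_of T \<Longrightarrow> g ` S edge_of g ` T"
    using face[of S T] by (simp only: edge_of_def g aff_dim_translation_eq aff_dim_injective_linear_image[OF lin])
  show "v extreme_point_of T \<Longrightarrow> g v extreme_point_of g ` T"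
    using face[of "{v}" T] by (simp only: face_of_singleton[symmetric] image_insert image_empty)
qed

context snub_hexagonal
begin

lemma flag_vertex:
  assumes "(v, e, P) \<in> flags \<tau>"
  shows "v extreme_point_of P" "v \<in> vertices \<tau>"
proof -
  have *: "P \<in> \<tau>" "e face_of P" "{v} face_of e"
    using assms by (auto simp: flags_def edge_of_def face_of_singleton)
  have "{v} face_of P" using *(3,2) by (rule face_of_trans)
  then show "v extreme_point_of P" by (simp only: face_of_singleton)
  then show "v \<in> vertices \<tau>" using *(1) unfolding vertices_def by blast
qed

lemma flag_act_closed:
  assumes "g \<in> carrier (Aut \<tau>)" "\<Phi> \<in> flags \<tau>"
  shows "flag_act g \<Phi> \<in> flags \<tau>"
proof -
  obtain a b where ab: "norm a = 1" "g = (\<lambda>z. a * z + b)" using Aut_cases[OF assms(1)] by blast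
  then have a: "a \<noteq> 0" by auto
  obtain v e P where F: "\<Phi> = (v, e, P)" "P \<in> \<tau>" "e edge_of P" "v extreme_point_of e"
    using assms(2) by (auto simp: flags_def)
  have "g ` P \<in> \<tau>" using Aut_preserves_faces[OF assms(1) F(2)] .
  then show ?thesis
    using affine_image_flag(2)[OF a F(3), of b] affine_image_flag(3)[OF a F(4), of b]
    by (simp add: F(1) flags_def flag_act_def ab(2))
qed

text \<open>Two direct isometries that map \<open>v\<close> to the same point and \<open>e\<close> to the same segment differ at most
  by a half-turn about \<open>v\<close>. That would make \<open>v\<close> the midpoint of two points of the edge, but it is an end point.\<close>

lemma flag_act_free:
  assumes g: "g \<in> carrier (Aut \<tau>)" and h: "h \<in> carrier (Aut \<tau>)" and F: "\<Phi> \<in> flags \<tau>"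
    and eq: "flag_act g \<Phi> = flag_act h \<Phi>"
  shows "g = h"
proof -
  obtain v e P where \<Phi>: "\<Phi> = (v, e, P)" "e edge_of P" "v extreme_point_of e"
    using F by (auto simp: flags_def)
  have gh: "g v = h v" "g ` e = h ` e" using eq by (simp_all add: \<Phi>(1) flag_act_def)
  obtain a b where ab: "norm a = 1" "g = (\<lambda>z. a * z + b)" using Aut_cases[OF g] by blast
  obtain a' b' where ab': "norm a' = 1" "h = (\<lambda>z. a' * z + b')" using Aut_cases[OF h] by blast
  have dim: "aff_dim e = 1" using \<Phi>(2) by (simp add: edge_of_def)
  have ve: "v \<in> e" using \<Phi>(3) by (simp only: extreme_point_of_def)
  have "e \<noteq> {v}" using dim by auto
  then obtain x where x: "x \<in> e" "x \<noteq> v" using ve by blast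
  then have "g x \<in> h ` e" unfolding gh(2)[symmetric] by blast
  then obtain y where y: "y \<in> e" "g x = h y" by blast
  have "collinear e" using dim by (simp add: collinear_aff_dim)
  moreover have "{x, v, y} \<subseteq> e" using ve x y by blast
  ultimately have "collinear {x, v, y}" by (rule collinear_subset)
  then have "collinear {0, x - v, y - v}" using collinear_3[of x v y] x(2) by simp
  then obtain r where r: "y - v = r *\<^sub>R (x - v)"
    using x(2) by (auto simp: collinear_lemma)
  have "a * (x - v) = a' * (y - v)"
  proof -
    have "a * (x - v) = g x - g v" "a' * (y - v) = h y - h v"
      unfolding ab(2) ab'(2) by (simp_all add: algebra_simps)
    then show ?thesis by (simp only: gh(1) y(2))
  qed
  then have aa: "a = a' * of_real r"
    using x(2) by (simp add: r scaleR_conv_of_real)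
  then have "\<bar>r\<bar> = 1" using ab(1) ab'(1) by (simp add: norm_mult)
  moreover have "r \<noteq> -1"
  proof
    assume "r = -1"
    then have "v = midpoint x y" using r by (simp add: midpoint_def scaleR_conv_of_real algebra_simps)
    moreover have "x \<noteq> y" using r \<open>r = -1\<close> x(2) by (auto simp: complex_eq_iff)
    ultimately have "v \<in> open_segment x y" by simp
    then show False using \<Phi>(3) x(1) y(1) unfolding extreme_point_of_def by blast
  qed
  ultimately have "r = 1" by linarith
  then have "a = a'" using aa by simp
  then show ?thesis using gh(1) unfolding ab(2) ab'(2) by simp
qed

lemma flags_nonempty: "flags \<tau> \<noteq> {}"
proof -
  obtain c d where H: "hexa c d \<in> \<tau>" and d: "d \<noteq> 0" using hexagon_exists by blast
  have "(c + d, closed_segment (c + d) (c + d * \<omega>), hexa c d) \<in> flags \<tau>"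
    using H hexa_edge[OF d, of c] by (simp add: flags_def extreme_point_of_segment)
  then show ?thesis by blast
qed

text \<open>By vertex-transitivity each orbit has a flag at one given vertex, where only finitely many faces meet.\<close>

lemma finite_flag_orbits: "finite (flag_orbit (carrier (Aut \<tau>)) ` flags \<tau>)"
proof -
  interpret A: group "Aut \<tau>" by (rule group_Aut)
  obtain v0 e0 P0 where "(v0, e0, P0) \<in> flags \<tau>" using flags_nonempty by (metis equals0I prod_cases3)
  then have v0: "v0 \<in> vertices \<tau>" by (rule flag_vertex(2))
  define At where "At = {P\<in>\<tau>. v0 extreme_point_of P}"
  have "At = {P\<in>\<tau>. v0 extreme_point_of P \<and> regular_polygon 3 P} \<union> {P\<in>\<tau>. v0 extreme_point_of P \<and> regular_polygon 6 P}"
    using face_at_vertex[OF v0] unfolding At_def by blast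
  moreover have "finite {P\<in>\<tau>. v0 extreme_point_of P \<and> regular_polygon 3 P}"
    by (rule card_ge_0_finite) (simp only: card_triangles_at[OF v0] zero_less_numeral)
  moreover have "finite {P\<in>\<tau>. v0 extreme_point_of P \<and> regular_polygon 6 P}"
    by (rule card_ge_0_finite) (simp only: card_hexagons_at[OF v0] zero_less_one)
  ultimately have finAt: "finite At" by simp
  define F0 where "F0 = (\<Union>P\<in>At. (\<lambda>e. (v0, e, P)) ` {e. e face_of P})"
  have "finite {e. e face_of P}" if "P \<in> At" for P
    using finite_polytope_faces[OF face_polytope(1)] that unfolding At_def by blast
  then have "finite F0" unfolding F0_def using finAt by blast
  moreover have "flag_orbit (carrier (Aut \<tau>)) ` flags \<tau> \<subseteq> flag_orbit (carrier (Aut \<tau>)) ` F0"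
  proof
    fix X assume "X \<in> flag_orbit (carrier (Aut \<tau>)) ` flags \<tau>"
    then obtain v e P where X: "X = flag_orbit (carrier (Aut \<tau>)) (v, e, P)" and F: "(v, e, P) \<in> flags \<tau>"
      by auto
    have "vertex_transitive \<tau>" using archimedean by (simp add: archimedean_3_3_3_3_6_def)
    then obtain g where g: "g \<in> carrier (Aut \<tau>)" "g v = v0"
      unfolding vertex_transitive_def using flag_vertex(2)[OF F] v0 by blast
    have gF: "(v0, g ` e, g ` P) \<in> flags \<tau>"
      using flag_act_closed[OF g(1) F] by (simp add: flag_act_def g(2))
    have "g ` P \<in> At" "g ` e face_of g ` P"
      using flag_vertex(1)[OF gF] gF by (auto simp: At_def flags_def edge_of_def)
    then have "(v0, g ` e, g ` P) \<in> F0" unfolding F0_def by blast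
    moreover have "X = flag_orbit (carrier (Aut \<tau>)) (v0, g ` e, g ` P)"
      unfolding X by (rule sym) (use g in \<open>auto simp: flag_orbit_eq_iff[OF A.subgroup_self] flag_act_def\<close>)
    ultimately show "X \<in> flag_orbit (carrier (Aut \<tau>)) ` F0" by blast
  qed
  ultimately show ?thesis by (meson finite_imageI finite_subset)
qed

text \<open>If the normalizer has no more flag orbits than the full group, then it has the same orbits. Since the
  action is free, an automorphism is determined by what it does to one flag, and hence lies in the
  normalizer.\<close>

theorem almost_regular_iff_normal:
  assumes "subgroup G (Aut \<tau>)"
  shows "almost_regular \<tau> G \<longleftrightarrow> toroidal \<tau> G \<and> normalizer (Aut \<tau>) G = carrier (Aut \<tau>)"
proof -
  interpret A: group "Aut \<tau>" by (rule group_Aut)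
  define N where "N = normalizer (Aut \<tau>) G"
  have N: "subgroup N (Aut \<tau>)"
    unfolding N_def by (rule A.normalizer_imp_subgroup[OF subgroup.subset[OF assms]])
  have "N = carrier (Aut \<tau>)" if card: "card (flag_orbit N ` flags \<tau>) = card (flag_orbit (carrier (Aut \<tau>)) ` flags \<tau>)"
  proof
    show "N \<subseteq> carrier (Aut \<tau>)" by (rule subgroup.subset[OF N])
    show "carrier (Aut \<tau>) \<subseteq> N"
    proof
      fix g assume g: "g \<in> carrier (Aut \<tau>)"
      obtain \<Phi> where F: "\<Phi> \<in> flags \<tau>" using flags_nonempty by blast
      have gF: "flag_act g \<Phi> \<in> flags \<tau>" by (rule flag_act_closed[OF g F])
      have "flag_orbit N (flag_act g \<Phi>) = flag_orbit N \<Phi>"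
      proof (rule same_fibres_if_card_image_eq[OF _ card finite_flag_orbits gF F])
        show "flag_orbit (carrier (Aut \<tau>)) \<Phi> = flag_orbit (carrier (Aut \<tau>)) \<Psi>" if "flag_orbit N \<Phi> = flag_orbit N \<Psi>" for \<Phi> \<Psi>
          using that subgroup.subset[OF N] unfolding flag_orbit_eq_iff[OF N] flag_orbit_eq_iff[OF A.subgroup_self] by blast
        show "flag_orbit (carrier (Aut \<tau>)) (flag_act g \<Phi>) = flag_orbit (carrier (Aut \<tau>)) \<Phi>"
          using g unfolding flag_orbit_eq_iff[OF A.subgroup_self] by blast
      qed
      then obtain n where n: "n \<in> N" "flag_act g \<Phi> = flag_act n \<Phi>"
        unfolding flag_orbit_eq_iff[OF N] by blast
      have "g = n" using flag_act_free[OF g subgroup.mem_carrier[OF N n(1)] F n(2)] .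
      then show "g \<in> N" using n(1) by simp
    qed
  qed
  then show ?thesis
    unfolding almost_regular_def card_quotient_flag_orbits[OF assms] orbits_Aut N_def by auto
qed

end

section \<open>Sublattices of \<open>\<int>[\<omega>]\<close> and their index\<close>

definition int_span :: "complex \<Rightarrow> complex \<Rightarrow> complex set" where
  "int_span s t = {of_int m * s + of_int n * t | m n :: int. True}"

lemma cnj_mult_self: "cnj z * z = of_real ((norm z)\<^sup>2)"
  by (simp only: complex_norm_square mult.commute)

lemma int_span_closed:
  assumes "x \<in> int_span s t" "y \<in> int_span s t"
  shows "x + y \<in> int_span s t" "x - y \<in> int_span s t" "- x \<in> int_span s t" "0 \<in> int_span s t"
proof -
  have *: "of_int m * s + of_int n * t \<in> int_span s t" for m n :: int
    by (auto simp: int_span_def)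
  obtain m n m' n' :: int where x: "x = of_int m * s + of_int n * t" and y: "y = of_int m' * s + of_int n' * t"
    using assms by (auto simp: int_span_def)
  show "x + y \<in> int_span s t" "x - y \<in> int_span s t" "- x \<in> int_span s t" "0 \<in> int_span s t"
    using *[of "m + m'" "n + n'"] *[of "m - m'" "n - n'"] *[of "- m" "- n"] *[of 0 0]
    by (simp_all add: x y algebra_simps)
qed

lemma int_span_generators: "s \<in> int_span s t" "t \<in> int_span s t"
proof -
  have "s = of_int 1 * s + of_int 0 * t" "t = of_int 0 * s + of_int 1 * t" by simp_all
  then show "s \<in> int_span s t" "t \<in> int_span s t" unfolding int_span_def by blast+
qed

lemma int_span_least:
  assumes "s \<in> L" "t \<in> L" and diff: "\<And>x y. \<lbrakk>x \<in> L; y \<in> L\<rbrakk> \<Longrightarrow> x - y \<in> L"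
  shows "int_span s t \<subseteq> L"
proof -
  have zero: "0 \<in> L" using diff[OF assms(1,1)] by simp
  have neg: "- x \<in> L" if "x \<in> L" for x using diff[OF zero that] by simp
  have add: "x + y \<in> L" if "x \<in> L" "y \<in> L" for x y using diff[OF that(1) neg[OF that(2)]] by simp
  have mult: "of_int n * x \<in> L" if x: "x \<in> L" for x and n :: int
  proof (induction n rule: int_induct[of _ 0])
    case (step1 i)
    show ?case using add[OF step1(2) x] by (simp add: algebra_simps)
  next
    case (step2 i)
    show ?case using diff[OF step2(2) x] by (simp add: algebra_simps)
  qed (use zero in simp)
  show ?thesis unfolding int_span_def using add mult assms(1,2) by blast
qed

lemma int_span_1_omega: "int_span 1 \<omega> = Z_omega"
  by (simp add: int_span_def Z_omega_def)

lemma int_span_principal: "int_span x (\<omega> * x) = (*) x ` Z_omega"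
proof -
  have "of_int m * x + of_int n * (\<omega> * x) = x * (of_int m + of_int n * \<omega>)" for m n :: int
    by (simp add: algebra_simps)
  then show ?thesis unfolding int_span_def Z_omega_def by (auto simp: image_def)
qed

text \<open>The rows \<open>(p, q)\<close> and \<open>(r, u)\<close> span the same lattice as the rows \<open>(g, h)\<close> and \<open>(0, w)\<close> of its Hermite normal form,
  where \<open>g = gcd p r\<close>. The lattice points of a \<open>g \<times> \<bar>w\<bar>\<close> rectangle represent its cosets.\<close>

lemma int_matrix_transversal:
  fixes p q r u :: int
  assumes det: "p * u - q * r \<noteq> 0"
  shows "\<exists>R. card R = nat \<bar>p * u - q * r\<bar> \<and>
    (\<forall>x y. \<exists>!v. v \<in> R \<and> (\<exists>i j. x - fst v = i * p + j * r \<and> y - snd v = i * q + j * u))"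
proof -
  define g where "g = gcd p r"
  have g0: "g > 0" using det by (auto simp: g_def)
  obtain p' r' where pr: "p = g * p'" "r = g * r'"
    by (metis g_def dvd_def gcd_dvd1 gcd_dvd2)
  obtain i0 j0 where bez: "i0 * p + j0 * r = g"
    unfolding g_def using bezout_int by blast
  then have "g * (i0 * p' + j0 * r') = g * 1" by (simp add: pr algebra_simps)
  then have one: "i0 * p' + j0 * r' = 1" using g0 by simp
  define h where "h = i0 * q + j0 * u"
  define w where "w = p' * u - q * r'"
  have det_eq: "p * u - q * r = g * w" by (simp add: w_def pr algebra_simps)
  then have w0: "w \<noteq> 0" using det by auto
  have M: "(\<exists>i j. x = i * p + j * r \<and> y = i * q + j * u) \<longleftrightarrow> (\<exists>k l. x = k * g \<and> y = k * h + l * w)" for x y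
  proof
    \<comment> \<open>The old rows in terms of the new ones: \<open>(p, q) = p' (g, h) - j0 (0, w)\<close> and
      \<open>(r, u) = r' (g, h) + i0 (0, w)\<close>.\<close>
    assume "\<exists>i j. x = i * p + j * r \<and> y = i * q + j * u"
    then obtain i j where ij: "x = i * p + j * r" "y = i * q + j * u" by blast
    have "q - p' * h = q * (1 - i0 * p') - p' * j0 * u" by (simp add: h_def algebra_simps)
    also have "1 - i0 * p' = j0 * r'" using one by simp
    finally have q: "q = p' * h - j0 * w" by (simp add: w_def algebra_simps)
    have "u - r' * h = u * (1 - j0 * r') - r' * i0 * q" by (simp add: h_def algebra_simps)
    also have "1 - j0 * r' = i0 * p'" using one by simp
    finally have u: "u = r' * h + i0 * w" by (simp add: w_def algebra_simps)
    have "y = i * (p' * h - j0 * w) + j * (r' * h + i0 * w)" using ij(2) q u by simp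
    then have "x = (i * p' + j * r') * g" "y = (i * p' + j * r') * h + (j * i0 - i * j0) * w"
      using ij(1) by (simp_all add: pr algebra_simps)
    then show "\<exists>k l. x = k * g \<and> y = k * h + l * w" by blast
  next
    assume "\<exists>k l. x = k * g \<and> y = k * h + l * w"
    then obtain k l where kl: "x = k * g" "y = k * h + l * w" by blast
    have "(k * i0 - l * r') * p + (k * j0 + l * p') * r = k * (i0 * p + j0 * r) + l * (p' * r - r' * p)"
      by (simp add: algebra_simps)
    also have "p' * r - r' * p = 0" by (simp add: pr)
    finally have "x = (k * i0 - l * r') * p + (k * j0 + l * p') * r"
      using kl(1) bez by simp
    moreover have "y = (k * i0 - l * r') * q + (k * j0 + l * p') * u"
      using kl(2) by (simp add: h_def w_def algebra_simps)
    ultimately show "\<exists>i j. x = i * p + j * r \<and> y = i * q + j * u" by blast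
  qed
  define R where "R = {0..<g} \<times> {0..<\<bar>w\<bar>}"
  have "card R = nat \<bar>p * u - q * r\<bar>"
    using g0 by (simp add: R_def det_eq abs_mult nat_mult_distrib)
  moreover have "\<exists>!v. v \<in> R \<and> (\<exists>k l. x - fst v = k * g \<and> y - snd v = k * h + l * w)" for x y
  proof (rule ex1I)
    define k where "k = x div g"
    define v where "v = (x mod g, (y - k * h) mod \<bar>w\<bar>)"
    have "x - x mod g = k * g" by (simp add: k_def minus_mod_eq_div_mult)
    moreover obtain l where "(y - k * h) - (y - k * h) mod \<bar>w\<bar> = l * w"
    proof -
      have "w dvd \<bar>w\<bar> * ((y - k * h) div \<bar>w\<bar>)" by simp
      then show ?thesis using that by (metis dvdE minus_mod_eq_mult_div mult.commute)
    qed
    then have "y - (y - k * h) mod \<bar>w\<bar> = k * h + l * w" by simp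
    ultimately show "v \<in> R \<and> (\<exists>k l. x - fst v = k * g \<and> y - snd v = k * h + l * w)"
      using g0 w0 by (auto simp: v_def R_def)
    fix v' assume v': "v' \<in> R \<and> (\<exists>k l. x - fst v' = k * g \<and> y - snd v' = k * h + l * w)"
    then obtain k' l' where kl: "x = fst v' + k' * g" "y = snd v' + k' * h + l' * w"
      by (auto simp: algebra_simps)
    have bound: "0 \<le> fst v'" "fst v' < g" "0 \<le> snd v'" "snd v' < \<bar>w\<bar>"
      using v' by (auto simp: R_def)
    have "fst v' = x mod g" "k' = k"
      unfolding kl(1) k_def using bound g0 by simp_all
    moreover have "snd v' = (y - k' * h) mod \<bar>w\<bar>"
    proof -
      have "y - k' * h = snd v' + \<bar>w\<bar> * (l' * sgn w)"
        using kl(2) by (simp add: mult.left_commute abs_mult_sgn)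
      then show ?thesis using bound by simp
    qed
    ultimately show "v' = v" by (simp add: v_def prod_eq_iff)
  qed
  ultimately show ?thesis unfolding M by blast
qed

text \<open>Rounding both coordinates leaves \<open>s\<close> and \<open>t\<close> of absolute value at most \<open>1/2\<close>, and then
  \<open>s\<^sup>2 + st + t\<^sup>2 \<le> 3/4\<close>.\<close>

lemma Z_omega_rounding:
  obtains q where "q \<in> Z_omega" "norm (z - q) < 1"
proof -
  define y where "y = Im z / Im \<omega>"
  define x where "x = Re z - y * Re \<omega>"
  have z: "z = of_real x + of_real y * \<omega>"
    using Im_omega_pos by (simp add: complex_eq_iff x_def y_def)
  define s where "s = x - of_int (round x)"
  define t where "t = y - of_int (round y)"
  have st: "\<bar>s\<bar> \<le> 1/2" "\<bar>t\<bar> \<le> 1/2"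
    using of_int_round_abs_le[of x] of_int_round_abs_le[of y] by (simp_all add: s_def t_def abs_minus_commute)
  define q :: complex where "q = of_int (round x) + of_int (round y) * \<omega>"
  have "z - q = of_real s + of_real t * \<omega>"
    unfolding z q_def s_def t_def by (simp add: algebra_simps)
  then have "(norm (z - q))\<^sup>2 = s\<^sup>2 + s * t + t\<^sup>2"
    by (simp only: cmod_power2) (simp add: omega_def power2_eq_square field_simps)
  also have "\<dots> \<le> (1/2)\<^sup>2 + (1/2) * (1/2) + (1/2)\<^sup>2"
  proof -
    have "s\<^sup>2 \<le> (1/2)\<^sup>2" "t\<^sup>2 \<le> (1/2)\<^sup>2"
      using power_mono[OF st(1), of 2] power_mono[OF st(2), of 2] by simp_all
    moreover have "s * t \<le> \<bar>s\<bar> * \<bar>t\<bar>" by (simp add: abs_mult[symmetric])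
    moreover have "\<bar>s\<bar> * \<bar>t\<bar> \<le> (1/2) * (1/2)" using st by (intro mult_mono) auto
    ultimately show ?thesis by linarith
  qed
  also have "\<dots> < 1\<^sup>2" by (simp add: power2_eq_square)
  finally have "norm (z - q) < 1" by (rule power_less_imp_less_base) simp
  moreover have "q \<in> Z_omega" unfolding q_def by (rule Z_omegaI)
  ultimately show ?thesis using that by blast
qed

text \<open>A nonzero element of least norm in the ideal generated by \<open>\<alpha>\<close> and \<open>\<beta>\<close> divides every element of the ideal, by
  division with remainder. So it divides \<open>\<gamma>\<close>, which therefore lies in the ideal.\<close>

lemma gcd_omega_bezout:
  assumes \<alpha>: "\<alpha> \<in> Z_omega" "\<alpha> \<noteq> 0" and \<beta>: "\<beta> \<in> Z_omega" and gcd: "is_gcd_omega \<gamma> \<alpha> \<beta>"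
  obtains p q where "p \<in> Z_omega" "q \<in> Z_omega" "\<gamma> = p * \<alpha> + q * \<beta>"
proof -
  define I where "I = {p * \<alpha> + q * \<beta> | p q. p \<in> Z_omega \<and> q \<in> Z_omega}"
  have IZ: "x \<in> Z_omega" if "x \<in> I" for x
    using that \<alpha> \<beta> by (auto simp: I_def Z_omega_closed)
  have I_mult: "z * x \<in> I" if x: "x \<in> I" and z: "z \<in> Z_omega" for x z
  proof -
    obtain p q where "x = p * \<alpha> + q * \<beta>" "p \<in> Z_omega" "q \<in> Z_omega" using x by (auto simp: I_def)
    then have "z * x = (z * p) * \<alpha> + (z * q) * \<beta>" "z * p \<in> Z_omega" "z * q \<in> Z_omega"
      using z by (simp_all add: algebra_simps Z_omega_closed)
    then show ?thesis unfolding I_def by blast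
  qed
  have I_diff: "x - y \<in> I" if x: "x \<in> I" and y: "y \<in> I" for x y
  proof -
    obtain p q where p: "x = p * \<alpha> + q * \<beta>" "p \<in> Z_omega" "q \<in> Z_omega" using x by (auto simp: I_def)
    obtain p' q' where p': "y = p' * \<alpha> + q' * \<beta>" "p' \<in> Z_omega" "q' \<in> Z_omega" using y by (auto simp: I_def)
    have "x - y = (p - p') * \<alpha> + (q - q') * \<beta>" "p - p' \<in> Z_omega" "q - q' \<in> Z_omega"
      using p p' by (simp_all add: algebra_simps Z_omega_closed)
    then show ?thesis unfolding I_def by blast
  qed
  have "\<alpha> = 1 * \<alpha> + 0 * \<beta>" "\<beta> = 0 * \<alpha> + 1 * \<beta>" by simp_all
  then have \<alpha>\<beta>I: "\<alpha> \<in> I" "\<beta> \<in> I" unfolding I_def using Z_omega_of_int(2,3) by blast+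
  define m where "m x = nat \<lfloor>(norm x)\<^sup>2\<rfloor>" for x :: complex
  have m: "real (m x) = (norm x)\<^sup>2" if "x \<in> Z_omega" for x
  proof -
    obtain a b :: int where x: "x = of_int a + of_int b * \<omega>" using \<open>x \<in> Z_omega\<close> by (auto simp: Z_omega_def)
    obtain k :: int where k: "(norm x)\<^sup>2 = of_int k" unfolding x norm_squared_omega_coords by blast
    then have "0 \<le> k" using zero_le_power2[of "norm x"] by simp
    then show ?thesis unfolding m_def k by simp
  qed
  obtain \<delta> where \<delta>: "\<delta> \<in> I" "\<delta> \<noteq> 0" and least: "\<And>x. x \<in> I \<Longrightarrow> x \<noteq> 0 \<Longrightarrow> m \<delta> \<le> m x"
    using ex_has_least_nat[of "\<lambda>x. x \<in> I \<and> x \<noteq> 0" \<alpha> m] \<alpha>\<beta>I(1) \<alpha>(2) by blast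
  have dvd: "dvd_omega \<delta> x" if x: "x \<in> I" for x
  proof -
    obtain q where q: "q \<in> Z_omega" "norm (x / \<delta> - q) < 1" using Z_omega_rounding by blast
    have r: "x - q * \<delta> \<in> I" using I_diff[OF x I_mult[OF \<delta>(1) q(1)]] .
    have "x - q * \<delta> = (x / \<delta> - q) * \<delta>" using \<delta>(2) by (simp add: field_simps)
    then have "norm (x - q * \<delta>) = norm (x / \<delta> - q) * norm \<delta>" by (simp add: norm_mult)
    also have "\<dots> < 1 * norm \<delta>" using q(2) \<delta>(2) by (intro mult_strict_right_mono) auto
    finally have "(norm (x - q * \<delta>))\<^sup>2 < (norm \<delta>)\<^sup>2" by (simp add: power_strict_mono)
    then have "m (x - q * \<delta>) < m \<delta>" using m[OF IZ[OF r]] m[OF IZ[OF \<delta>(1)]] by linarith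
    then have "x - q * \<delta> = 0" using least[OF r] by force
    then show ?thesis using q(1) unfolding dvd_omega_def by (auto simp: mult.commute)
  qed
  have "dvd_omega \<delta> \<gamma>"
    using gcd IZ[OF \<delta>(1)] dvd[OF \<alpha>\<beta>I(1)] dvd[OF \<alpha>\<beta>I(2)] unfolding is_gcd_omega_def by blast
  then obtain z where "z \<in> Z_omega" "\<gamma> = z * \<delta>" unfolding dvd_omega_def by (auto simp: mult.commute)
  then have "\<gamma> \<in> I" using I_mult[OF \<delta>(1)] by simp
  then show ?thesis using that unfolding I_def by blast
qed

lemma Im_omega_eq [simp]: "Im_omega (of_int a + of_int b * \<omega>) = b"
  unfolding Im_omega_def by (rule the_equality) auto

lemma cnj_mult_coords:
  "cnj (of_int a + of_int b * \<omega>) * (of_int c + of_int e * \<omega>)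
    = of_int (a * c + b * c + b * e) + of_int (a * e - b * c) * \<omega>"
proof -
  have "(of_int a + of_int b * (1 - \<omega>)) * (of_int c + of_int e * \<omega>)
     = of_int (a * c + b * c) + of_int (a * e + b * e - b * c) * \<omega> - of_int (b * e) * (\<omega> * \<omega>)"
    by (simp add: algebra_simps)
  then show ?thesis by (simp add: cnj_omega omega_sq algebra_simps)
qed

text \<open>If \<open>y = u + v\<omega>\<close>, then the coefficient of \<open>\<omega>\<close> in \<open>\<omega>y\<close> is \<open>u + v\<close>; so \<open>D\<close> divides \<open>v\<close> and \<open>u\<close>.\<close>

lemma int_multiple_if_Im_multiples:
  assumes y: "y = of_int u + of_int (D * n) * \<omega>" and wy: "\<omega> * y = of_int u' + of_int (D * q) * \<omega>"
  shows "\<exists>w\<in>Z_omega. y = of_int D * w"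
proof -
  have "\<omega> * y = of_int u * \<omega> + of_int (D * n) * (\<omega> * \<omega>)"
    by (simp add: y algebra_simps)
  also have "\<dots> = of_int (- (D * n)) + of_int (u + D * n) * \<omega>"
    by (simp add: omega_sq algebra_simps)
  finally have "of_int (- (D * n)) + of_int (u + D * n) * \<omega> = of_int u' + of_int (D * q) * \<omega>"
    using wy by simp
  then have u: "u = D * (q - n)" unfolding omega_int_coords_eq_iff by (simp add: algebra_simps)
  have "y = of_int D * (of_int (q - n) + of_int n * \<omega>)" unfolding y u by (simp add: algebra_simps)
  then show ?thesis using Z_omegaI by blast
qed

text \<open>Coordinates of \<open>\<alpha>\<close> and \<open>\<beta>\<close> with respect to the basis \<open>\<gamma>\<close>, \<open>\<gamma>\<omega>\<close> of the ideal generated by \<open>\<gamma>\<close>.\<close>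

locale lattice_generators =
  fixes \<alpha> \<beta> \<gamma> :: complex and a b c e :: int
  assumes gcd: "is_gcd_omega \<gamma> \<alpha> \<beta>" and \<gamma>0: "\<gamma> \<noteq> 0"
    and \<alpha>: "\<alpha> = \<gamma> * (of_int a + of_int b * \<omega>)" and \<beta>: "\<beta> = \<gamma> * (of_int c + of_int e * \<omega>)"
    and det: "a * e - b * c \<noteq> 0"
begin

definition "D = a * e - b * c"

definition "\<eta>0 = of_int D * \<gamma>"

text \<open>Cramer's rule: \<open>D\<close> times the basis \<open>\<gamma>\<close>, \<open>\<gamma>\<omega>\<close> is expressed by the adjugate matrix.\<close>

lemma eta_coords: "\<eta>0 = of_int e * \<alpha> + of_int (- b) * \<beta>" "\<omega> * \<eta>0 = of_int (- c) * \<alpha> + of_int a * \<beta>"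
  by (simp_all add: \<eta>0_def D_def \<alpha> \<beta> algebra_simps)

lemma eta_multiple_in_span:
  assumes "w \<in> Z_omega"
  shows "\<eta>0 * w \<in> int_span \<alpha> \<beta>"
proof -
  obtain x y :: int where w: "w = of_int x + of_int y * \<omega>" using assms by (auto simp: Z_omega_def)
  have "\<eta>0 * w = of_int x * \<eta>0 + of_int y * (\<omega> * \<eta>0)" by (simp add: w algebra_simps)
  also have "\<dots> = of_int (x * e - y * c) * \<alpha> + of_int (y * a - x * b) * \<beta>"
    unfolding eta_coords(2) by (subst eta_coords(1)) (simp add: algebra_simps)
  finally show ?thesis unfolding int_span_def by blast
qed

text \<open>After division by \<open>\<gamma>\<close>, let \<open>x' = m\<alpha>' + n\<beta>'\<close>. In \<open>cnj \<alpha>' * x'\<close> the first summand is an integer, and the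
  coefficient of \<open>\<omega>\<close> in the second one is \<open>nD\<close>. The same holds for \<open>\<omega>x'\<close>, so \<open>D\<close> divides
  \<open>cnj \<alpha>' * x'\<close>, and likewise \<open>cnj \<beta>' * x'\<close>. A Bezout identity for \<open>\<alpha>'\<close> and \<open>\<beta>'\<close> gives that \<open>D\<close>
  divides \<open>x'\<close>.\<close>

lemma span_closed_multiple_of_eta:
  assumes x: "x \<in> int_span \<alpha> \<beta>" and wx: "\<omega> * x \<in> int_span \<alpha> \<beta>"
  shows "\<exists>w\<in>Z_omega. x = \<eta>0 * w"
proof -
  define \<alpha>' :: complex where "\<alpha>' = of_int a + of_int b * \<omega>"
  define \<beta>' :: complex where "\<beta>' = of_int c + of_int e * \<omega>"
  have Z: "\<alpha>' \<in> Z_omega" "\<beta>' \<in> Z_omega" unfolding \<alpha>'_def \<beta>'_def by (rule Z_omegaI)+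
  have \<alpha>\<beta>: "\<alpha> = \<gamma> * \<alpha>'" "\<beta> = \<gamma> * \<beta>'" by (simp_all add: \<alpha> \<beta> \<alpha>'_def \<beta>'_def)
  have \<gamma>Z: "\<gamma> \<in> Z_omega" using gcd by (simp add: is_gcd_omega_def)
  obtain m n :: int where mn: "x = of_int m * \<alpha> + of_int n * \<beta>" using x by (auto simp: int_span_def)
  obtain m' n' :: int where mn': "\<omega> * x = of_int m' * \<alpha> + of_int n' * \<beta>" using wx by (auto simp: int_span_def)
  define x' where "x' = of_int m * \<alpha>' + of_int n * \<beta>'"
  have xx: "x = \<gamma> * x'" by (simp add: mn x'_def \<alpha>\<beta> algebra_simps)
  have "\<gamma> * (\<omega> * x') = \<gamma> * (of_int m' * \<alpha>' + of_int n' * \<beta>')"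
    using mn' by (simp add: xx \<alpha>\<beta> algebra_simps)
  then have wx': "\<omega> * x' = of_int m' * \<alpha>' + of_int n' * \<beta>'" using \<gamma>0 by simp
  have c1: "cnj \<alpha>' * \<alpha>' = of_int (a * a + b * a + b * b)" "cnj \<beta>' * \<beta>' = of_int (c * c + e * c + e * e)"
    using cnj_mult_coords[of a b a b] cnj_mult_coords[of c e c e] by (simp_all add: \<alpha>'_def \<beta>'_def)
  have c2: "cnj \<alpha>' * \<beta>' = of_int (a * c + b * c + b * e) + of_int D * \<omega>"
    "cnj \<beta>' * \<alpha>' = of_int (c * a + e * a + e * b) + of_int (- D) * \<omega>"
    using cnj_mult_coords[of a b c e] cnj_mult_coords[of c e a b] by (simp_all add: \<alpha>'_def \<beta>'_def D_def algebra_simps)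
  \<comment> \<open>Modulo the integers, \<open>cnj \<alpha>' * \<alpha>'\<close> vanishes and \<open>cnj \<alpha>' * \<beta>'\<close> is \<open>D\<omega>\<close>.\<close>
  have 1: "cnj \<alpha>' * (of_int k * \<alpha>' + of_int l * \<beta>')
    = of_int (k * (a * a + b * a + b * b) + l * (a * c + b * c + b * e)) + of_int (D * l) * \<omega>" for k l
  proof -
    have "cnj \<alpha>' * (of_int k * \<alpha>' + of_int l * \<beta>') = of_int k * (cnj \<alpha>' * \<alpha>') + of_int l * (cnj \<alpha>' * \<beta>')"
      by (simp add: algebra_simps)
    then show ?thesis unfolding c1 c2 by (simp add: algebra_simps)
  qed
  have 2: "cnj \<beta>' * (of_int k * \<alpha>' + of_int l * \<beta>')
    = of_int (k * (c * a + e * a + e * b) + l * (c * c + e * c + e * e)) + of_int (D * - k) * \<omega>" for k l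
  proof -
    have "cnj \<beta>' * (of_int k * \<alpha>' + of_int l * \<beta>') = of_int k * (cnj \<beta>' * \<alpha>') + of_int l * (cnj \<beta>' * \<beta>')"
      by (simp add: algebra_simps)
    then show ?thesis unfolding c1 c2 by (simp add: algebra_simps)
  qed
  have "\<omega> * (cnj \<alpha>' * x') = cnj \<alpha>' * (\<omega> * x')" "\<omega> * (cnj \<beta>' * x') = cnj \<beta>' * (\<omega> * x')" by simp_all
  then have "\<exists>w\<in>Z_omega. cnj \<alpha>' * x' = of_int D * w" "\<exists>w\<in>Z_omega. cnj \<beta>' * x' = of_int D * w"
    using int_multiple_if_Im_multiples[of "cnj \<alpha>' * x'"] int_multiple_if_Im_multiples[of "cnj \<beta>' * x'"]
      1 2 wx' unfolding x'_def by metis+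
  then obtain w1 w2 where w12: "w1 \<in> Z_omega" "cnj \<alpha>' * x' = of_int D * w1" "w2 \<in> Z_omega" "cnj \<beta>' * x' = of_int D * w2"
    by blast
  have "\<alpha> \<noteq> 0"
  proof
    assume "\<alpha> = 0"
    then have "of_int a + of_int b * \<omega> = of_int 0 + of_int 0 * \<omega>" using \<gamma>0 \<alpha> by simp
    then show False unfolding omega_int_coords_eq_iff using det by simp
  qed
  moreover have "\<alpha> \<in> Z_omega" "\<beta> \<in> Z_omega" unfolding \<alpha>\<beta> by (intro Z_omega_mult \<gamma>Z Z)+
  ultimately obtain p q where pq: "p \<in> Z_omega" "q \<in> Z_omega" "\<gamma> = p * \<alpha> + q * \<beta>"
    using gcd_omega_bezout[OF _ _ _ gcd] by blast
  have "\<gamma> * 1 = \<gamma> * (p * \<alpha>' + q * \<beta>')"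
    using pq(3) unfolding \<alpha>\<beta> by (simp add: algebra_simps)
  then have "1 = p * \<alpha>' + q * \<beta>'" using \<gamma>0 by (simp only: mult_cancel_left) simp
  then have "cnj p * cnj \<alpha>' + cnj q * cnj \<beta>' = 1" by (metis complex_cnj_add complex_cnj_mult complex_cnj_one)
  then have "x' = (cnj p * cnj \<alpha>' + cnj q * cnj \<beta>') * x'" by simp
  also have "\<dots> = cnj p * (cnj \<alpha>' * x') + cnj q * (cnj \<beta>' * x')" by (simp add: algebra_simps)
  also have "\<dots> = of_int D * (cnj p * w1 + cnj q * w2)" unfolding w12 by (simp add: algebra_simps)
  finally have "x = \<eta>0 * (cnj p * w1 + cnj q * w2)" unfolding xx \<eta>0_def by simp
  moreover have "cnj p * w1 + cnj q * w2 \<in> Z_omega"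
    using pq w12 by (intro Z_omega_add Z_omega_mult Z_omega_cnj)
  ultimately show ?thesis by blast
qed

end

section \<open>Translation groups and minimal almost regular covers\<close>

lemma independent_pair_iff:
  fixes s t :: complex
  shows "s \<noteq> t \<and> independent {s, t} \<longleftrightarrow> Im (cnj s * t) \<noteq> 0"
proof -
  have "Im (cnj s * t) = 0 \<longleftrightarrow> s = t \<or> dependent {s, t}"
  proof
    assume im: "Im (cnj s * t) = 0"
    show "s = t \<or> dependent {s, t}"
    proof (cases "s = 0")
      case False
      define r where "r = Re (cnj s * t)"
      have r: "cnj s * t = of_real r" using im by (simp add: r_def complex_eq_iff)
      have "t * of_real ((norm s)\<^sup>2) = s * (cnj s * t)"
        by (simp only: cnj_mult_self[symmetric] mult_ac)
      then have "t = (r / (norm s)\<^sup>2) *\<^sub>R s"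
        using False unfolding r by (simp add: scaleR_conv_of_real field_simps)
      then have "t \<in> span {s}" by (metis span_mul span_base singletonI)
      then show ?thesis using dependent_def[of "{s, t}"]
        by (cases "s = t") (auto simp: insert_Diff_if dependent_def insert_commute)
    qed (simp add: dependent_zero)
  next
    assume "s = t \<or> dependent {s, t}"
    then show "Im (cnj s * t) = 0"
    proof
      assume dep: "dependent {s, t}"
      show ?thesis
      proof (rule ccontr)
        assume ne: "Im (cnj s * t) \<noteq> 0"
        then have "s \<noteq> t" by auto
        from dep obtain u where u: "\<exists>v\<in>{s, t}. u v \<noteq> 0" "(\<Sum>v\<in>{s, t}. u v *\<^sub>R v) = 0"
          using dependent_finite[of "{s, t}"] by auto
        then have eq: "u s *\<^sub>R s + u t *\<^sub>R t = 0" using \<open>s \<noteq> t\<close> by simp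
        have "Im (cnj s * (u s *\<^sub>R s + u t *\<^sub>R t)) = u t * Im (cnj s * t)"
          by (simp add: algebra_simps)
        then have ut: "u t = 0" using eq ne by simp
        have "s \<noteq> 0" using ne by auto
        then have "u s = 0" using eq ut by simp
        then show False using u(1) ut by simp
      qed
    qed auto
  qed
  then show ?thesis by blast
qed

lemma plus_fun_comp: "(+) s \<circ> (+) t = (+) (s + t :: complex)"
  by (auto simp: add.assoc)

lemma plus_fun_eq_iff: "(+) s = (+) t \<longleftrightarrow> s = (t :: complex)"
  by (metis add.right_neutral)

lemma plus_fun_mem_image: "(+) s \<in> (+) ` L \<longleftrightarrow> s \<in> (L :: complex set)"
  by (auto simp: plus_fun_eq_iff)

lemma plus_fun_image_subset: "(+) ` L \<subseteq> (+) ` L' \<longleftrightarrow> L \<subseteq> (L' :: complex set)"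
  using plus_fun_mem_image by blast

lemma plus_fun_image_eq: "(+) ` L = (+) ` L' \<longleftrightarrow> L = (L' :: complex set)"
  by (simp only: set_eq_subset plus_fun_image_subset)

lemma inv_plus_fun:
  assumes "(+) t \<in> carrier (Aut \<tau>)" "(+) (- t) \<in> carrier (Aut \<tau>)"
  shows "inv\<^bsub>Aut \<tau>\<^esub> ((+) t) = (+) (- t)"
  by (rule group.inv_equality[OF group_Aut _ assms]) (simp add: plus_fun_comp fun_eq_iff)

lemma plus_uminus_Aut:
  assumes "(+) t \<in> carrier (Aut \<tau>)"
  shows "(+) (- t) \<in> carrier (Aut \<tau>)"
proof -
  interpret A: group "Aut \<tau>" by (rule group_Aut)
  have i: "inv\<^bsub>Aut \<tau>\<^esub> ((+) t) \<circ> (+) t = id" using A.l_inv[OF assms] by simp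
  have "(inv\<^bsub>Aut \<tau>\<^esub> ((+) t)) x = - t + x" for x
  proof -
    have "(inv\<^bsub>Aut \<tau>\<^esub> ((+) t) \<circ> (+) t) (x - t) = x - t" unfolding i by simp
    then show ?thesis by simp
  qed
  then have "inv\<^bsub>Aut \<tau>\<^esub> ((+) t) = (+) (- t)" by blast
  then show ?thesis using A.inv_closed[OF assms] by simp
qed

lemma trans_gen_eq:
  assumes s: "(+) s \<in> carrier (Aut \<tau>)" and t: "(+) t \<in> carrier (Aut \<tau>)"
  shows "trans_gen \<tau> s t = (+) ` int_span s t" "subgroup (trans_gen \<tau> s t) (Aut \<tau>)"
proof -
  interpret A: group "Aut \<tau>" by (rule group_Aut)
  define H where "H = trans_gen \<tau> s t"
  have gens: "{(+) s, (+) t} \<subseteq> carrier (Aut \<tau>)" using s t by simp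
  have H: "subgroup H (Aut \<tau>)"
    unfolding H_def trans_gen_def by (rule A.generate_is_subgroup[OF gens])
  then show "subgroup (trans_gen \<tau> s t) (Aut \<tau>)" by (simp only: H_def)
  have st: "(+) s \<in> H" "(+) t \<in> H" unfolding H_def trans_gen_def by (auto intro: generate.incl)
  have diff: "(+) (x - y) \<in> H" if x: "(+) x \<in> H" and y: "(+) y \<in> H" for x y
  proof -
    have yA: "(+) y \<in> carrier (Aut \<tau>)" using subgroup.mem_carrier[OF H y] .
    have "(+) (- y) \<in> H"
      using subgroup.m_inv_closed[OF H y] unfolding inv_plus_fun[OF yA plus_uminus_Aut[OF yA]] .
    from subgroup.m_closed[OF H x this] show ?thesis by (simp add: plus_fun_comp)
  qed
  have "int_span s t \<subseteq> {x. (+) x \<in> H}"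
    by (rule int_span_least) (use st diff in auto)
  then have "(+) ` int_span s t \<subseteq> H" by blast
  moreover have "g \<in> (+) ` int_span s t" if "g \<in> H" for g
    using that unfolding H_def trans_gen_def
  proof (induction rule: generate.induct)
    case one
    have "\<one>\<^bsub>Aut \<tau>\<^esub> = (+) (0 :: complex)" by (simp add: fun_eq_iff)
    then show ?case
      using int_span_closed(4)[OF int_span_generators(1) int_span_generators(1), of s t] by (rule image_eqI)
  next
    case (incl h)
    then show ?case using int_span_generators by auto
  next
    case (inv h)
    then obtain x where x: "h = (+) x" "x \<in> int_span s t" "(+) x \<in> carrier (Aut \<tau>)" using int_span_generators s t by auto
    then show ?case
      unfolding x(1) inv_plus_fun[OF x(3) plus_uminus_Aut[OF x(3)]] using int_span_closed(3)[OF x(2,2)] by blast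
  next
    case (eng h1 h2)
    then obtain x y where "h1 = (+) x" "x \<in> int_span s t" "h2 = (+) y" "y \<in> int_span s t" by blast
    then show ?case using int_span_closed(1)[of x s t y] by (simp add: plus_fun_comp)
  qed
  ultimately show "trans_gen \<tau> s t = (+) ` int_span s t" unfolding H_def by blast
qed

lemma card_rcosets_translations:
  assumes zero: "0 \<in> M" and diff: "\<And>x y. \<lbrakk>x \<in> M; y \<in> M\<rbrakk> \<Longrightarrow> x - y \<in> M"
    and R: "R \<subseteq> L" "\<And>x. x \<in> L \<Longrightarrow> \<exists>!r. r \<in> R \<and> x - r \<in> M"
  shows "card (rcosets\<^bsub>(Aut \<tau>)\<lparr>carrier := (+) ` L\<rparr>\<^esub> ((+) ` M)) = card R"
proof -
  define coset where "coset x = (\<lambda>m. (+) (m + x)) ` M" for x :: complex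
  have neg: "- x \<in> M" if "x \<in> M" for x using diff[OF zero that] by simp
  have add: "x + y \<in> M" if "x \<in> M" "y \<in> M" for x y using diff[OF that(1) neg[OF that(2)]] by simp
  have rcoset: "(+) ` M #>\<^bsub>(Aut \<tau>)\<lparr>carrier := (+) ` L\<rparr>\<^esub> (+) x = coset x" for x
  proof -
    have "(+) ` M #>\<^bsub>(Aut \<tau>)\<lparr>carrier := (+) ` L\<rparr>\<^esub> (+) x = (\<Union>m\<in>M. {(+) m \<circ> (+) x})"
      by (simp add: r_coset_def)
    also have "\<dots> = coset x" unfolding coset_def plus_fun_comp by blast
    finally show ?thesis .
  qed
  have eq_iff: "coset x = coset y \<longleftrightarrow> x - y \<in> M" for x y
  proof
    assume "coset x = coset y"
    moreover have "(+) (0 + x) \<in> coset x" unfolding coset_def using zero by blast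
    ultimately obtain m where "m \<in> M" "(+) (0 + x) = (+) (m + y)" unfolding coset_def by blast
    then have "x = m + y" unfolding plus_fun_eq_iff by simp
    then show "x - y \<in> M" using \<open>m \<in> M\<close> by simp
  next
    have sub: "coset x \<subseteq> coset y" if "x - y \<in> M" for x y
    proof
      fix g assume "g \<in> coset x"
      then obtain m where m: "m \<in> M" "g = (+) (m + x)" unfolding coset_def by blast
      show "g \<in> coset y"
        unfolding coset_def m(2) by (rule image_eqI[of _ _ "m + (x - y)"]) (simp_all add: add[OF m(1) that])
    qed
    assume "x - y \<in> M"
    then show "coset x = coset y" using sub[of x y] sub[of y x] neg[of "x - y"] by simp
  qed
  have "rcosets\<^bsub>(Aut \<tau>)\<lparr>carrier := (+) ` L\<rparr>\<^esub> ((+) ` M) = coset ` L"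
    unfolding RCOSETS_def using rcoset by auto
  also have "\<dots> = coset ` R"
  proof
    show "coset ` R \<subseteq> coset ` L" using R(1) by blast
    show "coset ` L \<subseteq> coset ` R"
    proof
      fix X assume "X \<in> coset ` L"
      then obtain x where x: "x \<in> L" "X = coset x" by blast
      then obtain r where "r \<in> R" "x - r \<in> M" using R(2) by blast
      then show "X \<in> coset ` R" using eq_iff x(2) by blast
    qed
  qed
  also have "card (coset ` R) = card R"
  proof (rule card_image, rule inj_onI)
    fix r r' assume r: "r \<in> R" "r' \<in> R" "coset r = coset r'"
    have "r - r \<in> M" "r - r' \<in> M" using zero r(3) eq_iff by simp_all
    then show "r = r'" using R r(1,2) by (metis subsetD)
  qed
  finally show ?thesis .
qed

locale snub_hexagonal_lattice = snub_hexagonal +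
  assumes translation_lattice: "translation_group \<tau> = trans_gen \<tau> 1 \<omega>"
begin

lemma translation_iff: "(+) t \<in> carrier (Aut \<tau>) \<longleftrightarrow> t \<in> Z_omega"
proof -
  have "(+) 1 \<in> translation_group \<tau>" "(+) \<omega> \<in> translation_group \<tau>"
    unfolding translation_lattice trans_gen_def by (auto intro: generate.incl)
  then have "(+) 1 \<in> carrier (Aut \<tau>)" "(+) \<omega> \<in> carrier (Aut \<tau>)"
    by (simp_all add: translation_group_def)
  from trans_gen_eq(1)[OF this] have T: "translation_group \<tau> = (+) ` Z_omega"
    unfolding translation_lattice int_span_1_omega .
  have "(+) t \<in> carrier (Aut \<tau>) \<longleftrightarrow> (+) t \<in> translation_group \<tau>"
    by (auto simp: translation_group_def)
  then show ?thesis unfolding T plus_fun_mem_image .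
qed

lemma trans_gen_Z:
  assumes "s \<in> Z_omega" "t \<in> Z_omega"
  shows "trans_gen \<tau> s t = (+) ` int_span s t" "subgroup (trans_gen \<tau> s t) (Aut \<tau>)"
  using trans_gen_eq[of s \<tau> t] assms translation_iff by blast+

lemma int_span_Z: "s \<in> Z_omega \<Longrightarrow> t \<in> Z_omega \<Longrightarrow> int_span s t \<subseteq> Z_omega"
  by (intro int_span_least) (auto simp: Z_omega_closed)

lemma toroidal_iff:
  "toroidal \<tau> G \<longleftrightarrow> (\<exists>s\<in>Z_omega. \<exists>t\<in>Z_omega. Im (cnj s * t) \<noteq> 0 \<and> G = trans_gen \<tau> s t)"
proof -
  have "(+) s \<in> translation_group \<tau> \<longleftrightarrow> s \<in> Z_omega" for s
    using translation_iff by (auto simp: translation_group_def)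
  then show ?thesis
    unfolding toroidal_def independent_pair_iff[symmetric] by blast
qed

lemma conjugate_translation:
  assumes g: "g \<in> carrier (Aut \<tau>)" "g = (\<lambda>z. a * z + b)"
  shows "g \<circ> (+) t \<circ> inv\<^bsub>Aut \<tau>\<^esub> g = (+) (a * t)"
proof -
  interpret A: group "Aut \<tau>" by (rule group_Aut)
  have "g \<circ> (+) t = (+) (a * t) \<circ> g" by (auto simp: g(2) algebra_simps)
  then have "g \<circ> (+) t \<circ> inv\<^bsub>Aut \<tau>\<^esub> g = (+) (a * t) \<circ> (g \<circ> inv\<^bsub>Aut \<tau>\<^esub> g)" by (simp only: comp_assoc)
  also have "g \<circ> inv\<^bsub>Aut \<tau>\<^esub> g = id" using A.r_inv[OF g(1)] by simp
  finally show ?thesis by (simp only: comp_id)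
qed

text \<open>Conjugation by an automorphism with linear part \<open>a\<close> multiplies translation vectors by \<open>a\<close>.\<close>

lemma normalizer_iff:
  assumes L: "L \<subseteq> Z_omega" and g: "g \<in> carrier (Aut \<tau>)" "g = (\<lambda>z. a * z + b)"
  shows "g \<in> normalizer (Aut \<tau>) ((+) ` L) \<longleftrightarrow> (*) a ` L = L"
proof -
  have sub: "(+) ` L \<subseteq> carrier (Aut \<tau>)" using L translation_iff by blast
  have "g <#\<^bsub>Aut \<tau>\<^esub> ((+) ` L) #>\<^bsub>Aut \<tau>\<^esub> (inv\<^bsub>Aut \<tau>\<^esub> g) = (\<lambda>t. g \<circ> (+) t \<circ> inv\<^bsub>Aut \<tau>\<^esub> g) ` L"
    by (auto simp: l_coset_def r_coset_def)
  also have "\<dots> = (+) ` ((*) a ` L)"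
    unfolding conjugate_translation[OF g] by (simp only: image_image)
  finally have "g \<in> normalizer (Aut \<tau>) ((+) ` L) \<longleftrightarrow> (+) ` ((*) a ` L) = (+) ` L"
    using g(1) sub by (simp add: normalizer_def stabilizer_def)
  then show ?thesis by (simp only: plus_fun_image_eq)
qed

text \<open>Conjugating the translation by 1 gives the translation by \<open>a\<close>, so \<open>a\<close> is in \<open>\<int>[\<omega>]\<close>.\<close>

lemma linear_part_unit:
  assumes g: "g \<in> carrier (Aut \<tau>)" "g = (\<lambda>z. a * z + b)" "norm a = 1"
  shows "a \<in> units6"
proof -
  interpret A: group "Aut \<tau>" by (rule group_Aut)
  have "(+) 1 \<in> carrier (Aut \<tau>)" using translation_iff by simp
  then have "g \<circ> (+) 1 \<circ> inv\<^bsub>Aut \<tau>\<^esub> g \<in> carrier (Aut \<tau>)"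
    using g(1) A.m_closed[of "g \<circ> (+) 1" "inv\<^bsub>Aut \<tau>\<^esub> g"] A.m_closed[of g "(+) 1"] by simp
  then have "a \<in> Z_omega" unfolding conjugate_translation[OF g(1,2)] translation_iff by simp
  then show ?thesis using g(3) by (simp add: units6_iff)
qed

text \<open>The linear parts of the automorphisms are units, that is, powers of \<open>\<omega>\<close>, and \<open>\<omega>\<close> itself occurs. So all of
  them preserve the lattice iff \<open>\<omega>\<close> does.\<close>

theorem almost_regular_iff:
  assumes "s \<in> Z_omega" "t \<in> Z_omega" and G: "G = trans_gen \<tau> s t"
  shows "almost_regular \<tau> G \<longleftrightarrow> Im (cnj s * t) \<noteq> 0 \<and> (\<forall>x\<in>int_span s t. \<omega> * x \<in> int_span s t)"
proof -
  define L where "L = int_span s t"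
  have GL: "G = (+) ` L" and sub: "subgroup G (Aut \<tau>)"
    unfolding G L_def using trans_gen_Z[OF assms(1,2)] by blast+
  have LZ: "L \<subseteq> Z_omega" unfolding L_def by (rule int_span_Z[OF assms(1,2)])
  have "toroidal \<tau> G \<longleftrightarrow> Im (cnj s * t) \<noteq> 0"
  proof
    assume "Im (cnj s * t) \<noteq> 0"
    then show "toroidal \<tau> G" unfolding toroidal_iff G using assms(1,2) by blast
  next
    assume "toroidal \<tau> G"
    then obtain s' t' where s't': "s' \<in> Z_omega" "t' \<in> Z_omega" "Im (cnj s' * t') \<noteq> 0" "G = trans_gen \<tau> s' t'"
      unfolding toroidal_iff by blast
    have "(+) ` int_span s' t' = (+) ` L"
      using s't'(4) unfolding trans_gen_Z(1)[OF s't'(1,2)] GL by (rule sym)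
    then have span: "int_span s' t' = int_span s t" unfolding plus_fun_image_eq L_def .
    obtain m n :: int where mn: "s' = of_int m * s + of_int n * t"
      using int_span_generators(1)[of s' t'] unfolding span by (auto simp: int_span_def)
    obtain m' n' :: int where mn': "t' = of_int m' * s + of_int n' * t"
      using int_span_generators(2)[of t' s'] unfolding span by (auto simp: int_span_def)
    have "Im (cnj s' * t') = of_int (m * n' - n * m') * Im (cnj s * t)"
      unfolding mn mn' by (simp add: algebra_simps)
    then show "Im (cnj s * t) \<noteq> 0" using s't'(3) by auto
  qed
  moreover have "normalizer (Aut \<tau>) G = carrier (Aut \<tau>) \<longleftrightarrow> (\<forall>x\<in>L. \<omega> * x \<in> L)"
  proof
    assume N: "normalizer (Aut \<tau>) G = carrier (Aut \<tau>)"
    obtain b where b: "(\<lambda>z. \<omega> * z + b) \<in> carrier (Aut \<tau>)" using sixfold_rotation by blast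
    then have "(\<lambda>z. \<omega> * z + b) \<in> normalizer (Aut \<tau>) ((+) ` L)" unfolding GL[symmetric] N .
    then have "(*) \<omega> ` L = L" unfolding normalizer_iff[OF LZ b refl] .
    then show "\<forall>x\<in>L. \<omega> * x \<in> L" by (metis imageI)
  next
    assume closed: "\<forall>x\<in>L. \<omega> * x \<in> L"
    have pow: "\<omega> ^ k * x \<in> L" if "x \<in> L" for k x
    proof (induction k)
      case (Suc k)
      from closed[rule_format, OF this] show ?case by (simp only: power_Suc mult.assoc)
    qed (use that in simp)
    have unit: "u * x \<in> L" if u: "u \<in> units6" and x: "x \<in> L" for u x
    proof -
      obtain k where k: "u = \<omega> ^ k" using u units6_iff_omega_power by blast
      show ?thesis unfolding k by (rule pow[OF x])
    qed
    have unit_image: "(*) u ` L = L" if u: "u \<in> units6" for u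
    proof
      show "(*) u ` L \<subseteq> L" using unit[OF u] by (rule image_subsetI)
      show "L \<subseteq> (*) u ` L"
      proof
        fix x assume x: "x \<in> L"
        have "x = u * (cnj u * x)" using units6_mult_cnj[OF u] by (simp add: mult.assoc[symmetric])
        then show "x \<in> (*) u ` L" using unit[OF units6_cnj[OF u] x] by (rule image_eqI)
      qed
    qed
    have "carrier (Aut \<tau>) \<subseteq> normalizer (Aut \<tau>) G"
    proof (intro subsetI)
      fix g assume g: "g \<in> carrier (Aut \<tau>)"
      obtain a b where ab: "norm a = 1" "g = (\<lambda>z. a * z + b)" using Aut_cases[OF g] by blast
      show "g \<in> normalizer (Aut \<tau>) G"
        unfolding GL normalizer_iff[OF LZ g ab(2)] by (rule unit_image[OF linear_part_unit[OF g ab(2,1)]])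
    qed
    moreover have "normalizer (Aut \<tau>) G \<subseteq> carrier (Aut \<tau>)"
      by (auto simp: normalizer_def stabilizer_def)
    ultimately show "normalizer (Aut \<tau>) G = carrier (Aut \<tau>)" by blast
  qed
  ultimately show ?thesis unfolding almost_regular_iff_normal[OF sub] L_def by (simp only:)
qed

text \<open>Coordinates with respect to \<open>s\<close> and \<open>t\<close> turn the cosets into those of the row lattice of an integer
  matrix in \<open>\<int>\<^sup>2\<close>.\<close>

lemma glued_regions_det:
  fixes p q r u :: int
  assumes st: "s \<in> Z_omega" "t \<in> Z_omega" "Im (cnj s * t) \<noteq> 0"
    and s': "s' = of_int p * s + of_int q * t" and t': "t' = of_int r * s + of_int u * t"
    and det: "p * u - q * r \<noteq> 0"
  shows "glued_regions \<tau> (trans_gen \<tau> s' t') (trans_gen \<tau> s t) = nat \<bar>p * u - q * r\<bar>"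
proof -
  define f where "f v = of_int (fst v) * s + of_int (snd v) * t" for v :: "int \<times> int"
  have f_diff: "f v - f w = f (v - w)" for v w by (simp add: f_def algebra_simps)
  have f0: "v = 0" if "f v = 0" for v
  proof -
    have "Im (cnj s * f v) = of_int (snd v) * Im (cnj s * t)" by (simp add: f_def algebra_simps)
    then have snd: "snd v = 0" using that st(3) by simp
    have "s \<noteq> 0" using st(3) by auto
    then have "fst v = 0" using that snd by (simp add: f_def)
    then show ?thesis using snd by (simp add: prod_eq_iff)
  qed
  have inj: "inj f"
  proof (rule injI)
    fix v w assume "f v = f w"
    then have "f (v - w) = 0" unfolding f_diff[symmetric] by simp
    from f0[OF this] show "v = w" by simp
  qed
  have range: "range f = int_span s t"
  proof
    show "range f \<subseteq> int_span s t" unfolding f_def int_span_def by blast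
    have "of_int m * s + of_int n * t = f (m, n)" for m n by (simp add: f_def)
    then show "int_span s t \<subseteq> range f" unfolding int_span_def by blast
  qed
  have M: "f v \<in> int_span s' t' \<longleftrightarrow> (\<exists>i j. fst v = i * p + j * r \<and> snd v = i * q + j * u)" for v
  proof -
    have "of_int i * s' + of_int j * t' = f (i * p + j * r, i * q + j * u)" for i j :: int
      by (simp add: f_def s' t' algebra_simps)
    then have "f v \<in> int_span s' t' \<longleftrightarrow> (\<exists>i j. f v = f (i * p + j * r, i * q + j * u))"
      unfolding int_span_def by simp
    also have "\<dots> \<longleftrightarrow> (\<exists>i j. v = (i * p + j * r, i * q + j * u))"
      by (simp only: inj_eq[OF inj])
    finally have "f v \<in> int_span s' t' \<longleftrightarrow> (\<exists>i j. v = (i * p + j * r, i * q + j * u))" .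
    then show ?thesis by (simp add: prod_eq_iff)
  qed
  from int_matrix_transversal[OF det] obtain R where R_all: "card R = nat \<bar>p * u - q * r\<bar> \<and>
    (\<forall>x y. \<exists>!v. v \<in> R \<and> (\<exists>i j. x - fst v = i * p + j * r \<and> y - snd v = i * q + j * u))"
    by (rule exE)
  note R = R_all[THEN conjunct1] R_all[THEN conjunct2, rule_format]
  have R': "\<exists>!v. v \<in> R \<and> f w - f v \<in> int_span s' t'" for w
    using R(2)[of "fst w" "snd w"] unfolding f_diff M by simp
  have Z': "s' \<in> Z_omega" "t' \<in> Z_omega"
    unfolding s' t' using st by (simp_all add: Z_omega_closed)
  have "glued_regions \<tau> (trans_gen \<tau> s' t') (trans_gen \<tau> s t) = card (f ` R)"
    unfolding glued_regions_def trans_gen_Z(1)[OF st(1,2)] trans_gen_Z(1)[OF Z']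
  proof (rule card_rcosets_translations)
    show "0 \<in> int_span s' t'" using int_span_closed(4) int_span_generators(1) by blast
    show "x - y \<in> int_span s' t'" if "x \<in> int_span s' t'" "y \<in> int_span s' t'" for x y
      using int_span_closed(2)[OF that] .
    show "f ` R \<subseteq> int_span s t" unfolding range[symmetric] by blast
    show "\<exists>!x'. x' \<in> f ` R \<and> x - x' \<in> int_span s' t'" if x: "x \<in> int_span s t" for x
    proof -
      obtain w where w: "x = f w" using x unfolding range[symmetric] by blast
      obtain v where v: "v \<in> R" "f w - f v \<in> int_span s' t'"
        and uniq: "\<And>v'. \<lbrakk>v' \<in> R; f w - f v' \<in> int_span s' t'\<rbrakk> \<Longrightarrow> v' = v"
        using R'[of w] by auto
      show ?thesis
      proof (rule ex1I[of _ "f v"])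
        show "f v \<in> f ` R \<and> x - f v \<in> int_span s' t'" using v unfolding w by blast
        show "x' = f v" if "x' \<in> f ` R \<and> x - x' \<in> int_span s' t'" for x'
          using that uniq unfolding w by blast
      qed
    qed
  qed
  also have "\<dots> = card R" by (rule card_image) (rule inj_on_subset[OF inj subset_UNIV])
  finally show ?thesis using R(1) by simp
qed

text \<open>The map \<open>\<tau>\<^sub>\<eta>\<close> is the least almost regular cover, not only a minimal one: any ideal contained in
  the lattice \<open>\<int>\<alpha> + \<int>\<beta>\<close> consists of multiples of \<open>\<eta>\<close>.\<close>

theorem minimal_almost_regular_cover_unique:
  assumes gens: "lattice_generators \<alpha> \<beta> \<gamma> a b c e" and \<gamma>Z: "\<gamma> \<in> Z_omega"
    and \<eta>: "\<eta> = of_int (a * e - b * c) * \<gamma>"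
  shows "minimal_almost_regular_cover \<tau> H (trans_gen \<tau> \<alpha> \<beta>) \<longleftrightarrow> H = trans_gen \<tau> \<eta> (\<omega> * \<eta>)"
    and "glued_regions \<tau> (trans_gen \<tau> \<eta> (\<omega> * \<eta>)) (trans_gen \<tau> \<alpha> \<beta>) = nat \<bar>a * e - b * c\<bar>"
proof -
  interpret lattice_generators \<alpha> \<beta> \<gamma> a b c e by (rule gens)
  have \<eta>0: "\<eta>0 = \<eta>" unfolding \<eta> \<eta>0_def D_def by (rule refl)
  have Z: "\<alpha> \<in> Z_omega" "\<beta> \<in> Z_omega" "\<eta> \<in> Z_omega" "\<omega> * \<eta> \<in> Z_omega"
    unfolding \<alpha> \<beta> \<eta> using \<gamma>Z Z_omegaI by (simp_all add: Z_omega_closed)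
  have Im\<alpha>\<beta>: "Im (cnj \<alpha> * \<beta>) \<noteq> 0"
  proof -
    have "cnj \<alpha> * \<beta> = (cnj \<gamma> * \<gamma>) * (cnj (of_int a + of_int b * \<omega>) * (of_int c + of_int e * \<omega>))"
      by (simp add: \<alpha> \<beta>)
    then have "Im (cnj \<alpha> * \<beta>) = (norm \<gamma>)\<^sup>2 * (of_int (a * e - b * c) * Im \<omega>)"
      unfolding cnj_mult_coords cnj_mult_self by simp
    moreover have "real_of_int (a * e - b * c) \<noteq> 0" using det by (simp only: of_int_eq_0_iff not_False_eq_True)
    ultimately show ?thesis using \<gamma>0 Im_omega_pos by simp
  qed
  have "\<eta> \<noteq> 0" unfolding \<eta> using det \<gamma>0 by (simp only: mult_eq_0_iff of_int_eq_0_iff simp_thms)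
  have Im\<eta>: "Im (cnj \<eta> * (\<omega> * \<eta>)) \<noteq> 0"
  proof -
    have eq: "cnj \<eta> * (\<omega> * \<eta>) = of_real ((norm \<eta>)\<^sup>2) * \<omega>" by (simp only: cnj_mult_self[symmetric] mult_ac)
    show ?thesis unfolding eq using \<open>\<eta> \<noteq> 0\<close> Im_omega_pos by simp
  qed
  define G where "G = trans_gen \<tau> \<alpha> \<beta>"
  define E where "E = trans_gen \<tau> \<eta> (\<omega> * \<eta>)"
  have G: "G = (+) ` int_span \<alpha> \<beta>" unfolding G_def by (rule trans_gen_Z(1)[OF Z(1,2)])
  have E: "E = (+) ` (*) \<eta> ` Z_omega"
    unfolding E_def trans_gen_Z(1)[OF Z(3,4)] int_span_principal ..
  have torG: "toroidal \<tau> G" unfolding toroidal_iff G_def using Z Im\<alpha>\<beta> by blast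
  have torE: "toroidal \<tau> E" unfolding toroidal_iff E_def using Z Im\<eta> by blast
  have "\<omega> * x \<in> (*) \<eta> ` Z_omega" if "x \<in> (*) \<eta> ` Z_omega" for x
  proof -
    obtain w where "w \<in> Z_omega" "x = \<eta> * w" using \<open>x \<in> (*) \<eta> ` Z_omega\<close> by blast
    then have "\<omega> * x = \<eta> * (\<omega> * w)" "\<omega> * w \<in> Z_omega" by (simp_all add: Z_omega_closed)
    then show ?thesis by blast
  qed
  then have arE: "almost_regular \<tau> E"
    unfolding almost_regular_iff[OF Z(3,4) E_def] int_span_principal using Im\<eta> by blast
  have "(*) \<eta> ` Z_omega \<subseteq> int_span \<alpha> \<beta>" using eta_multiple_in_span unfolding \<eta>0 by blast
  then have EG: "covers \<tau> E G"
    unfolding covers_def using torE torG by (simp add: E G plus_fun_image_subset)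
  have largest: "K \<subseteq> E" if K: "almost_regular \<tau> K" "covers \<tau> K G" for K
  proof -
    obtain s t where st: "s \<in> Z_omega" "t \<in> Z_omega" "K = trans_gen \<tau> s t"
      using K(2) unfolding covers_def toroidal_iff by blast
    have KL: "K = (+) ` int_span s t" unfolding st(3) by (rule trans_gen_Z(1)[OF st(1,2)])
    have sub: "int_span s t \<subseteq> int_span \<alpha> \<beta>" using K(2) unfolding covers_def KL G plus_fun_image_subset by blast
    have "\<omega> * x \<in> int_span s t" if "x \<in> int_span s t" for x
      using K(1) that unfolding almost_regular_iff[OF st] by blast
    then have "int_span s t \<subseteq> (*) \<eta> ` Z_omega"
      using span_closed_multiple_of_eta sub unfolding \<eta>0 by blast
    then show ?thesis unfolding KL E plus_fun_image_subset .
  qed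
  have "minimal_almost_regular_cover \<tau> H G \<longleftrightarrow> H = E"
  proof
    assume H: "minimal_almost_regular_cover \<tau> H G"
    then have H': "almost_regular \<tau> H" "covers \<tau> H G" by (simp_all add: minimal_almost_regular_cover_def)
    then have "covers \<tau> H E" using largest[OF H'] torE by (simp add: covers_def)
    then show "H = E" using H arE EG unfolding minimal_almost_regular_cover_def by blast
  next
    assume "H = E"
    moreover have "K = E" if "almost_regular \<tau> K" "covers \<tau> K G" "covers \<tau> E K" for K
      using largest[OF that(1,2)] that(3) unfolding covers_def by blast
    ultimately show "minimal_almost_regular_cover \<tau> H G"
      using arE EG by (simp add: minimal_almost_regular_cover_def)
  qed
  then show "minimal_almost_regular_cover \<tau> H (trans_gen \<tau> \<alpha> \<beta>) \<longleftrightarrow> H = trans_gen \<tau> \<eta> (\<omega> * \<eta>)"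
    unfolding G_def E_def .
  show "glued_regions \<tau> (trans_gen \<tau> \<eta> (\<omega> * \<eta>)) (trans_gen \<tau> \<alpha> \<beta>) = nat \<bar>a * e - b * c\<bar>"
  proof -
    have "e * a - (- b) * (- c) \<noteq> 0" using det by (simp add: mult.commute)
    from glued_regions_det[OF Z(1,2) Im\<alpha>\<beta> eta_coords[unfolded \<eta>0] this]
    show ?thesis by (simp add: mult.commute)
  qed
qed

end

theorem theorem4p3:
  fixes \<tau> :: "complex set set" and \<alpha> \<beta> \<gamma> \<eta> :: complex
  assumes "archimedean_3_3_3_3_6 \<tau>"
    and "0 \<in> vertices \<tau>"
    and "translation_group \<tau> = trans_gen \<tau> 1 \<omega>"
    and "\<alpha> \<in> Z_omega - {0}" and "\<beta> \<in> Z_omega - {0}"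
    and "\<alpha> / \<beta> \<notin> \<rat>"
    and "is_gcd_omega \<gamma> \<alpha> \<beta>"
    and "\<eta> = of_int (Im_omega (cnj \<alpha> * \<beta>)) / N_omega \<gamma> * \<gamma>"
  shows "(\<forall>H. minimal_almost_regular_cover \<tau> H (trans_gen \<tau> \<alpha> \<beta>)
                \<longleftrightarrow> H = trans_gen \<tau> \<eta> (\<omega> * \<eta>)) \<and>
         of_nat (glued_regions \<tau> (trans_gen \<tau> \<eta> (\<omega> * \<eta>)) (trans_gen \<tau> \<alpha> \<beta>))
           = of_int \<bar>Im_omega (cnj \<alpha> * \<beta>)\<bar> / N_omega \<gamma>"
proof -
  interpret snub_hexagonal_lattice \<tau>
    by unfold_locales (rule assms(1), rule assms(3))
  have \<gamma>Z: "\<gamma> \<in> Z_omega" using assms(7) by (simp add: is_gcd_omega_def)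
  obtain \<alpha>' \<beta>' where \<alpha>\<beta>': "\<alpha>' \<in> Z_omega" "\<alpha> = \<gamma> * \<alpha>'" "\<beta>' \<in> Z_omega" "\<beta> = \<gamma> * \<beta>'"
    using assms(7) unfolding is_gcd_omega_def dvd_omega_def by blast
  obtain a b :: int where a: "\<alpha>' = of_int a + of_int b * \<omega>" using \<alpha>\<beta>'(1) by (auto simp: Z_omega_def)
  obtain c e :: int where c: "\<beta>' = of_int c + of_int e * \<omega>" using \<alpha>\<beta>'(3) by (auto simp: Z_omega_def)
  have \<gamma>0: "\<gamma> \<noteq> 0" using \<alpha>\<beta>'(2) assms(4) by auto
  obtain g h :: int where gh: "\<gamma> = of_int g + of_int h * \<omega>" using \<gamma>Z by (auto simp: Z_omega_def)
  define n where "n = g * g + h * g + h * h"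
  have n: "cnj \<gamma> * \<gamma> = of_int n" unfolding gh cnj_mult_coords n_def by simp
  then have N: "N_omega \<gamma> = of_int n" by (simp add: N_omega_def mult.commute)
  have n0: "of_int n \<noteq> (0 :: complex)" unfolding n[symmetric] using \<gamma>0 by simp
  have "cnj \<alpha> * \<beta> = (cnj \<gamma> * \<gamma>) * (cnj \<alpha>' * \<beta>')" by (simp add: \<alpha>\<beta>')
  also have "\<dots> = of_int (n * (a * c + b * c + b * e)) + of_int (n * (a * e - b * c)) * \<omega>"
    unfolding n a c cnj_mult_coords by (simp add: algebra_simps)
  finally have prod: "cnj \<alpha> * \<beta> = of_int (n * (a * c + b * c + b * e)) + of_int (n * (a * e - b * c)) * \<omega>" .
  have Im: "Im_omega (cnj \<alpha> * \<beta>) = n * (a * e - b * c)" unfolding prod by (rule Im_omega_eq)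
  have det: "a * e - b * c \<noteq> 0"
  proof
    assume 0: "a * e - b * c = 0"
    \<comment> \<open>then \<open>cnj \<alpha> * \<beta>\<close> is an integer, so \<open>\<alpha> / \<beta>\<close> is the quotient of two integers\<close>
    obtain k l :: int where kl: "cnj \<alpha> * \<alpha> = of_int k" "cnj \<alpha> * \<beta> = of_int l"
    proof -
      have "cnj \<alpha> * \<alpha> = (cnj \<gamma> * \<gamma>) * (cnj \<alpha>' * \<alpha>')" by (simp add: \<alpha>\<beta>')
      also have "\<dots> = of_int (n * (a * a + b * a + b * b))" unfolding n a cnj_mult_coords by simp
      finally show thesis by (rule that) (simp only: prod 0 mult_zero_right of_int_0 mult_zero_left add_0_right)
    qed
    have "\<alpha> / \<beta> = (cnj \<alpha> * \<alpha>) / (cnj \<alpha> * \<beta>)" using assms(4) by simp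
    then have "\<alpha> / \<beta> \<in> \<rat>" unfolding kl by simp
    then show False using assms(6) by contradiction
  qed
  have \<eta>: "\<eta> = of_int (a * e - b * c) * \<gamma>"
    unfolding assms(8) Im N using n0 by simp
  have "lattice_generators \<alpha> \<beta> \<gamma> a b c e"
    by unfold_locales (use assms(7) \<gamma>0 \<alpha>\<beta>' a c det in simp_all)
  note main = minimal_almost_regular_cover_unique[OF this \<gamma>Z \<eta>]
  have "of_nat (nat \<bar>a * e - b * c\<bar>) = (of_int \<bar>n * (a * e - b * c)\<bar> / of_int n :: complex)"
  proof -
    have "of_real ((norm \<gamma>)\<^sup>2) = (of_int n :: complex)" using n by (simp only: cnj_mult_self)
    then have "(norm \<gamma>)\<^sup>2 = of_int n" by (metis of_real_eq_iff of_real_of_int_eq)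
    then have "n \<ge> 0" by (metis of_int_0_le_iff zero_le_power2)
    then show ?thesis using n0 by (simp add: abs_mult)
  qed
  then show ?thesis unfolding main(2) Im N using main(1) by blast
qed

end
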